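(* Let $X=(x_1,\dots,x_p)\in\mathbb{R}^{n\times p}$, $y\in\mathbb{R}^n$, $\beta^*\in\mathbb{R}^p$, $\lambda_0>0$ and $\xi>1$. Let $(\widehat\beta,\widehat\sigma)$ be the scaled lasso estimator with parameter $\lambda_0$, $\sigma^*=|y-X\beta^*|_2/n^{1/2}>0$, $z^*=|X'(y-X\beta^* )/n|_\infty/\sigma^*$. Let $\mu(\lambda,\xi)$ be as defined in the context and $\tau_*=\{\lambda_0\mu(\sigma^*\lambda_0,\xi)/\sigma^*\}^{1/2}$. (i) When $z^*\le(1-\tau_*^2)\lambda_0(\xi-1)/(\xi+1)$, $$\max\big(1-\widehat\sigma/\sigma^*,\,1-\sigma^*/\widehat\sigma\big)\le\tau_*^2,\qquad |\widehat\beta-\beta^*|_1\le\mu(\sigma^*\lambda_0,\xi)/(1-\tau_*^2).$$ (ii) Suppose $|x_j|_2^2=n$ for all $j$. Let $\lambda_0\ge\{(2/n)\log(p/\epsilon)\}^{1/2}(\xi+1)/\{(\xi-1)(1-\tau_*^2)\}$. For all $\epsilon>0$ and $n-2>\log(p/\epsilon)\to\infty$, $$\mathrm{pr}_{\beta^*,\sigma}\big\{z^*\le(1-\tau_*^2)\lambda_0(\xi-1)/(\xi+1)\big\}\ge1-\{1+o(1)\}\frac{\epsilon}{\{\pi\log(p/\epsilon)\}^{1/2}}.$$ If, as $n\to\infty$ and $p\to\infty$, $\lambda_0=A\{(2/n)\log p\}^{1/2}$ with constants $\xi>1$ and $A>(\xi+1)/(\xi-1)$, and $\lambda_0\mu(\sigma\lambda_0,\xi)/\sigma=o(n^{-1/2})$,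 then $$n^{1/2}(\widehat\sigma/\sigma-1)\to N(0,1/2)$$ in distribution under $\mathrm{pr}_{\beta^*,\sigma}$.
   Context: $|v|_q$ is the $\ell_q$ norm, $|v|_\infty=\max_j|v_j|$; $v_T$ is the subvector of $v$ with indices in $T$; $T^c=\{1,\dots,p\}\setminus T$. $\mathrm{pr}_{\beta,\sigma}$ is the probability measure under which $y-X\beta\sim N(0,\sigma^2I_n)$ ($X$ deterministic). In asymptotic statements $X,\beta^*,\sigma,p,\epsilon,\lambda_0$ may depend on $n$, and $o(1)$ is as $n\to\infty$. The hypothesis on $\lambda_0$ involving the random $\tau_*$ is understood to hold (with $\tau_*<1$) almost surely. Scaled lasso: $(\widehat\beta,\widehat\sigma)=\arg\min_{\beta\in\mathbb{R}^p,\,\sigma>0}\big\{|y-X\beta|_2^2/(2n\sigma)+\sigma/2+\lambda_0|\beta|_1\big\}$. For $\xi>0$, $T\subset\{1,\dots,p\}$, let $\mathscr{C}(\xi,T)=\{u\in\mathbb{R}^p:|u_{T^c}|_1\le\xi|u_T|_1\}$ and $$\kappa(\xi,T)=\min\Big\{\frac{|T|^{1/2}|Xu|_2}{n^{1/2}|u_T|_1}:u\in\mathscr{C}(\xi,T),\,u\ne0\Big\}.$$ For $\lambda>0$, $\xi>1$, $$\mu(\lambda,\xi)=(\xi+1)\min_{T\subset\{1,\dots,p\}}\ \inf_{0<\nu<1}\max\Big[\frac{|\beta^*_{T^c}|_1}{\nu},\ \frac{\lambda|T|/\{2(1-\nu)\}}{\kappa^2\{(\xi+\nu)/(1-\nu),T\}}\Big],$$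 where the second entry of the maximum is $0$ if $T=\emptyset$ and $+\infty$ if $T\ne\emptyset$ and $\kappa=0$. Quantities with denominator $1-\tau_*^2$ are read as $+\infty$ if $\tau_*=1$. *)

theory Defs
  imports "HOL-Probability.Probability" "HOL-Library.Landau_Symbols"
begin

text \<open>
  Since the dimensions \<open>n\<close> and \<open>p\<close> vary in the asymptotic part, a vector of length \<open>p\<close> is a
  function \<open>nat \<Rightarrow> real\<close> of which only the values at indices in \<open>{..<p}\<close> are ever read, and an
  \<open>n \<times> p\<close> matrix is a function \<open>X\<close> with entries \<open>X i j\<close> for \<open>i < n\<close>, \<open>j < p\<close>.  Indices start
  at 0.  Euclidean norms are \<^const>\<open>L2_set\<close> over the index set.
\<close>

definition l1_norm :: "nat set \<Rightarrow> (nat \<Rightarrow> real) \<Rightarrow> real" where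
  "l1_norm T v = (\<Sum>j\<in>T. \<bar>v j\<bar>)"

definition linf_norm :: "nat \<Rightarrow> (nat \<Rightarrow> real) \<Rightarrow> real" where
  "linf_norm p v = (MAX j\<in>{..<p}. \<bar>v j\<bar>)"

definition mat_vec :: "nat \<Rightarrow> (nat \<Rightarrow> nat \<Rightarrow> real) \<Rightarrow> (nat \<Rightarrow> real) \<Rightarrow> nat \<Rightarrow> real" where
  "mat_vec p X b = (\<lambda>i. \<Sum>j<p. X i j * b j)"

definition resid ::
  "nat \<Rightarrow> (nat \<Rightarrow> nat \<Rightarrow> real) \<Rightarrow> (nat \<Rightarrow> real) \<Rightarrow> (nat \<Rightarrow> real) \<Rightarrow> nat \<Rightarrow> real" where
  "resid p X y b = (\<lambda>i. y i - mat_vec p X b i)"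

definition scaled_lasso_loss ::
  "nat \<Rightarrow> nat \<Rightarrow> (nat \<Rightarrow> nat \<Rightarrow> real) \<Rightarrow> (nat \<Rightarrow> real) \<Rightarrow> real \<Rightarrow> (nat \<Rightarrow> real) \<times> real \<Rightarrow> real" where
  "scaled_lasso_loss n p X y lam0 = (\<lambda>(b, s).
     (L2_set (resid p X y b) {..<n})\<^sup>2 / (2 * real n * s) + s / 2 + lam0 * l1_norm {..<p} b)"

text \<open>Minimisers need not be unique; any of them counts as the scaled lasso.\<close>

definition is_scaled_lasso ::
  "nat \<Rightarrow> nat \<Rightarrow> (nat \<Rightarrow> nat \<Rightarrow> real) \<Rightarrow> (nat \<Rightarrow> real) \<Rightarrow> real \<Rightarrow> (nat \<Rightarrow> real) \<Rightarrow> real \<Rightarrow> bool" where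
  "is_scaled_lasso n p X y lam0 b s \<longleftrightarrow>
     is_arg_min (scaled_lasso_loss n p X y lam0) (\<lambda>(b, s). s > 0) (b, s)"

text \<open>
  The scaled lasso as a function of the data.  For some \<open>y\<close> (e.g. \<open>y = 0\<close>)
  the infimum over \<open>s > 0\<close> may only be approached as \<open>s\<close> tends to 0; there the
  estimator is left unconstrained.
\<close>

definition scaled_lasso_estimator ::
  "nat \<Rightarrow> nat \<Rightarrow> (nat \<Rightarrow> nat \<Rightarrow> real) \<Rightarrow> real \<Rightarrow>
   ((nat \<Rightarrow> real) \<Rightarrow> nat \<Rightarrow> real) \<Rightarrow> ((nat \<Rightarrow> real) \<Rightarrow> real) \<Rightarrow> bool" where
  "scaled_lasso_estimator n p X lam0 bhat shat \<longleftrightarrow>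
     (\<forall>y \<in> {..<n} \<rightarrow>\<^sub>E UNIV. (\<exists>b s. is_scaled_lasso n p X y lam0 b s) \<longrightarrow>
        is_scaled_lasso n p X y lam0 (bhat y) (shat y))"

definition sigma_star ::
  "nat \<Rightarrow> nat \<Rightarrow> (nat \<Rightarrow> nat \<Rightarrow> real) \<Rightarrow> (nat \<Rightarrow> real) \<Rightarrow> (nat \<Rightarrow> real) \<Rightarrow> real" where
  "sigma_star n p X y \<beta> = L2_set (resid p X y \<beta>) {..<n} / sqrt (real n)"

definition z_star ::
  "nat \<Rightarrow> nat \<Rightarrow> (nat \<Rightarrow> nat \<Rightarrow> real) \<Rightarrow> (nat \<Rightarrow> real) \<Rightarrow> (nat \<Rightarrow> real) \<Rightarrow> real" where
  "z_star n p X y \<beta> =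
     linf_norm p (\<lambda>j. (\<Sum>i<n. X i j * resid p X y \<beta> i) / real n) / sigma_star n p X y \<beta>"

definition lasso_cone :: "nat \<Rightarrow> real \<Rightarrow> nat set \<Rightarrow> (nat \<Rightarrow> real) set" where
  "lasso_cone p \<xi> T = {u. l1_norm ({..<p} - T) u \<le> \<xi> * l1_norm T u}"

text \<open>
  For nonempty \<open>T\<close> the infimum is a minimum (continuity and homogeneity of degree 0), and on the
  index set of the infimum the restriction of \<open>u\<close> to \<open>T\<close> is nonzero.
\<close>

definition kappa :: "nat \<Rightarrow> nat \<Rightarrow> (nat \<Rightarrow> nat \<Rightarrow> real) \<Rightarrow> real \<Rightarrow> nat set \<Rightarrow> real" where
  "kappa n p X \<xi> T =
     (INF u \<in> {u \<in> lasso_cone p \<xi> T. \<exists>j<p. u j \<noteq> 0}.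
        sqrt (real (card T)) * L2_set (mat_vec p X u) {..<n} / (sqrt (real n) * l1_norm T u))"

definition mu_entry ::
  "nat \<Rightarrow> nat \<Rightarrow> (nat \<Rightarrow> nat \<Rightarrow> real) \<Rightarrow> real \<Rightarrow> real \<Rightarrow> nat set \<Rightarrow> real \<Rightarrow> ereal" where
  "mu_entry n p X lam \<xi> T \<nu> =
     (let \<kappa> = kappa n p X ((\<xi> + \<nu>) / (1 - \<nu>)) T in
      if T = {} then 0
      else if \<kappa> = 0 then \<infinity>
      else ereal (lam * real (card T) / (2 * (1 - \<nu>)) / \<kappa>\<^sup>2))"

definition mu_ext ::
  "nat \<Rightarrow> nat \<Rightarrow> (nat \<Rightarrow> nat \<Rightarrow> real) \<Rightarrow> (nat \<Rightarrow> real) \<Rightarrow> real \<Rightarrow> real \<Rightarrow> ereal" where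
  "mu_ext n p X \<beta> lam \<xi> =
     ereal (\<xi> + 1) *
     (MIN T \<in> Pow {..<p}. INF \<nu> \<in> {0<..<1::real}.
        max (ereal (l1_norm ({..<p} - T) \<beta> / \<nu>)) (mu_entry n p X lam \<xi> T \<nu>))"

definition mu ::
  "nat \<Rightarrow> nat \<Rightarrow> (nat \<Rightarrow> nat \<Rightarrow> real) \<Rightarrow> (nat \<Rightarrow> real) \<Rightarrow> real \<Rightarrow> real \<Rightarrow> real" where
  "mu n p X \<beta> lam \<xi> = real_of_ereal (mu_ext n p X \<beta> lam \<xi>)"

text \<open>The choice \<open>T = {}\<close> keeps the minimum finite, so the conversion to \<^typ>\<open>real\<close> loses nothing.\<close>

lemma ereal_mu:
  assumes "\<xi> > 1"
  shows "ereal (mu n p X \<beta> lam \<xi>) = mu_ext n p X \<beta> lam \<xi>"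
proof -
  define F where "F = (\<lambda>T. INF \<nu> \<in> {0<..<1::real}.
        max (ereal (l1_norm ({..<p} - T) \<beta> / \<nu>)) (mu_entry n p X lam \<xi> T \<nu>))"
  have fin: "finite (F ` Pow {..<p})" and ne: "F ` Pow {..<p} \<noteq> {}" by auto
  have "0 \<le> F T" for T
    unfolding F_def by (rule INF_greatest) (auto simp: le_max_iff_disj l1_norm_def sum_nonneg)
  then have lo: "0 \<le> Min (F ` Pow {..<p})"
    using fin ne by simp
  have "Min (F ` Pow {..<p}) \<le> F {}"
    using fin by (intro Min_le) auto
  also have "F {} \<le> max (ereal (l1_norm ({..<p} - {}) \<beta> / (1/2))) (mu_entry n p X lam \<xi> {} (1/2))"
    unfolding F_def by (rule INF_lower) auto
  also have "\<dots> < \<infinity>"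
    by (simp add: mu_entry_def max_def)
  finally have hi: "Min (F ` Pow {..<p}) < \<infinity>" .
  then obtain r where r: "Min (F ` Pow {..<p}) = ereal r"
    using lo by (cases "Min (F ` Pow {..<p})") auto
  have "mu_ext n p X \<beta> lam \<xi> = ereal (\<xi> + 1) * Min (F ` Pow {..<p})"
    by (simp add: mu_ext_def F_def)
  then show ?thesis
    unfolding mu_def using r by simp
qed

definition tau_star ::
  "nat \<Rightarrow> nat \<Rightarrow> (nat \<Rightarrow> nat \<Rightarrow> real) \<Rightarrow> (nat \<Rightarrow> real) \<Rightarrow> (nat \<Rightarrow> real) \<Rightarrow> real \<Rightarrow> real \<Rightarrow> real" where
  "tau_star n p X y \<beta> lam0 \<xi> =
     (let s = sigma_star n p X y \<beta> in sqrt (lam0 * mu n p X \<beta> (s * lam0) \<xi> / s))"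

definition noise_event ::
  "nat \<Rightarrow> nat \<Rightarrow> (nat \<Rightarrow> nat \<Rightarrow> real) \<Rightarrow> (nat \<Rightarrow> real) \<Rightarrow> (nat \<Rightarrow> real) \<Rightarrow> real \<Rightarrow> real \<Rightarrow> bool" where
  "noise_event n p X y \<beta> lam0 \<xi> \<longleftrightarrow>
     z_star n p X y \<beta> \<le> (1 - (tau_star n p X y \<beta> lam0 \<xi>)\<^sup>2) * lam0 * (\<xi> - 1) / (\<xi> + 1)"

text \<open>
  The law of the response \<open>y\<close>: independent coordinates with means \<open>(X \<beta>)\<^sub>i\<close> and common
  variance \<open>\<sigma>\<^sup>2\<close>.
\<close>

definition response_law ::
  "nat \<Rightarrow> nat \<Rightarrow> (nat \<Rightarrow> nat \<Rightarrow> real) \<Rightarrow> (nat \<Rightarrow> real) \<Rightarrow> real \<Rightarrow> (nat \<Rightarrow> real) measure" where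
  "response_law n p X \<beta> \<sigma> =
     PiM {..<n} (\<lambda>i. density lborel (\<lambda>t. ennreal (normal_density (mat_vec p X \<beta> i) \<sigma> t)))"

lemma prob_space_response_law: "\<sigma> > 0 \<Longrightarrow> prob_space (response_law n p X \<beta> \<sigma>)"
  unfolding response_law_def by (intro prob_space_PiM prob_space_normal_density)

end

theory Submission
  imports Defs "HOL-Real_Asymp.Real_Asymp"
begin

text \<open>
  Minimality of a penalised least squares fit is used only through the variational inequality
  \<open>lasso_vi\<close>, tested at \<open>\<beta>\<close> and at its reflection.  It yields the cone argument for the \<open>\<ell>\<^sub>1\<close> error
  and bounds the difference of the squared residual scales by that error.  The lower bound for the
  scale estimate compares the square-root lasso with an auxiliary lasso of penalty
  \<open>(1 - \<tau>\<^sup>2) \<sigma>\<^sup>* \<lambda>\<^sub>0\<close>.  As square-root lasso solutions always exist, it also shows that the infimum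
  of the scaled lasso loss over \<open>\<sigma> > 0\<close> is attained on the noise event.

  For the noise event, rotation invariance reduces the tail of a normalised inner product to a
  standard normal variable against an independent chi variable, where Mills' bound gives the sharp
  constant.  The limit law is that of the oracle scale (central limit theorem for squared normals
  and the delta method), since on the noise event the two scales differ by \<open>o(n\<^sup>-\<^sup>1\<^sup>/\<^sup>2)\<close>.
\<close>

subsection \<open>Lasso minimisers\<close>

text \<open>The auxiliary lasso breaks a circularity. The error bound for the fit with penalty
  \<open>shat * lam0\<close> needs the noise to lie below a multiple of that penalty, hence a lower
  bound on \<open>shat\<close>; but a bound on \<open>shat\<close> is to be drawn from the error
  bound. The auxiliary penalty does not depend on the fit, so the noise event applies to it
  directly. Write s for the oracle scale, q for \<tau> squared and t = (1 - q) s. If the square-root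
  lasso scale were below t, the auxiliary residual scale would be at most t, and the error bound
  would give q (2 - q) <= 2 q (1 - q), impossible for q > 0. The case q = 0 forces \<beta> = 0 and
  has its own argument. The sharp probability constant is delicate because conditioning leaves n - 1
  degrees of freedom. With w^2 = 2 L / n, the power (1 - w^2)^((n-1)/2) must still be at most
  exp(-L); the second-order term of log(1 - w^2) pays for the missing degree as soon as n <= (n - 1)
  L. The mean of 1/|g|^2 in n - 1 dimensions is 1/(n - 3), and this becomes the factor sqrt(n/(n -
  3)) = 1 + o(1).\<close>

lemma L2_set_power2: "(L2_set f A)\<^sup>2 = (\<Sum>i\<in>A. (f i)\<^sup>2)"
  by (simp add: L2_set_def sum_nonneg)

lemma l1_norm_nonneg: "0 \<le> l1_norm T v"
  by (simp add: l1_norm_def sum_nonneg)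

lemma sigma_star_nonneg: "0 \<le> sigma_star n p X y b"
  by (simp add: sigma_star_def)

lemma sigma_star_power2: "(sigma_star n p X y b)\<^sup>2 = (\<Sum>i<n. (resid p X y b i)\<^sup>2) / real n"
  by (simp add: sigma_star_def power_divide L2_set_power2)

text \<open>The penalty makes the objective coercive: once a coordinate exceeds \<open>M\<close>,
  the penalty alone exceeds the value at 0. Only the \<open>p\<close> coordinates that are read
  range over \<open>{-M..M}\<close>, the others being pinned to 0, so the box is compact in the
  product topology by Tychonoff.\<close>

lemma l1_penalised_attains:
  fixes f :: "(nat \<Rightarrow> real) \<Rightarrow> real"
  assumes cont: "continuous_on UNIV f" and nonneg: "\<And>b. 0 \<le> f b"
    and dep: "\<And>b b'. (\<And>j. j < p \<Longrightarrow> b j = b' j) \<Longrightarrow> f b = f b'" and lam: "lam > 0"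
  shows "\<exists>b. \<forall>v. f b + lam * l1_norm {..<p} b \<le> f v + lam * l1_norm {..<p} v"
proof -
  define M where "M = f (\<lambda>_. 0) / lam"
  define C where "C = PiE UNIV (\<lambda>j. if j < p then {-M..M} else {0::real})"
  let ?g = "\<lambda>b. f b + lam * l1_norm {..<p} b"
  have M: "M \<ge> 0" using nonneg lam by (simp add: M_def)
  have "compactin (product_topology (\<lambda>_. euclidean) UNIV) C"
    unfolding C_def by (subst compactin_PiE) auto
  then have compact: "compact C" by (simp add: euclidean_product_topology)
  have C0: "(\<lambda>_. 0) \<in> C" using M by (auto simp: C_def)
  have "continuous_on C ?g" unfolding l1_norm_def
    by (intro continuous_intros continuous_on_subset[OF cont] subset_UNIV
        continuous_on_product_then_coordinatewise[OF continuous_on_id])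
  then obtain b where b: "b \<in> C" "\<And>v. v \<in> C \<Longrightarrow> ?g b \<le> ?g v"
    using continuous_attains_inf[OF compact] C0 by blast
  have "?g b \<le> ?g v" for v
  proof (cases "\<forall>j<p. \<bar>v j\<bar> \<le> M")
    case True
    define w where "w j = (if j < p then v j else 0)" for j
    have "w \<in> C" using True by (auto simp: C_def w_def abs_le_iff minus_le_iff)
    moreover have "f w = f v" by (rule dep) (simp add: w_def)
    moreover have "l1_norm {..<p} w = l1_norm {..<p} v" by (simp add: l1_norm_def w_def)
    ultimately show ?thesis using b(2)[of w] by simp
  next
    case False
    then obtain j where j: "j < p" "\<bar>v j\<bar> > M" by force
    have "M \<le> l1_norm {..<p} v"
      using j member_le_sum[of j "{..<p}" "\<lambda>j. \<bar>v j\<bar>"] by (simp add: l1_norm_def)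
    then have "f (\<lambda>_. 0) \<le> lam * l1_norm {..<p} v"
      using lam by (simp add: M_def pos_divide_le_eq mult.commute)
    moreover have "?g b \<le> f (\<lambda>_. 0)" using b(2)[OF C0] by (simp add: l1_norm_def)
    ultimately show ?thesis using nonneg[of v] by linarith
  qed
  then show ?thesis by blast
qed

lemma continuous_on_resid: "continuous_on UNIV (\<lambda>b. resid p X y b i)"
  unfolding resid_def mat_vec_def
  by (intro continuous_intros continuous_on_product_then_coordinatewise[OF continuous_on_id])

lemma resid_cong: "(\<And>j. j < p \<Longrightarrow> b j = b' j) \<Longrightarrow> resid p X y b = resid p X y b'"
  by (simp add: resid_def mat_vec_def)

lemma resid_line:
  "resid p X y (\<lambda>j. b j + t * (v j - b j)) i = resid p X y b i + t * (resid p X y v i - resid p X y b i)"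
  by (simp add: resid_def mat_vec_def algebra_simps sum.distrib sum_subtractf sum_distrib_left)

lemma resid_diff: "resid p X y v i - resid p X y b i = mat_vec p X (\<lambda>j. b j - v j) i"
  by (simp add: resid_def mat_vec_def algebra_simps sum_subtractf)

lemma l1_norm_line:
  assumes "0 \<le> t" "t \<le> 1"
  shows "l1_norm A (\<lambda>j. b j + t * (v j - b j)) \<le> l1_norm A b + t * (l1_norm A v - l1_norm A b)"
proof -
  have "\<bar>b j + t * (v j - b j)\<bar> \<le> \<bar>b j\<bar> + t * (\<bar>v j\<bar> - \<bar>b j\<bar>)" for j
  proof -
    have "b j + t * (v j - b j) = (1 - t) * b j + t * v j" by (simp add: algebra_simps)
    also have "\<bar>\<dots>\<bar> \<le> (1 - t) * \<bar>b j\<bar> + t * \<bar>v j\<bar>"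
      using assms abs_triangle_ineq[of "(1 - t) * b j" "t * v j"] by (simp add: abs_mult)
    finally show ?thesis by (simp add: algebra_simps)
  qed
  then have "l1_norm A (\<lambda>j. b j + t * (v j - b j)) \<le> (\<Sum>j\<in>A. \<bar>b j\<bar> + t * (\<bar>v j\<bar> - \<bar>b j\<bar>))"
    unfolding l1_norm_def by (rule sum_mono)
  then show ?thesis
    by (simp add: l1_norm_def sum.distrib sum_distrib_left sum_subtractf right_diff_distrib)
qed

text \<open>First-order condition for minimising half the mean squared residual plus
  \<open>lam\<close> times the l1 norm: the quadratic part is linearised at \<open>b\<close>, the
  penalty is kept as a difference. By convexity it is equivalent to minimality, and it avoids
  subgradients.\<close>

definition lasso_vi ::
  "nat \<Rightarrow> nat \<Rightarrow> (nat \<Rightarrow> nat \<Rightarrow> real) \<Rightarrow> (nat \<Rightarrow> real) \<Rightarrow> real \<Rightarrow> (nat \<Rightarrow> real) \<Rightarrow> bool" where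
  "lasso_vi n p X y lam b \<longleftrightarrow>
     (\<forall>v. (\<Sum>i<n. resid p X y b i * (resid p X y b i - resid p X y v i)) / real n
            \<le> lam * (l1_norm {..<p} v - l1_norm {..<p} b))"

text \<open>Moving from \<open>b\<close> towards \<open>v\<close> by a fraction t changes the
  quadratic part by - t a + t^2 q / 2 and the penalty by at most t D. Minimality gives a - D <= t q
  / 2 for all t in (0, 1], and t can be taken arbitrarily small.\<close>

lemma lasso_viI:
  assumes lam: "lam > 0"
    and min: "\<And>v. (sigma_star n p X y b)\<^sup>2 / 2 + lam * l1_norm {..<p} b
                \<le> (sigma_star n p X y v)\<^sup>2 / 2 + lam * l1_norm {..<p} v"
  shows "lasso_vi n p X y lam b"
  unfolding lasso_vi_def
proof
  fix v
  let ?R = "resid p X y"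
  define a where "a = (\<Sum>i<n. ?R b i * (?R b i - ?R v i)) / real n"
  define q where "q = (\<Sum>i<n. (?R b i - ?R v i)\<^sup>2) / real n"
  define D where "D = lam * (l1_norm {..<p} v - l1_norm {..<p} b)"
  have q: "q \<ge> 0" by (simp add: q_def sum_nonneg)
  have key: "a - D \<le> t * q / 2" if t: "0 < t" "t \<le> 1" for t
  proof -
    have "(sigma_star n p X y (\<lambda>j. b j + t * (v j - b j)))\<^sup>2 = (sigma_star n p X y b)\<^sup>2 - 2 * t * a + t\<^sup>2 * q"
    proof -
      have "(\<Sum>i<n. (?R b i + t * (?R v i - ?R b i))\<^sup>2)
          = (\<Sum>i<n. (?R b i)\<^sup>2 - 2 * t * (?R b i * (?R b i - ?R v i)) + t\<^sup>2 * (?R b i - ?R v i)\<^sup>2)"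
        by (intro sum.cong refl) (simp add: power2_eq_square algebra_simps)
      then show ?thesis
        by (simp add: sigma_star_power2 resid_line a_def q_def sum.distrib sum_subtractf
            add_divide_distrib diff_divide_distrib flip: sum_distrib_left)
    qed
    moreover have "lam * l1_norm {..<p} (\<lambda>j. b j + t * (v j - b j)) \<le> lam * l1_norm {..<p} b + t * D"
      using mult_left_mono[OF l1_norm_line[of t "{..<p}" b v], of lam] t lam
      by (simp add: D_def algebra_simps)
    ultimately have "0 \<le> - t * a + t\<^sup>2 * q / 2 + t * D"
      using min[of "\<lambda>j. b j + t * (v j - b j)"] by (simp add: add_divide_distrib diff_divide_distrib)
    then have "t * (a - D) \<le> t * (t * q / 2)" by (simp add: power2_eq_square algebra_simps)
    then show ?thesis using t by simp
  qed
  have "a \<le> D"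
  proof (rule ccontr)
    assume "\<not> a \<le> D"
    then have pos: "a - D > 0" by simp
    \<comment> \<open>Short enough that t q <= a - D, which contradicts a - D <= t q / 2. The
      \<open>+ 1\<close> guards against q = 0.\<close>
    define t where "t = min 1 ((a - D) / (q + 1))"
    have t: "0 < t" "t \<le> 1" "t \<le> (a - D) / (q + 1)" using pos q by (auto simp: t_def)
    have "t * q \<le> t * (q + 1)" using t by simp
    also have "\<dots> \<le> a - D" using t(3) q by (simp add: pos_le_divide_eq)
    finally show False using key[OF t(1,2)] pos by simp
  qed
  then show "(\<Sum>i<n. ?R b i * (?R b i - ?R v i)) / real n \<le> lam * (l1_norm {..<p} v - l1_norm {..<p} b)"
    by (simp add: a_def D_def)
qed

lemma continuous_on_sigma_star: "continuous_on UNIV (sigma_star n p X y)"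
  unfolding sigma_star_def L2_set_def divide_inverse
  by (intro continuous_intros continuous_on_resid)

lemma sigma_star_cong: "(\<And>j. j < p \<Longrightarrow> b j = b' j) \<Longrightarrow> sigma_star n p X y b = sigma_star n p X y b'"
  using resid_cong[of p b b'] by (simp add: sigma_star_def)

lemma lasso_vi_exists:
  assumes lam: "lam > 0"
  shows "\<exists>b. lasso_vi n p X y lam b"
proof -
  have "\<exists>b. \<forall>v. (sigma_star n p X y b)\<^sup>2 / 2 + lam * l1_norm {..<p} b
                \<le> (sigma_star n p X y v)\<^sup>2 / 2 + lam * l1_norm {..<p} v"
  proof (rule l1_penalised_attains[OF _ _ _ lam])
    show "continuous_on UNIV (\<lambda>b. (sigma_star n p X y b)\<^sup>2 / 2)"
      by (intro continuous_intros continuous_on_sigma_star) simp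
    show "(sigma_star n p X y b)\<^sup>2 / 2 = (sigma_star n p X y b')\<^sup>2 / 2"
      if "\<And>j. j < p \<Longrightarrow> b j = b' j" for b b'
      using sigma_star_cong[OF that] by simp
  qed simp
  then show ?thesis using lasso_viI[OF lam] by blast
qed

lemma sqrt_lasso_exists:
  assumes lam: "lam0 > 0"
  shows "\<exists>b. \<forall>v. sigma_star n p X y b + lam0 * l1_norm {..<p} b
                \<le> sigma_star n p X y v + lam0 * l1_norm {..<p} v"
  by (rule l1_penalised_attains[OF continuous_on_sigma_star sigma_star_nonneg sigma_star_cong lam]) auto

section \<open>From the scaled lasso to the square-root lasso and back\<close>

lemma scaled_lasso_loss_eq:
  "scaled_lasso_loss n p X y lam0 (b, s) = (sigma_star n p X y b)\<^sup>2 / (2 * s) + s / 2 + lam0 * l1_norm {..<p} b"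
  by (simp add: scaled_lasso_loss_def sigma_star_def power_divide)

lemma is_scaled_lasso_iff:
  "is_scaled_lasso n p X y lam0 b s \<longleftrightarrow> s > 0 \<and>
     (\<forall>v t. t > 0 \<longrightarrow> (sigma_star n p X y b)\<^sup>2 / (2 * s) + s / 2 + lam0 * l1_norm {..<p} b
                    \<le> (sigma_star n p X y v)\<^sup>2 / (2 * t) + t / 2 + lam0 * l1_norm {..<p} v)"
  unfolding is_scaled_lasso_def is_arg_min_linorder by (auto simp: scaled_lasso_loss_eq)

lemma le_scale_loss:
  fixes a t :: real assumes "t > 0"
  shows "a \<le> a\<^sup>2 / (2 * t) + t / 2"
proof -
  have "0 \<le> (a - t)\<^sup>2 / (2 * t)" using assms by simp
  also have "\<dots> = a\<^sup>2 / (2 * t) + t / 2 - a" using assms by (simp add: power2_eq_square field_simps)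
  finally show ?thesis by simp
qed

lemma is_scaled_lasso_scale:
  assumes "is_scaled_lasso n p X y lam0 b s"
  shows "s = sigma_star n p X y b"
proof -
  let ?a = "sigma_star n p X y b"
  have s: "s > 0" and min: "\<And>t. t > 0 \<Longrightarrow> ?a\<^sup>2 / (2 * s) + s / 2 \<le> ?a\<^sup>2 / (2 * t) + t / 2"
    using assms unfolding is_scaled_lasso_iff by (auto dest!: spec[of _ b])
  show ?thesis
  proof (cases "?a > 0")
    case True
    have "?a\<^sup>2 / (2 * s) + s / 2 \<le> ?a" using min[OF True] True by (simp add: power2_eq_square)
    moreover have "?a\<^sup>2 / (2 * s) + s / 2 = ?a + (?a - s)\<^sup>2 / (2 * s)"
      using s by (simp add: power2_eq_square field_simps)
    ultimately show ?thesis using s by (simp add: divide_le_0_iff)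
  next
    case False
    \<comment> \<open>With zero residual the scale enters the loss only as s / 2, and halving s
      would lower it, so this case is contradictory.\<close>
    then have "?a = 0" using sigma_star_nonneg[of n p X y b] by simp
    then show ?thesis using min[of "s / 2"] s by simp
  qed
qed

text \<open>With the scale frozen at its optimal value \<open>s\<close>, multiplying the loss by
  \<open>s\<close> leaves an ordinary lasso problem in \<open>b\<close> with penalty
  \<open>s * lam0\<close>.\<close>

lemma is_scaled_lasso_vi:
  assumes "is_scaled_lasso n p X y lam0 b s" "lam0 > 0"
  shows "lasso_vi n p X y (s * lam0) b"
proof (rule lasso_viI)
  have s: "s > 0" using assms by (simp add: is_scaled_lasso_iff)
  then show "s * lam0 > 0" using assms by simp
  fix v
  have "(sigma_star n p X y b)\<^sup>2 / (2 * s) + lam0 * l1_norm {..<p} b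
       \<le> (sigma_star n p X y v)\<^sup>2 / (2 * s) + lam0 * l1_norm {..<p} v"
    using assms s unfolding is_scaled_lasso_iff by (auto dest!: spec[of _ v] spec[of _ s])
  moreover have "x / 2 + s * lam0 * l = s * (x / (2 * s) + lam0 * l)" for x l
    using s by (simp add: field_simps)
  ultimately show "(sigma_star n p X y b)\<^sup>2 / 2 + s * lam0 * l1_norm {..<p} b
       \<le> (sigma_star n p X y v)\<^sup>2 / 2 + s * lam0 * l1_norm {..<p} v"
    using s by simp
qed

text \<open>Minimising the loss over the scale turns the scaled lasso into the square-root lasso.\<close>

lemma is_scaled_lasso_sqrt_lasso:
  assumes "is_scaled_lasso n p X y lam0 b s"
  shows "sigma_star n p X y b + lam0 * l1_norm {..<p} b
           \<le> sigma_star n p X y v + lam0 * l1_norm {..<p} v"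
proof (rule field_le_epsilon)
  \<comment> \<open>The best scale for \<open>v\<close> is its residual scale, which may be 0 and is
    then not admissible. Enlarging it by \<open>e\<close> costs at most e / 2.\<close>
  fix e :: real assume e: "e > 0"
  let ?a = "sigma_star n p X y v"
  have s: "s > 0" using assms by (simp add: is_scaled_lasso_iff)
  have a: "?a \<ge> 0" by (rule sigma_star_nonneg)
  have "sigma_star n p X y b + lam0 * l1_norm {..<p} b
      \<le> (sigma_star n p X y b)\<^sup>2 / (2 * s) + s / 2 + lam0 * l1_norm {..<p} b"
    using le_scale_loss[OF s] by simp
  also have "\<dots> \<le> ?a\<^sup>2 / (2 * (?a + e)) + (?a + e) / 2 + lam0 * l1_norm {..<p} v"
    using assms a e unfolding is_scaled_lasso_iff by (auto dest!: spec[of _ v] spec[of _ "?a + e"])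
  also have "?a\<^sup>2 / (2 * (?a + e)) \<le> ?a / 2"
    using a e by (simp add: field_simps power2_eq_square)
  finally show "sigma_star n p X y b + lam0 * l1_norm {..<p} b
           \<le> sigma_star n p X y v + lam0 * l1_norm {..<p} v + e"
    using e by simp argo
qed

text \<open>Positivity makes the residual scale an admissible competitor in the scaled problem.
  Together with \<open>sqrt_lasso_exists\<close> this shows that the scaled lasso exists at data
  where the scale is bounded away from 0.\<close>

lemma sqrt_lasso_is_scaled_lasso:
  assumes "\<And>v. sigma_star n p X y b + lam0 * l1_norm {..<p} b
           \<le> sigma_star n p X y v + lam0 * l1_norm {..<p} v"
    and pos: "sigma_star n p X y b > 0"
  shows "is_scaled_lasso n p X y lam0 b (sigma_star n p X y b)"
  unfolding is_scaled_lasso_iff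
proof (intro conjI allI impI pos)
  fix v and t :: real assume t: "t > 0"
  show "(sigma_star n p X y b)\<^sup>2 / (2 * sigma_star n p X y b) + sigma_star n p X y b / 2 + lam0 * l1_norm {..<p} b
         \<le> (sigma_star n p X y v)\<^sup>2 / (2 * t) + t / 2 + lam0 * l1_norm {..<p} v"
    using assms(1)[of v] le_scale_loss[OF t, of "sigma_star n p X y v"] pos
    by (simp add: power2_eq_square)
qed

subsection \<open>The error bound \<open>\<mu>\<close>\<close>

text \<open>Interface to \<open>mu\<close>: the minimum over T and the infimum over \<nu> become a
  universal statement, so a lower bound on \<open>mu\<close> is proved, or used, for one pair T,
  \<nu> at a time.\<close>

lemma le_mu_iff:
  assumes \<xi>: "\<xi> > 1"
  shows "D \<le> mu n p X \<beta> lam \<xi> \<longleftrightarrow> (\<forall>T \<nu>. T \<subseteq> {..<p} \<longrightarrow> 0 < \<nu> \<longrightarrow> \<nu> < 1 \<longrightarrow>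
     ereal (D / (\<xi> + 1)) \<le> max (ereal (l1_norm ({..<p} - T) \<beta> / \<nu>)) (mu_entry n p X lam \<xi> T \<nu>))"
proof -
  define F where "F = (\<lambda>T. INF \<nu> \<in> {0<..<1::real}.
        max (ereal (l1_norm ({..<p} - T) \<beta> / \<nu>)) (mu_entry n p X lam \<xi> T \<nu>))"
  have "D \<le> mu n p X \<beta> lam \<xi> \<longleftrightarrow> ereal D \<le> ereal (\<xi> + 1) * Min (F ` Pow {..<p})"
    using ereal_mu[OF \<xi>, of n p X \<beta> lam] by (simp add: mu_ext_def F_def flip: ereal_less_eq(3))
  also have "\<dots> \<longleftrightarrow> ereal (D / (\<xi> + 1)) \<le> Min (F ` Pow {..<p})"
    using \<xi> by (cases "Min (F ` Pow {..<p})") (auto simp: pos_divide_le_eq mult.commute)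
  also have "\<dots> \<longleftrightarrow> (\<forall>T\<subseteq>{..<p}. ereal (D / (\<xi> + 1)) \<le> F T)"
    by (subst Min_ge_iff) auto
  also have "\<dots> \<longleftrightarrow> (\<forall>T \<nu>. T \<subseteq> {..<p} \<longrightarrow> 0 < \<nu> \<longrightarrow> \<nu> < 1 \<longrightarrow>
     ereal (D / (\<xi> + 1)) \<le> max (ereal (l1_norm ({..<p} - T) \<beta> / \<nu>)) (mu_entry n p X lam \<xi> T \<nu>))"
    unfolding F_def by (auto simp: le_INF_iff)
  finally show ?thesis .
qed

lemma mu_nonneg: "\<xi> > 1 \<Longrightarrow> 0 \<le> mu n p X \<beta> lam \<xi>"
  by (subst le_mu_iff) (auto simp: le_max_iff_disj l1_norm_nonneg)

lemma mu_entry_mono: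
  assumes "\<nu> < 1" "lam \<le> lam'"
  shows "mu_entry n p X lam \<xi> T \<nu> \<le> mu_entry n p X lam' \<xi> T \<nu>"
  using assms by (auto simp: mu_entry_def Let_def intro!: divide_right_mono mult_right_mono)

lemma mu_mono:
  assumes "\<xi> > 1" "lam \<le> lam'"
  shows "mu n p X \<beta> lam \<xi> \<le> mu n p X \<beta> lam' \<xi>"
proof (subst le_mu_iff[OF assms(1)], intro allI impI)
  fix T and \<nu> :: real assume "T \<subseteq> {..<p}" "0 < \<nu>" "\<nu> < 1"
  then have "ereal (mu n p X \<beta> lam \<xi> / (\<xi> + 1))
      \<le> max (ereal (l1_norm ({..<p} - T) \<beta> / \<nu>)) (mu_entry n p X lam \<xi> T \<nu>)"
    using le_mu_iff[OF assms(1), of "mu n p X \<beta> lam \<xi>" n p X \<beta> lam] by blast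
  also have "\<dots> \<le> max (ereal (l1_norm ({..<p} - T) \<beta> / \<nu>)) (mu_entry n p X lam' \<xi> T \<nu>)"
    using mu_entry_mono[OF \<open>\<nu> < 1\<close> assms(2)] by (intro max.mono) auto
  finally show "ereal (mu n p X \<beta> lam \<xi> / (\<xi> + 1))
      \<le> max (ereal (l1_norm ({..<p} - T) \<beta> / \<nu>)) (mu_entry n p X lam' \<xi> T \<nu>)" .
qed

text \<open>The first entry of the maximum does not involve \<open>lam\<close> and the second is
  linear in it, so enlarging \<open>lam\<close> by a factor c >= 1 enlarges the maximum by at most
  c. This lets penalties at different noise scales be compared.\<close>

lemma mu_scale:
  assumes \<xi>: "\<xi> > 1" and c: "c \<ge> 1"
  shows "mu n p X \<beta> (c * lam) \<xi> \<le> c * mu n p X \<beta> lam \<xi>"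
proof -
  have "mu n p X \<beta> (c * lam) \<xi> / c \<le> mu n p X \<beta> lam \<xi>"
  proof (subst le_mu_iff[OF \<xi>], intro allI impI)
    fix T and \<nu> :: real assume T: "T \<subseteq> {..<p}" and \<nu>: "0 < \<nu>" "\<nu> < 1"
    define a where "a = l1_norm ({..<p} - T) \<beta> / \<nu>"
    have a: "a \<ge> 0" using \<nu> by (simp add: a_def l1_norm_nonneg)
    define M where "M = mu n p X \<beta> (c * lam) \<xi> / (\<xi> + 1)"
    have M: "ereal M \<le> max (ereal a) (mu_entry n p X (c * lam) \<xi> T \<nu>)"
      using le_mu_iff[OF \<xi>, of "mu n p X \<beta> (c * lam) \<xi>" n p X \<beta> "c * lam"] T \<nu>
      unfolding a_def M_def by blast
    have "ereal (M / c) \<le> max (ereal a) (mu_entry n p X lam \<xi> T \<nu>)"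
    proof (cases "T = {} \<or> kappa n p X ((\<xi> + \<nu>) / (1 - \<nu>)) T = 0")
      case True
      have "a \<le> c * a" using c a by (simp add: mult_le_cancel_right1)
      then show ?thesis using M c True
        by (auto simp: mu_entry_def max_def a pos_divide_le_eq mult.commute split: if_splits)
    next
      case False
      define e where "e = lam * real (card T) / (2 * (1 - \<nu>)) / (kappa n p X ((\<xi> + \<nu>) / (1 - \<nu>)) T)\<^sup>2"
      have e: "mu_entry n p X lam \<xi> T \<nu> = ereal e" "mu_entry n p X (c * lam) \<xi> T \<nu> = ereal (c * e)"
        using False by (simp_all add: mu_entry_def Let_def e_def)
      have "a \<le> c * a" using c a by (simp add: mult_le_cancel_right1)
      then have "M \<le> c * max a e" using M c unfolding e
        by (auto simp: max_def mult_left_mono split: if_splits intro: order_trans)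
      then have "M / c \<le> max a e" using c by (simp add: pos_divide_le_eq mult.commute)
      then show ?thesis unfolding e by (simp add: le_max_iff_disj)
    qed
    then show "ereal (mu n p X \<beta> (c * lam) \<xi> / c / (\<xi> + 1))
         \<le> max (ereal (l1_norm ({..<p} - T) \<beta> / \<nu>)) (mu_entry n p X lam \<xi> T \<nu>)"
      by (simp add: a_def M_def field_simps)
  qed
  then show ?thesis using c by (simp add: pos_divide_le_eq mult.commute)
qed

lemma kappa_bdd_below:
  "bdd_below ((\<lambda>u. sqrt (real (card T)) * L2_set (mat_vec p X u) {..<n} / (sqrt (real n) * l1_norm T u)) ` U)"
  by (rule bdd_belowI2[of _ 0]) (simp add: l1_norm_nonneg)

lemma kappa_le:
  assumes "u \<in> lasso_cone p \<xi> T" "j < p" "u j \<noteq> 0"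
  shows "kappa n p X \<xi> T \<le> sqrt (real (card T)) * L2_set (mat_vec p X u) {..<n} / (sqrt (real n) * l1_norm T u)"
  unfolding kappa_def by (rule cINF_lower[OF kappa_bdd_below]) (use assms in auto)

lemma kappa_nonneg:
  assumes "u \<in> lasso_cone p \<xi> T" "j < p" "u j \<noteq> 0"
  shows "0 \<le> kappa n p X \<xi> T"
  unfolding kappa_def by (rule cINF_greatest) (use assms in \<open>auto simp: l1_norm_nonneg\<close>)

text \<open>Only finitely many T compete, so a positive lower bound for each, uniform in \<nu>, is
  enough. For empty T the first entry is at least the l1 norm of \<beta> because \<nu> < 1; for
  nonempty T the second entry is bounded below since \<open>kappa\<close> is bounded above. This
  serves the degenerate case \<tau> = 0 of the scale bound.\<close>

lemma mu_eq_0D: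
  assumes \<xi>: "\<xi> > 1" and lam: "lam > 0" and zero: "mu n p X \<beta> lam \<xi> = 0"
  shows "l1_norm {..<p} \<beta> = 0"
proof (rule ccontr)
  assume "l1_norm {..<p} \<beta> \<noteq> 0"
  then have \<beta>: "l1_norm {..<p} \<beta> > 0" using l1_norm_nonneg[of "{..<p}" \<beta>] by simp
  have "\<forall>T\<in>Pow {..<p}. \<exists>d>0. \<forall>\<nu>. 0 < \<nu> \<longrightarrow> \<nu> < 1 \<longrightarrow>
      ereal d \<le> max (ereal (l1_norm ({..<p} - T) \<beta> / \<nu>)) (mu_entry n p X lam \<xi> T \<nu>)"
  proof
    fix T assume T: "T \<in> Pow {..<p}"
    show "\<exists>d>0. \<forall>\<nu>. 0 < \<nu> \<longrightarrow> \<nu> < 1 \<longrightarrow>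
      ereal d \<le> max (ereal (l1_norm ({..<p} - T) \<beta> / \<nu>)) (mu_entry n p X lam \<xi> T \<nu>)"
    proof (cases "T = {}")
      case True
      have "l1_norm {..<p} \<beta> \<le> l1_norm {..<p} \<beta> / \<nu>" if "0 < \<nu>" "\<nu> < 1" for \<nu>
        using that \<beta> by (simp add: pos_le_divide_eq mult_le_cancel_left1)
      then show ?thesis using \<beta> True by (intro exI[of _ "l1_norm {..<p} \<beta>"]) (auto simp: le_max_iff_disj)
    next
      case False
      then obtain j where j: "j \<in> T" "j < p" using T by auto
      \<comment> \<open>A unit vector at an index of T lies in the cone for every \<nu>, so its
        quotient \<open>K\<close> bounds \<open>kappa\<close> uniformly in \<nu>. The
        \<open>+ 1\<close> in \<open>d\<close> below covers K = 0.\<close>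
      define u where "u = (\<lambda>i. if i = j then 1 else 0 :: real)"
      define K where "K = sqrt (real (card T)) * L2_set (mat_vec p X u) {..<n} / (sqrt (real n) * l1_norm T u)"
      have fin: "finite T" using T finite_subset by blast
      have T0: "card T > 0" using False fin by (simp add: card_gt_0_iff)
      have u0: "l1_norm ({..<p} - T) u = 0" using j by (auto simp: l1_norm_def u_def intro!: sum.neutral)
      define d where "d = lam * real (card T) / 2 / (K\<^sup>2 + 1)"
      have d: "d > 0" using lam T0 by (auto simp: d_def intro!: divide_pos_pos add_nonneg_pos)
      have "ereal d \<le> mu_entry n p X lam \<xi> T \<nu>" if \<nu>: "0 < \<nu>" "\<nu> < 1" for \<nu>
      proof -
        define k where "k = kappa n p X ((\<xi> + \<nu>) / (1 - \<nu>)) T"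
        have cone: "u \<in> lasso_cone p ((\<xi> + \<nu>) / (1 - \<nu>)) T"
          using u0 \<nu> \<xi> by (simp add: lasso_cone_def l1_norm_nonneg)
        have k: "0 \<le> k" "k \<le> K"
          using kappa_nonneg[OF cone j(2)] kappa_le[OF cone j(2)] unfolding k_def K_def by (auto simp: u_def)
        show ?thesis
        proof (cases "k = 0")
          case True
          then show ?thesis using False by (simp add: mu_entry_def k_def)
        next
          case kpos: False
          have "d \<le> lam * real (card T) / 2 / k\<^sup>2"
            unfolding d_def using k kpos lam power_mono[of k K 2]
            by (intro divide_left_mono mult_pos_pos) (auto simp: add_nonneg_pos intro: add_increasing2)
          also have "\<dots> \<le> lam * real (card T) / (2 * (1 - \<nu>)) / k\<^sup>2"
            using \<nu> lam kpos by (intro divide_right_mono divide_left_mono mult_pos_pos) auto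
          finally show ?thesis using False kpos by (simp add: mu_entry_def k_def Let_def)
        qed
      qed
      then show ?thesis using d by (auto simp: le_max_iff_disj)
    qed
  qed
  then obtain d where d: "\<And>T. T \<subseteq> {..<p} \<Longrightarrow> d T > 0"
      "\<And>T \<nu>. T \<subseteq> {..<p} \<Longrightarrow> 0 < \<nu> \<Longrightarrow> \<nu> < 1 \<Longrightarrow>
        ereal (d T) \<le> max (ereal (l1_norm ({..<p} - T) \<beta> / \<nu>)) (mu_entry n p X lam \<xi> T \<nu>)"
    by (metis (no_types, lifting) PowI bchoice)
  define m where "m = Min (d ` Pow {..<p})"
  have "m > 0" unfolding m_def using d(1) by (subst Min_gr_iff) auto
  have "(\<xi> + 1) * m \<le> mu n p X \<beta> lam \<xi>"
  proof (subst le_mu_iff[OF \<xi>], intro allI impI)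
    fix T and \<nu> :: real assume T: "T \<subseteq> {..<p}" and \<nu>: "0 < \<nu>" "\<nu> < 1"
    have "m \<le> d T" unfolding m_def using T by (intro Min_le) auto
    then show "ereal ((\<xi> + 1) * m / (\<xi> + 1))
        \<le> max (ereal (l1_norm ({..<p} - T) \<beta> / \<nu>)) (mu_entry n p X lam \<xi> T \<nu>)"
      using d(2)[OF T \<nu>] \<xi> by (auto intro: order_trans[rotated])
  qed
  then show False using zero \<open>m > 0\<close> \<xi> mult_pos_pos[of "\<xi> + 1" m] by linarith
qed

subsection \<open>Deterministic error bounds\<close>

lemma l1_norm_split: "T \<subseteq> {..<p} \<Longrightarrow> l1_norm {..<p} u = l1_norm T u + l1_norm ({..<p} - T) u"
  unfolding l1_norm_def using sum.subset_diff[of T "{..<p}"] by (simp add: add.commute)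

lemma l1_norm_triangle_diff: "l1_norm A u \<le> l1_norm A v + l1_norm A (\<lambda>j. v j - u j)"
  unfolding l1_norm_def sum.distrib[symmetric] by (rule sum_mono) linarith

lemma l1_norm_minus_commute: "l1_norm A (\<lambda>j. v j - u j) = l1_norm A (\<lambda>j. u j - v j)"
  by (simp add: l1_norm_def abs_minus_commute)

text \<open>The residual difference equals X (b - \<beta>), so the left side pairs the score vector
  X' resid / n with b - \<beta>, and Hoelder's inequality applies.\<close>

lemma noise_bound:
  "(\<Sum>i<n. resid p X y \<beta> i * (resid p X y \<beta> i - resid p X y b i)) / real n
     \<le> linf_norm p (\<lambda>j. (\<Sum>i<n. X i j * resid p X y \<beta> i) / real n) * l1_norm {..<p} (\<lambda>j. b j - \<beta> j)"
  (is "?L \<le> ?Z * _")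
proof -
  let ?g = "\<lambda>j. (\<Sum>i<n. X i j * resid p X y \<beta> i) / real n"
  have "(\<Sum>i<n. resid p X y \<beta> i * (resid p X y \<beta> i - resid p X y b i))
      = (\<Sum>i<n. \<Sum>j<p. X i j * resid p X y \<beta> i * (b j - \<beta> j))"
    by (simp add: resid_diff mat_vec_def sum_distrib_left mult_ac)
  also have "\<dots> = (\<Sum>j<p. \<Sum>i<n. X i j * resid p X y \<beta> i * (b j - \<beta> j))" by (rule sum.swap)
  finally have "?L = (\<Sum>j<p. ?g j * (b j - \<beta> j))"
    by (simp add: sum_distrib_right sum_divide_distrib)
  also have "\<dots> \<le> (\<Sum>j<p. ?Z * \<bar>b j - \<beta> j\<bar>)"
  proof (rule sum_mono)
    fix j assume "j \<in> {..<p}"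
    then have "\<bar>?g j\<bar> \<le> ?Z" unfolding linf_norm_def by (intro Max_ge) auto
    then have "\<bar>?g j\<bar> * \<bar>b j - \<beta> j\<bar> \<le> ?Z * \<bar>b j - \<beta> j\<bar>" by (rule mult_right_mono) simp
    then show "?g j * (b j - \<beta> j) \<le> ?Z * \<bar>b j - \<beta> j\<bar>"
      using abs_ge_self[of "?g j * (b j - \<beta> j)"] by (simp add: abs_mult)
  qed
  finally show ?thesis by (simp add: l1_norm_def sum_distrib_left)
qed

lemma lasso_vi_le:
  assumes "lasso_vi n p X y lam b" "lam > 0"
  shows "\<bar>\<Sum>i<n. resid p X y b i * (resid p X y \<beta> i - resid p X y b i)\<bar> / real n
           \<le> lam * l1_norm {..<p} (\<lambda>j. b j - \<beta> j)"
proof -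
  let ?R = "resid p X y" and ?l = "l1_norm {..<p}"
  have *: "(\<Sum>i<n. ?R b i * (?R b i - ?R v i)) / real n \<le> lam * (?l v - ?l b)" for v
    using assms(1) by (simp add: lasso_vi_def)
  have "lam * (?l \<beta> - ?l b) \<le> lam * ?l (\<lambda>j. b j - \<beta> j)"
    using assms(2) l1_norm_triangle_diff[of "{..<p}" \<beta> b] by simp
  with *[of \<beta>] have 1: "(\<Sum>i<n. ?R b i * (?R b i - ?R \<beta> i)) / real n \<le> lam * ?l (\<lambda>j. b j - \<beta> j)"
    by simp
  \<comment> \<open>The reflection 2 b - \<beta>: the residual difference changes sign, while the
    triangle inequality bounds the increase of the penalty by the same l1 distance.\<close>
  define v where "v = (\<lambda>j. b j + (-1) * (\<beta> j - b j))"
  have Rv: "?R b i - ?R v i = ?R \<beta> i - ?R b i" for i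
    unfolding v_def by (subst resid_line) simp
  have "(\<lambda>j. b j - v j) = (\<lambda>j. \<beta> j - b j)" by (simp add: v_def)
  then have "?l v - ?l b \<le> ?l (\<lambda>j. b j - \<beta> j)"
    using l1_norm_triangle_diff[of "{..<p}" v b] l1_norm_minus_commute[of "{..<p}" b \<beta>] by simp
  then have "lam * (?l v - ?l b) \<le> lam * ?l (\<lambda>j. b j - \<beta> j)" using assms(2) by simp
  with *[of v] have 2: "(\<Sum>i<n. ?R b i * (?R \<beta> i - ?R b i)) / real n \<le> lam * ?l (\<lambda>j. b j - \<beta> j)"
    by (simp add: Rv)
  have "(\<Sum>i<n. ?R b i * (?R b i - ?R \<beta> i)) = - (\<Sum>i<n. ?R b i * (?R \<beta> i - ?R b i))"
    by (simp add: sum_negf[symmetric] algebra_simps)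
  then show ?thesis using 1 2 by (simp add: abs_if)
qed

text \<open>With residuals r at \<beta> and r' at \<open>b\<close>, r^2 - r'^2 = r (r - r') + r' (r
  - r'). The noise controls the first pairing and the variational inequality the second, so the
  difference is linear in the l1 error without a quadratic remainder.\<close>

lemma sigma_star_power2_diff:
  assumes "lasso_vi n p X y lam b" "lam > 0"
    and Z: "linf_norm p (\<lambda>j. (\<Sum>i<n. X i j * resid p X y \<beta> i) / real n) \<le> Z"
  shows "\<bar>(sigma_star n p X y \<beta>)\<^sup>2 - (sigma_star n p X y b)\<^sup>2\<bar>
           \<le> (Z + lam) * l1_norm {..<p} (\<lambda>j. b j - \<beta> j)"
proof -
  let ?R = "resid p X y" and ?h = "l1_norm {..<p} (\<lambda>j. b j - \<beta> j)"
  have \<beta>: "\<bar>\<Sum>i<n. ?R \<beta> i * (?R \<beta> i - ?R b i)\<bar> / real n \<le> Z * ?h"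
  proof -
    \<comment> \<open>\<open>noise_bound\<close> is one-sided; reflecting \<open>b\<close> through
      \<beta> supplies the other sign.\<close>
    define v where "v = (\<lambda>j. \<beta> j + (-1) * (b j - \<beta> j))"
    have Rv: "?R \<beta> i - ?R v i = - (?R \<beta> i - ?R b i)" for i
      unfolding v_def by (subst resid_line) simp
    have v: "l1_norm {..<p} (\<lambda>j. v j - \<beta> j) = ?h"
      by (simp add: v_def l1_norm_def abs_minus_commute)
    have "(\<Sum>i<n. ?R \<beta> i * (?R \<beta> i - ?R v i)) / real n \<le> Z * ?h"
      using noise_bound[of p X y \<beta> v n] mult_right_mono[OF Z, of ?h] by (simp add: v l1_norm_nonneg)
    moreover have "(\<Sum>i<n. ?R \<beta> i * (?R \<beta> i - ?R b i)) / real n \<le> Z * ?h"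
      using noise_bound[of p X y \<beta> b n] mult_right_mono[OF Z, of ?h] by (simp add: l1_norm_nonneg)
    moreover have "(\<Sum>i<n. ?R \<beta> i * (?R \<beta> i - ?R v i)) = - (\<Sum>i<n. ?R \<beta> i * (?R \<beta> i - ?R b i))"
      unfolding Rv by (simp only: mult_minus_right sum_negf)
    ultimately show ?thesis by (simp add: abs_if)
  qed
  have "(sigma_star n p X y \<beta>)\<^sup>2 - (sigma_star n p X y b)\<^sup>2
      = (\<Sum>i<n. ?R \<beta> i * (?R \<beta> i - ?R b i)) / real n + (\<Sum>i<n. ?R b i * (?R \<beta> i - ?R b i)) / real n"
    unfolding sigma_star_power2
    by (simp add: sum.distrib[symmetric] sum_subtractf[symmetric]
        add_divide_distrib[symmetric] diff_divide_distrib[symmetric] power2_eq_square algebra_simps)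
  then have "\<bar>(sigma_star n p X y \<beta>)\<^sup>2 - (sigma_star n p X y b)\<^sup>2\<bar>
      \<le> \<bar>\<Sum>i<n. ?R \<beta> i * (?R \<beta> i - ?R b i)\<bar> / real n + \<bar>\<Sum>i<n. ?R b i * (?R \<beta> i - ?R b i)\<bar> / real n"
    using abs_triangle_ineq[of "(\<Sum>i<n. ?R \<beta> i * (?R \<beta> i - ?R b i)) / real n"
        "(\<Sum>i<n. ?R b i * (?R \<beta> i - ?R b i)) / real n"] by simp
  then show ?thesis using \<beta> lasso_vi_le[OF assms(1,2), of \<beta>] by (simp add: algebra_simps)
qed

lemma lasso_basic_inequality:
  assumes vi: "lasso_vi n p X y lam b" and lam: "lam > 0" and \<xi>: "\<xi> > 1" and T: "T \<subseteq> {..<p}"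
    and Z: "linf_norm p (\<lambda>j. (\<Sum>i<n. X i j * resid p X y \<beta> i) / real n) \<le> lam * (\<xi> - 1) / (\<xi> + 1)"
  defines "h \<equiv> (\<lambda>j. b j - \<beta> j)"
  shows "(\<xi> + 1) * ((L2_set (mat_vec p X h) {..<n})\<^sup>2 / real n) / (2 * lam) + l1_norm ({..<p} - T) h
           \<le> \<xi> * l1_norm T h + (\<xi> + 1) * l1_norm ({..<p} - T) \<beta>"
proof -
  let ?R = "resid p X y" and ?l = "l1_norm {..<p}" and ?c = "l1_norm ({..<p} - T)"
  define Q where "Q = (L2_set (mat_vec p X h) {..<n})\<^sup>2 / real n"
  define z where "z = lam * (\<xi> - 1) / (\<xi> + 1)"
  have "Q = (\<Sum>i<n. (?R \<beta> i - ?R b i)\<^sup>2) / real n"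
    by (simp add: Q_def h_def L2_set_power2 resid_diff)
  also have "\<dots> = (\<Sum>i<n. ?R \<beta> i * (?R \<beta> i - ?R b i)) / real n + (\<Sum>i<n. ?R b i * (?R b i - ?R \<beta> i)) / real n"
    by (simp add: sum.distrib[symmetric] add_divide_distrib[symmetric] power2_eq_square algebra_simps)
  also have "\<dots> \<le> z * ?l h + lam * (?l \<beta> - ?l b)"
  proof (rule add_mono)
    show "(\<Sum>i<n. ?R \<beta> i * (?R \<beta> i - ?R b i)) / real n \<le> z * ?l h"
      using noise_bound[of p X y \<beta> b n] mult_right_mono[OF Z, of "?l h"]
      by (simp add: l1_norm_nonneg h_def z_def)
    show "(\<Sum>i<n. ?R b i * (?R b i - ?R \<beta> i)) / real n \<le> lam * (?l \<beta> - ?l b)"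
      using vi by (simp add: lasso_vi_def)
  qed
  also have "?l \<beta> - ?l b \<le> l1_norm T h + 2 * ?c \<beta> - ?c h"
  proof -
    have "?c h \<le> ?c b + ?c \<beta>"
      unfolding l1_norm_def sum.distrib[symmetric] h_def by (rule sum_mono) linarith
    then show ?thesis
      using l1_norm_triangle_diff[of T \<beta> b] l1_norm_split[OF T, of b] l1_norm_split[OF T, of \<beta>]
      by (simp add: h_def)
  qed
  finally have "Q \<le> z * ?l h + lam * (l1_norm T h + 2 * ?c \<beta> - ?c h)"
    using lam by simp
  \<comment> \<open>This factor turns the noise level into (\<xi> - 1) / 2 and the penalty into
    (\<xi> + 1) / 2. Their sum \<xi> multiplies the error on T, and their difference leaves
    coefficient -1 off T.\<close>
  then have "(\<xi> + 1) / (2 * lam) * Q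
      \<le> (\<xi> + 1) / (2 * lam) * (z * ?l h + lam * (l1_norm T h + 2 * ?c \<beta> - ?c h))"
    using lam \<xi> by (intro mult_left_mono) auto
  also have "\<dots> = \<xi> * l1_norm T h + (\<xi> + 1) * ?c \<beta> - ?c h"
  proof -
    have "(\<xi> + 1) / (2 * lam) * z = (((\<xi> + 1) * lam) * (\<xi> - 1)) / (((\<xi> + 1) * lam) * 2)"
      by (simp only: z_def times_divide_times_eq mult_ac)
    also have "\<dots> = (\<xi> - 1) / 2"
      by (rule nonzero_mult_divide_mult_cancel_left) (use lam \<xi> in auto)
    finally have "(\<xi> + 1) / (2 * lam) * z = (\<xi> - 1) / 2" "(\<xi> + 1) / (2 * lam) * lam = (\<xi> + 1) / 2"
      using lam by simp_all
    then have "(\<xi> + 1) / (2 * lam) * (z * ?l h + lam * (l1_norm T h + 2 * ?c \<beta> - ?c h))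
       = (\<xi> - 1) / 2 * ?l h + (\<xi> + 1) / 2 * (l1_norm T h + 2 * ?c \<beta> - ?c h)"
      by (simp only: distrib_left mult.assoc[symmetric])
    then show ?thesis by (simp add: l1_norm_split[OF T, of h] algebra_simps) argo
  qed
  finally show ?thesis by (simp add: Q_def mult_ac)
qed

text \<open>For each T and \<nu>, either the part of \<beta> off T is large enough for the first
  entry to dominate, or it is absorbed into the fraction \<nu> of the l1 error. Absorption puts the
  error in the cone with constant (\<xi> + \<nu>) / (1 - \<nu>), where \<open>kappa\<close> turns
  the basic inequality into the second entry.\<close>

lemma lasso_l1_bound:
  assumes vi: "lasso_vi n p X y lam b" and lam: "lam > 0" and \<xi>: "\<xi> > 1"
    and Z: "linf_norm p (\<lambda>j. (\<Sum>i<n. X i j * resid p X y \<beta> i) / real n) \<le> lam * (\<xi> - 1) / (\<xi> + 1)"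
  shows "l1_norm {..<p} (\<lambda>j. b j - \<beta> j) \<le> mu n p X \<beta> lam \<xi>"
proof (subst le_mu_iff[OF \<xi>], intro allI impI)
  fix T and \<nu> :: real assume T: "T \<subseteq> {..<p}" and \<nu>: "0 < \<nu>" "\<nu> < 1"
  define h where "h = (\<lambda>j. b j - \<beta> j)"
  let ?l = "l1_norm {..<p} h" and ?c = "l1_norm ({..<p} - T)"
  define Q where "Q = (L2_set (mat_vec p X h) {..<n})\<^sup>2 / real n"
  have Q: "Q \<ge> 0" by (simp add: Q_def)
  have basic: "(\<xi> + 1) * Q / (2 * lam) + ?c h \<le> \<xi> * l1_norm T h + (\<xi> + 1) * ?c \<beta>"
    using lasso_basic_inequality[OF vi lam \<xi> T Z] by (simp add: h_def Q_def)
  have split: "?l = l1_norm T h + ?c h" by (rule l1_norm_split[OF T])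
  show "ereal (?l / (\<xi> + 1)) \<le> max (ereal (?c \<beta> / \<nu>)) (mu_entry n p X lam \<xi> T \<nu>)"
    unfolding h_def[symmetric]
  proof (cases "?l / (\<xi> + 1) \<le> ?c \<beta> / \<nu>")
    case True
    then show ?thesis by (simp add: le_max_iff_disj)
  next
    case False
    then have small: "(\<xi> + 1) * ?c \<beta> < \<nu> * ?l"
      using \<nu> \<xi> by (simp add: field_simps)
    have "?l > 0"
      using small \<nu> \<xi> l1_norm_nonneg[of "{..<p} - T" \<beta>]
      by (smt (verit) mult_nonneg_nonneg mult_nonneg_nonpos)
    then obtain j where j: "j < p" "h j \<noteq> 0"
      by (auto simp: l1_norm_def) (metis (no_types, lifting) abs_zero lessThan_iff less_irrefl sum.neutral)
    have "(\<xi> + 1) * Q / (2 * lam) \<ge> 0" using Q lam \<xi> by simp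
    with basic small have "(1 - \<nu>) * ?c h \<le> (\<xi> + \<nu>) * l1_norm T h"
      by (simp add: split algebra_simps)
    then have cone: "h \<in> lasso_cone p ((\<xi> + \<nu>) / (1 - \<nu>)) T"
      using \<nu> by (simp add: lasso_cone_def field_simps)
    define x where "x = l1_norm T h"
    have x: "x > 0"
    proof (rule ccontr)
      assume "\<not> x > 0"
      then have "x = 0" using l1_norm_nonneg[of T h] by (simp add: x_def)
      then have "?c h \<le> 0" using cone by (simp add: lasso_cone_def x_def)
      then show False using \<open>x = 0\<close> \<open>?l > 0\<close> split by (simp add: x_def)
    qed
    then have Tne: "T \<noteq> {}" by (auto simp: x_def l1_norm_def)
    have fin: "finite T" using T finite_subset by blast
    have t: "real (card T) > 0" using Tne fin by (simp add: card_gt_0_iff)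
    define k where "k = kappa n p X ((\<xi> + \<nu>) / (1 - \<nu>)) T"
    show ?thesis
    proof (cases "k = 0")
      case True
      then show ?thesis using Tne by (simp add: mu_entry_def k_def)
    next
      case False
      have k: "k > 0" using False kappa_nonneg[OF cone j, of n X] by (simp add: k_def)
      have "k \<le> sqrt (real (card T)) * L2_set (mat_vec p X h) {..<n} / (sqrt (real n) * x)"
        using kappa_le[OF cone j, of n X] by (simp add: k_def x_def)
      then have "k\<^sup>2 \<le> (sqrt (real (card T)) * L2_set (mat_vec p X h) {..<n} / (sqrt (real n) * x))\<^sup>2"
        using k by (intro power_mono) auto
      also have "\<dots> = real (card T) * Q / x\<^sup>2"
        by (simp add: Q_def power_mult_distrib power_divide)
      finally have kQ: "k\<^sup>2 * x\<^sup>2 \<le> real (card T) * Q" using x by (simp add: pos_le_divide_eq)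
      define m where "m = lam * real (card T)"
      have m: "m > 0" using lam t by (simp add: m_def)
      have "(1 - \<nu>) * ?l \<le> (\<xi> + 1) * (x - Q / (2 * lam))"
        using basic small by (simp add: split x_def algebra_simps)
      also have "\<dots> \<le> (\<xi> + 1) * (m / (2 * k\<^sup>2))"
      proof (rule mult_left_mono)
        \<comment> \<open>AM-GM: x <= m / (2 k^2) + k^2 x^2 / (2 m). With m = lam |T| the last term
          is at most Q / (2 lam), which is exactly the quadratic gain kept in the basic
          inequality.\<close>
        have "0 \<le> (k\<^sup>2 * x - m)\<^sup>2 / (2 * m * k\<^sup>2)" using m k by simp
        also have "\<dots> = m / (2 * k\<^sup>2) - x + k\<^sup>2 * x\<^sup>2 / (2 * m)"
          using m k by (simp add: power2_eq_square field_simps)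
        also have "k\<^sup>2 * x\<^sup>2 / (2 * m) \<le> real (card T) * Q / (2 * m)"
          using kQ m by (intro divide_right_mono) auto
        also have "\<dots> = Q / (2 * lam)" using t by (simp add: m_def)
        finally show "x - Q / (2 * lam) \<le> m / (2 * k\<^sup>2)" by simp
      qed (use \<xi> in simp)
      finally have "?l / (\<xi> + 1) \<le> m / (2 * (1 - \<nu>)) / k\<^sup>2"
        using \<xi> \<nu> k by (simp add: field_simps)
      then show ?thesis using Tne False by (simp add: mu_entry_def k_def m_def Let_def le_max_iff_disj)
    qed
  qed
qed

section \<open>Scale and error bounds on the noise event\<close>

lemma tau_star_power2:
  assumes "\<xi> > 1" "lam0 \<ge> 0"
  shows "(tau_star n p X y \<beta> lam0 \<xi>)\<^sup>2
           = lam0 * mu n p X \<beta> (sigma_star n p X y \<beta> * lam0) \<xi> / sigma_star n p X y \<beta>"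
  using assms by (simp add: tau_star_def Let_def mu_nonneg sigma_star_nonneg)

lemma tau_star_nonneg: "\<xi> > 1 \<Longrightarrow> lam0 \<ge> 0 \<Longrightarrow> 0 \<le> tau_star n p X y \<beta> lam0 \<xi>"
  by (simp add: tau_star_def Let_def mu_nonneg sigma_star_nonneg)

lemma linf_norm_nonneg: "p \<ge> 1 \<Longrightarrow> 0 \<le> linf_norm p v"
  unfolding linf_norm_def by (subst Max_ge_iff) (auto simp: lessThan_empty_iff intro!: exI[of _ 0])

text \<open>The left side of the event is nonnegative and
  \<open>lam0 * (\<xi> - 1) / (\<xi> + 1)\<close> is positive, so the event by itself forces \<tau>
  squared to be at most 1.\<close>

lemma noise_eventD:
  assumes "\<xi> > 1" "p \<ge> 1" "lam0 > 0" and s: "sigma_star n p X y \<beta> > 0"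
    and "noise_event n p X y \<beta> lam0 \<xi>"
  shows "linf_norm p (\<lambda>j. (\<Sum>i<n. X i j * resid p X y \<beta> i) / real n)
           \<le> (1 - (tau_star n p X y \<beta> lam0 \<xi>)\<^sup>2) * sigma_star n p X y \<beta> * lam0 * (\<xi> - 1) / (\<xi> + 1)"
    and "(tau_star n p X y \<beta> lam0 \<xi>)\<^sup>2 \<le> 1"
proof -
  let ?\<tau> = "tau_star n p X y \<beta> lam0 \<xi>" and ?Z = "linf_norm p (\<lambda>j. (\<Sum>i<n. X i j * resid p X y \<beta> i) / real n)"
  have *: "?Z / sigma_star n p X y \<beta> \<le> (1 - ?\<tau>\<^sup>2) * lam0 * (\<xi> - 1) / (\<xi> + 1)"
    using assms by (simp add: noise_event_def z_star_def)
  then show "?Z \<le> (1 - ?\<tau>\<^sup>2) * sigma_star n p X y \<beta> * lam0 * (\<xi> - 1) / (\<xi> + 1)"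
    using s by (simp add: pos_divide_le_eq mult_ac)
  have "0 \<le> ?Z / sigma_star n p X y \<beta>" using linf_norm_nonneg[OF assms(2)] s by simp
  with * have "0 \<le> (1 - ?\<tau>\<^sup>2) * (lam0 * (\<xi> - 1) / (\<xi> + 1))" by (simp only: times_divide_eq_right mult.assoc)
  moreover have "lam0 * (\<xi> - 1) / (\<xi> + 1) > 0" using assms by simp
  ultimately have "0 \<le> 1 - ?\<tau>\<^sup>2" by (simp only: zero_le_mult_iff) linarith
  then show "?\<tau>\<^sup>2 \<le> 1" by simp
qed

text \<open>
  Strict convexity in the scale: the residual scale of the lasso with penalty \<open>t * lam0\<close> lies
  between that of the square-root lasso and \<open>t\<close>.
\<close>

lemma sigma_star_lasso_le:
  assumes vi: "lasso_vi n p X y (t * lam0) b'" and t: "t > 0" and n: "n \<ge> 1"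
    and min: "\<And>v. sigma_star n p X y b + lam0 * l1_norm {..<p} b
           \<le> sigma_star n p X y v + lam0 * l1_norm {..<p} v"
    and less: "sigma_star n p X y b < t"
  shows "sigma_star n p X y b' \<le> t"
proof (rule ccontr)
  let ?R = "resid p X y" and ?S = "sigma_star n p X y"
  assume "\<not> ?S b' \<le> t"
  then have gt: "?S b' > t" by simp
  \<comment> \<open>Cauchy-Schwarz bounds the pairing from below; the variational inequality tested
    at \<open>b\<close>, followed by minimality of \<open>b\<close> against b', bounds it from
    above. The result factors as (S b' - t) (S b' - S b) <= 0, against S b < t < S b'.\<close>
  have "(?S b')\<^sup>2 - ?S b' * ?S b \<le> (\<Sum>i<n. ?R b' i * (?R b' i - ?R b i)) / real n"
  proof -
    have "(\<Sum>i<n. ?R b' i * ?R b i) \<le> (\<Sum>i<n. \<bar>?R b' i\<bar> * \<bar>?R b i\<bar>)"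
      by (intro sum_mono) (simp flip: abs_mult)
    also have "\<dots> \<le> L2_set (?R b') {..<n} * L2_set (?R b) {..<n}" by (rule L2_set_mult_ineq)
    also have "\<dots> = real n * (?S b' * ?S b)" using n by (simp add: sigma_star_def)
    finally have "(\<Sum>i<n. ?R b' i * ?R b i) / real n \<le> ?S b' * ?S b"
      using n by (simp add: pos_divide_le_eq mult.commute)
    moreover have "(\<Sum>i<n. ?R b' i * (?R b' i - ?R b i)) / real n
        = (?S b')\<^sup>2 - (\<Sum>i<n. ?R b' i * ?R b i) / real n"
      unfolding sigma_star_power2 by (simp add: sum_subtractf diff_divide_distrib power2_eq_square right_diff_distrib)
    ultimately show ?thesis by simp
  qed
  also have "\<dots> \<le> t * (lam0 * (l1_norm {..<p} b - l1_norm {..<p} b'))"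
    using vi by (simp add: lasso_vi_def mult.assoc)
  also have "\<dots> \<le> t * (?S b' - ?S b)"
    using min[of b'] t by (intro mult_left_mono) (auto simp: algebra_simps)
  finally have "(?S b' - t) * (?S b' - ?S b) \<le> 0" by (simp add: power2_eq_square algebra_simps)
  then show False using gt less by (simp add: mult_le_0_iff)
qed

lemma sqrt_lasso_scale_lower:
  assumes \<xi>: "\<xi> > 1" and n: "n \<ge> 1" and p: "p \<ge> 1" and lam0: "lam0 > 0"
    and s: "sigma_star n p X y \<beta> > 0" and noise: "noise_event n p X y \<beta> lam0 \<xi>"
    and min: "\<And>v. sigma_star n p X y b + lam0 * l1_norm {..<p} b
           \<le> sigma_star n p X y v + lam0 * l1_norm {..<p} v"
  shows "(1 - (tau_star n p X y \<beta> lam0 \<xi>)\<^sup>2) * sigma_star n p X y \<beta> \<le> sigma_star n p X y b"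
proof (rule ccontr)
  let ?R = "resid p X y" and ?S = "sigma_star n p X y"
  let ?Z = "linf_norm p (\<lambda>j. (\<Sum>i<n. X i j * resid p X y \<beta> i) / real n)"
  define s where "s = ?S \<beta>"
  define q where "q = (tau_star n p X y \<beta> lam0 \<xi>)\<^sup>2"
  define t where "t = (1 - q) * s"
  have s0: "s > 0" using s by (simp add: s_def)
  have q: "0 \<le> q" "q \<le> 1" and Z: "?Z \<le> t * lam0 * (\<xi> - 1) / (\<xi> + 1)"
    using noise_eventD[OF \<xi> p lam0 s noise] by (auto simp: q_def t_def s_def)
  have q_eq: "lam0 * mu n p X \<beta> (s * lam0) \<xi> = q * s"
    using tau_star_power2[OF \<xi>, of lam0 n p X y \<beta>] lam0 s0 by (simp add: q_def s_def)
  assume "\<not> (1 - (tau_star n p X y \<beta> lam0 \<xi>)\<^sup>2) * ?S \<beta> \<le> ?S b"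
  then have less: "?S b < t" by (simp add: t_def q_def s_def)
  then have t: "t > 0" using sigma_star_nonneg[of n p X y b] by linarith
  then have q1: "q < 1" using s0 by (simp add: t_def zero_less_mult_iff)
  show False
  proof (cases "q = 0")
    case True
    then have "mu n p X \<beta> (s * lam0) \<xi> = 0" using q_eq lam0 by simp
    then have \<beta>0: "l1_norm {..<p} \<beta> = 0" using mu_eq_0D[OF \<xi>, of "s * lam0" n p X \<beta>] s0 lam0 by simp
    then have \<beta>j: "\<beta> j = 0" if "j < p" for j using that by (auto simp: l1_norm_def sum_nonneg_eq_0_iff)
    \<comment> \<open>Here \<beta> vanishes, so it solves every lasso whose penalty dominates the
      noise. The second entry of the maximum ensures that for \<open>t' * lam0\<close>; the first
      puts t' strictly above the square-root lasso scale; and t' < s. The comparison lemma applied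
      to \<beta> then gives s <= t', a contradiction.\<close>
    define t' where "t' = max ((?S b + s) / 2) (s * (\<xi> - 1) / (\<xi> + 1))"
    have ts: "t = s" using True by (simp add: t_def)
    have "s * (\<xi> - 1) / (\<xi> + 1) < s" using s0 \<xi> by (simp add: field_simps)
    then have t': "t' < s" "?S b < t'" "t' > 0" "s * (\<xi> - 1) / (\<xi> + 1) \<le> t'"
      using less ts sigma_star_nonneg[of n p X y b] s0 by (simp_all add: t'_def less_max_iff_disj)
    have Z': "?Z \<le> t' * lam0"
      using Z mult_right_mono[OF t'(4), of lam0] lam0 by (simp add: ts mult_ac)
    have "lasso_vi n p X y (t' * lam0) \<beta>"
      unfolding lasso_vi_def
    proof
      fix v
      have "l1_norm {..<p} (\<lambda>j. v j - \<beta> j) = l1_norm {..<p} v"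
        by (simp add: l1_norm_def \<beta>j)
      then have "(\<Sum>i<n. ?R \<beta> i * (?R \<beta> i - ?R v i)) / real n \<le> ?Z * l1_norm {..<p} v"
        using noise_bound[of p X y \<beta> v n] by simp
      also have "\<dots> \<le> t' * lam0 * l1_norm {..<p} v"
        using Z' by (rule mult_right_mono) (rule l1_norm_nonneg)
      finally show "(\<Sum>i<n. ?R \<beta> i * (?R \<beta> i - ?R v i)) / real n
          \<le> t' * lam0 * (l1_norm {..<p} v - l1_norm {..<p} \<beta>)" by (simp add: \<beta>0)
    qed
    from sigma_star_lasso_le[OF this t'(3) n min t'(2)] show False using t'(1) by (simp add: s_def)
  next
    case False
    then have q0: "q > 0" using q by simp
    obtain b' where vi: "lasso_vi n p X y (t * lam0) b'" using lasso_vi_exists[of "t * lam0" n p X y] t lam0 by auto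
    have tl: "t * lam0 > 0" using t lam0 by simp
    have "?S b' \<le> t" by (rule sigma_star_lasso_le[OF vi t n min less])
    then have "(?S b')\<^sup>2 \<le> t\<^sup>2" by (intro power_mono sigma_star_nonneg)
    moreover have h: "l1_norm {..<p} (\<lambda>j. b' j - \<beta> j) \<le> mu n p X \<beta> (s * lam0) \<xi>"
    proof -
      have "t * lam0 \<le> s * lam0" using q s0 lam0 by (simp add: t_def mult_le_cancel_right1)
      then show ?thesis
        using lasso_l1_bound[OF vi tl \<xi> Z] mu_mono[OF \<xi>, of "t * lam0" "s * lam0" n p X \<beta>] by simp
    qed
    ultimately have "s\<^sup>2 - t\<^sup>2 \<le> (t * lam0 * (\<xi> - 1) / (\<xi> + 1) + t * lam0) * mu n p X \<beta> (s * lam0) \<xi>"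
    proof -
      have "s\<^sup>2 - t\<^sup>2 \<le> \<bar>(?S \<beta>)\<^sup>2 - (?S b')\<^sup>2\<bar>" using \<open>(?S b')\<^sup>2 \<le> t\<^sup>2\<close> by (simp add: s_def)
      also have "\<dots> \<le> (t * lam0 * (\<xi> - 1) / (\<xi> + 1) + t * lam0) * l1_norm {..<p} (\<lambda>j. b' j - \<beta> j)"
        by (rule sigma_star_power2_diff[OF vi tl Z])
      also have "\<dots> \<le> (t * lam0 * (\<xi> - 1) / (\<xi> + 1) + t * lam0) * mu n p X \<beta> (s * lam0) \<xi>"
        using h t lam0 \<xi> by (intro mult_left_mono) auto
      finally show ?thesis .
    qed
    also have "\<dots> \<le> (2 * (t * lam0)) * mu n p X \<beta> (s * lam0) \<xi>"
    proof (rule mult_right_mono)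
      have "(\<xi> - 1) / (\<xi> + 1) \<le> 1" using \<xi> by simp
      from mult_left_mono[OF this, of "t * lam0"] tl
      show "t * lam0 * (\<xi> - 1) / (\<xi> + 1) + t * lam0 \<le> 2 * (t * lam0)" by (simp add: mult.commute)
    qed (simp add: mu_nonneg \<xi>)
    also have "\<dots> = 2 * t * (q * s)" by (simp add: q_eq[symmetric])
    finally have "s\<^sup>2 * (q * (2 - q)) \<le> s\<^sup>2 * (q * (2 * (1 - q)))"
      by (simp add: t_def power2_eq_square algebra_simps)
    then show False using s0 q0 by (simp add: mult_le_cancel_left)
  qed
qed

text \<open>Once \<open>shat\<close> is bounded below, \<open>shat * lam0\<close> dominates the
  noise as required and the l1 bound applies to the estimator itself. Replacing \<open>mu\<close> at
  this random penalty by \<open>mu\<close> at the oracle penalty costs a factor c from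
  \<open>mu_scale\<close>, which the upper bound on \<open>shat\<close> finally limits to 1 / (1 -
  q).\<close>

lemma scaled_lasso_bounds:
  assumes \<xi>: "\<xi> > 1" and n: "n \<ge> 1" and p: "p \<ge> 1" and lam0: "lam0 > 0"
    and sl: "is_scaled_lasso n p X y lam0 b shat"
    and s: "sigma_star n p X y \<beta> > 0" and noise: "noise_event n p X y \<beta> lam0 \<xi>"
  defines "q \<equiv> (tau_star n p X y \<beta> lam0 \<xi>)\<^sup>2"
  shows "(1 - q) * sigma_star n p X y \<beta> \<le> shat"
    and "(1 - q) * shat \<le> sigma_star n p X y \<beta>"
    and "q < 1 \<Longrightarrow> l1_norm {..<p} (\<lambda>j. b j - \<beta> j) \<le> mu n p X \<beta> (sigma_star n p X y \<beta> * lam0) \<xi> / (1 - q)"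
proof -
  let ?Z = "linf_norm p (\<lambda>j. (\<Sum>i<n. X i j * resid p X y \<beta> i) / real n)"
  define s where "s = sigma_star n p X y \<beta>"
  have s0: "s > 0" using s by (simp add: s_def)
  have shat: "shat > 0" "shat = sigma_star n p X y b"
    using sl is_scaled_lasso_scale[OF sl] by (simp_all add: is_scaled_lasso_iff)
  have q: "0 \<le> q" "q \<le> 1" and Z: "?Z \<le> (1 - q) * s * lam0 * (\<xi> - 1) / (\<xi> + 1)"
    using noise_eventD[OF \<xi> p lam0 s noise] by (auto simp: q_def s_def)
  have q_eq: "lam0 * mu n p X \<beta> (s * lam0) \<xi> = q * s"
    using tau_star_power2[OF \<xi>, of lam0 n p X y \<beta>] lam0 s0 by (simp add: q_def s_def)
  show lower: "(1 - q) * sigma_star n p X y \<beta> \<le> shat"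
    using sqrt_lasso_scale_lower[OF \<xi> n p lam0 s noise is_scaled_lasso_sqrt_lasso[OF sl]]
    by (simp add: q_def shat)
  have vi: "lasso_vi n p X y (shat * lam0) b" by (rule is_scaled_lasso_vi[OF sl lam0])
  have l: "shat * lam0 > 0" using shat lam0 by simp
  have Z': "?Z \<le> shat * lam0 * (\<xi> - 1) / (\<xi> + 1)"
  proof -
    have "(1 - q) * s * (lam0 * (\<xi> - 1) / (\<xi> + 1)) \<le> shat * (lam0 * (\<xi> - 1) / (\<xi> + 1))"
      using lower lam0 \<xi> by (intro mult_right_mono) (auto simp: s_def)
    then show ?thesis using Z by simp
  qed
  have h: "l1_norm {..<p} (\<lambda>j. b j - \<beta> j) \<le> mu n p X \<beta> (shat * lam0) \<xi>"
    by (rule lasso_l1_bound[OF vi l \<xi> Z'])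
  have h': "l1_norm {..<p} (\<lambda>j. b j - \<beta> j) \<le> c * mu n p X \<beta> (s * lam0) \<xi>"
    if "c \<ge> 1" "shat \<le> c * s" for c
  proof -
    have "shat * lam0 \<le> c * (s * lam0)" using that lam0 by (simp flip: mult.assoc)
    then have "mu n p X \<beta> (shat * lam0) \<xi> \<le> mu n p X \<beta> (c * (s * lam0)) \<xi>" by (rule mu_mono[OF \<xi>])
    then show ?thesis using h mu_scale[OF \<xi> that(1), of n p X \<beta> "s * lam0"] by simp
  qed
  show upper: "(1 - q) * shat \<le> sigma_star n p X y \<beta>"
  proof (rule ccontr)
    assume "\<not> (1 - q) * shat \<le> sigma_star n p X y \<beta>"
    then have gt: "s < (1 - q) * shat" by (simp add: s_def)
    \<comment> \<open>With c = 1 / x the error bound yields 1 - x^2 <= ((1 - q) x + 1) q <= 2 q -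
      q^2, whereas x < 1 - q makes the left side larger than 2 q - q^2.\<close>
    define x where "x = s / shat"
    have x: "0 < x" "x < 1 - q" using s0 shat(1) gt by (simp_all add: x_def pos_divide_less_eq)
    have sx: "s = x * shat" using shat by (simp add: x_def)
    have "1 / x \<ge> 1" "shat \<le> 1 / x * s" using x q shat by (simp_all add: sx)
    note hx = h'[OF this]
    have h1: "lam0 * l1_norm {..<p} (\<lambda>j. b j - \<beta> j) \<le> q * shat"
    proof -
      have "lam0 * l1_norm {..<p} (\<lambda>j. b j - \<beta> j) \<le> lam0 * (1 / x * mu n p X \<beta> (s * lam0) \<xi>)"
        using hx lam0 by (intro mult_left_mono) auto
      also have "\<dots> = 1 / x * (q * s)" by (simp add: q_eq[symmetric])
      also have "\<dots> = q * shat" using x by (simp add: sx)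
      finally show ?thesis .
    qed
    have Zl: "?Z \<le> (1 - q) * s * lam0"
    proof -
      have "(1 - q) * s * lam0 * ((\<xi> - 1) / (\<xi> + 1)) \<le> (1 - q) * s * lam0 * 1"
        using \<xi> q s0 lam0 by (intro mult_left_mono) auto
      then show ?thesis using Z by simp
    qed
    have "shat\<^sup>2 - s\<^sup>2 \<le> ((1 - q) * s * lam0 + shat * lam0) * l1_norm {..<p} (\<lambda>j. b j - \<beta> j)"
      using sigma_star_power2_diff[OF vi l Zl] by (simp add: shat(2)[symmetric] s_def[symmetric])
    also have "\<dots> = ((1 - q) * s + shat) * (lam0 * l1_norm {..<p} (\<lambda>j. b j - \<beta> j))"
      by (simp add: algebra_simps)
    also have "\<dots> \<le> ((1 - q) * s + shat) * (q * shat)"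
      using h1 q s0 shat(1) by (intro mult_left_mono) auto
    finally have "shat\<^sup>2 * (1 - x\<^sup>2) \<le> shat\<^sup>2 * (((1 - q) * x + 1) * q)"
      by (simp add: sx power2_eq_square algebra_simps)
    then have "1 - x\<^sup>2 \<le> ((1 - q) * x + 1) * q" using shat(1) by (simp add: mult_le_cancel_left)
    moreover have "x\<^sup>2 < (1 - q)\<^sup>2" using x by (intro power_strict_mono) auto
    moreover have "(1 - q) * x * q \<le> (1 - q) * 1 * q" using x q by (intro mult_left_mono mult_right_mono) auto
    ultimately show False by (simp add: power2_eq_square algebra_simps)
  qed
  show "l1_norm {..<p} (\<lambda>j. b j - \<beta> j) \<le> mu n p X \<beta> (sigma_star n p X y \<beta> * lam0) \<xi> / (1 - q)" if "q < 1"
  proof -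
    have "1 / (1 - q) \<ge> 1" "shat \<le> 1 / (1 - q) * s"
      using that q upper by (simp_all add: s_def pos_le_divide_eq mult.commute)
    from h'[OF this] show ?thesis by (simp add: s_def)
  qed
qed

subsection \<open>Gaussian vectors\<close>

abbreviation gaussian :: "nat set \<Rightarrow> (nat \<Rightarrow> real) measure" where
  "gaussian I \<equiv> PiM I (\<lambda>_. std_normal_distribution)"

lemma prob_space_std_normal: "prob_space std_normal_distribution"
  using prob_space_normal_density[of 1 0] by simp

interpretation std_normal: product_prob_space "\<lambda>_ :: nat. std_normal_distribution" UNIV
  by (rule product_prob_spaceI) (rule prob_space_std_normal)

interpretation std_normal_pair: pair_sigma_finite std_normal_distribution std_normal_distribution
  using prob_space_std_normal
  by (intro pair_sigma_finite.intro) (auto intro: prob_space_imp_sigma_finite)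

text \<open>For c nonzero the rotation is a composition of two one-dimensional affine substitutions:
  first u = c x + d e at fixed e, then w = (e - d u) / c at fixed u, with Jacobians |c| and 1 / |c|
  that cancel. For c = 0 it is a coordinate swap with signs.\<close>

lemma nn_integral_lborel_rotation:
  fixes f :: "real \<times> real \<Rightarrow> ennreal"
  assumes f [measurable]: "f \<in> borel_measurable (borel \<Otimes>\<^sub>M borel)" and cd: "c\<^sup>2 + d\<^sup>2 = 1"
  shows "(\<integral>\<^sup>+x. \<integral>\<^sup>+e. f (c * x + d * e, c * e - d * x) \<partial>lborel \<partial>lborel)
           = (\<integral>\<^sup>+x. \<integral>\<^sup>+e. f (x, e) \<partial>lborel \<partial>lborel)"
    (is "?L = ?R")
proof (cases "c = 0")
  case True
  then have d: "d \<noteq> 0" "\<bar>d\<bar> = 1" using cd by (auto simp: power2_eq_1_iff)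
  have "?L = (\<integral>\<^sup>+x. \<integral>\<^sup>+e. f (e, - d * x) \<partial>lborel \<partial>lborel)"
  proof (rule nn_integral_cong)
    fix x
    show "(\<integral>\<^sup>+e. f (c * x + d * e, c * e - d * x) \<partial>lborel) = (\<integral>\<^sup>+e. f (e, - d * x) \<partial>lborel)"
      using True d nn_integral_real_affine[of "\<lambda>e. f (e, - d * x)" d 0] by simp
  qed
  also have "\<dots> = (\<integral>\<^sup>+e. \<integral>\<^sup>+x. f (e, - d * x) \<partial>lborel \<partial>lborel)"
    by (rule lborel_pair.Fubini') measurable
  also have "\<dots> = ?R"
    using d nn_integral_real_affine[of "\<lambda>x. f (e, x)" "- d" 0 for e] by simp
  finally show ?thesis .
next
  case False
  have "?L = (\<integral>\<^sup>+e. \<integral>\<^sup>+x. f (c * x + d * e, c * e - d * x) \<partial>lborel \<partial>lborel)"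
    by (rule lborel_pair.Fubini') measurable
  then have "ennreal \<bar>c\<bar> * ?L = ennreal \<bar>c\<bar> * (\<integral>\<^sup>+e. \<integral>\<^sup>+x. f (c * x + d * e, c * e - d * x) \<partial>lborel \<partial>lborel)"
    by simp
  also have "\<dots> = (\<integral>\<^sup>+e. ennreal \<bar>c\<bar> * (\<integral>\<^sup>+x. f (c * x + d * e, c * e - d * x) \<partial>lborel) \<partial>lborel)"
    by (rule nn_integral_cmult[symmetric]) measurable
  also have "\<dots> = (\<integral>\<^sup>+e. \<integral>\<^sup>+u. f (u, (e - d * u) / c) \<partial>lborel \<partial>lborel)"
  proof (rule nn_integral_cong)
    fix e
    have "(e - d * (d * e + c * x)) / c = c * e - d * x" for x
    proof -
      have "e - d * (d * e + c * x) = (c\<^sup>2 + d\<^sup>2) * e - d * (d * e + c * x)" using cd by simp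
      also have "\<dots> = c * (c * e - d * x)" by (simp add: power2_eq_square algebra_simps)
      finally show ?thesis using False by simp
    qed
    then show "ennreal \<bar>c\<bar> * (\<integral>\<^sup>+x. f (c * x + d * e, c * e - d * x) \<partial>lborel)
        = (\<integral>\<^sup>+u. f (u, (e - d * u) / c) \<partial>lborel)"
      using nn_integral_real_affine[of "\<lambda>u. f (u, (e - d * u) / c)" c "d * e"] False
      by (simp add: add.commute)
  qed
  also have "\<dots> = (\<integral>\<^sup>+u. \<integral>\<^sup>+e. f (u, (e - d * u) / c) \<partial>lborel \<partial>lborel)"
    by (rule lborel_pair.Fubini') measurable
  also have "\<dots> = (\<integral>\<^sup>+u. ennreal \<bar>c\<bar> * (\<integral>\<^sup>+w. f (u, w) \<partial>lborel) \<partial>lborel)"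
  proof (rule nn_integral_cong)
    fix u
    have "ennreal \<bar>c\<bar> * (\<integral>\<^sup>+w. f (u, w) \<partial>lborel)
        = ennreal \<bar>c\<bar> * (ennreal \<bar>1 / c\<bar> * (\<integral>\<^sup>+e. f (u, - (d * u) / c + 1 / c * e) \<partial>lborel))"
      using nn_integral_real_affine[of "\<lambda>w. f (u, w)" "1 / c" "- (d * u) / c"] False by simp
    also have "\<dots> = (\<integral>\<^sup>+e. f (u, (e - d * u) / c) \<partial>lborel)"
      using False by (simp add: mult.assoc[symmetric] ennreal_mult[symmetric] diff_divide_distrib)
    finally show "(\<integral>\<^sup>+e. f (u, (e - d * u) / c) \<partial>lborel) = ennreal \<bar>c\<bar> * (\<integral>\<^sup>+w. f (u, w) \<partial>lborel)" ..
  qed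
  also have "\<dots> = ennreal \<bar>c\<bar> * ?R"
    by (rule nn_integral_cmult) measurable
  finally show ?thesis using False by (simp add: ennreal_mult_cancel_left)
qed

text \<open>The joint density depends only on x^2 + e^2, so rotation invariance of Lebesgue measure
  carries over.\<close>

lemma nn_integral_gaussian_rotation:
  fixes f :: "real \<times> real \<Rightarrow> ennreal"
  assumes f [measurable]: "f \<in> borel_measurable (borel \<Otimes>\<^sub>M borel)" and cd: "c\<^sup>2 + d\<^sup>2 = 1"
  shows "(\<integral>\<^sup>+x. \<integral>\<^sup>+e. f (c * x + d * e, c * e - d * x) \<partial>std_normal_distribution \<partial>std_normal_distribution)
           = (\<integral>\<^sup>+x. \<integral>\<^sup>+e. f (x, e) \<partial>std_normal_distribution \<partial>std_normal_distribution)"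
proof -
  let ?\<phi> = "std_normal_density"
  define F where "F = (\<lambda>(x, e). ennreal (?\<phi> x) * (ennreal (?\<phi> e) * f (x, e)))"
  have F [measurable]: "F \<in> borel_measurable (borel \<Otimes>\<^sub>M borel)" unfolding F_def by measurable
  have density: "?\<phi> (c * x + d * e) * ?\<phi> (c * e - d * x) = ?\<phi> x * ?\<phi> e" for x e
  proof -
    have "(c * x + d * e)\<^sup>2 + (c * e - d * x)\<^sup>2 = (c\<^sup>2 + d\<^sup>2) * (x\<^sup>2 + e\<^sup>2)"
      by (simp add: power2_eq_square algebra_simps)
    then have "- (c * x + d * e)\<^sup>2 / 2 + - (c * e - d * x)\<^sup>2 / 2 = - x\<^sup>2 / 2 + - e\<^sup>2 / 2" using cd by simp
    then show ?thesis by (simp add: std_normal_density_def flip: exp_add)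
  qed
  have *: "(\<integral>\<^sup>+x. \<integral>\<^sup>+e. h x e \<partial>std_normal_distribution \<partial>std_normal_distribution)
      = (\<integral>\<^sup>+x. \<integral>\<^sup>+e. ennreal (?\<phi> x) * (ennreal (?\<phi> e) * h x e) \<partial>lborel \<partial>lborel)"
    if [measurable]: "case_prod h \<in> borel_measurable (borel \<Otimes>\<^sub>M borel)" for h
    by (simp add: nn_integral_density nn_integral_cmult)
  have "(\<integral>\<^sup>+x. \<integral>\<^sup>+e. f (c * x + d * e, c * e - d * x) \<partial>std_normal_distribution \<partial>std_normal_distribution)
      = (\<integral>\<^sup>+x. \<integral>\<^sup>+e. F (c * x + d * e, c * e - d * x) \<partial>lborel \<partial>lborel)"
    by (subst *) (auto simp: F_def mult.assoc[symmetric] ennreal_mult[symmetric] density)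
  also have "\<dots> = (\<integral>\<^sup>+x. \<integral>\<^sup>+e. F (x, e) \<partial>lborel \<partial>lborel)"
    by (rule nn_integral_lborel_rotation[OF F cd])
  also have "\<dots> = (\<integral>\<^sup>+x. \<integral>\<^sup>+e. f (x, e) \<partial>std_normal_distribution \<partial>std_normal_distribution)"
    by (subst *) (auto simp: F_def)
  finally show ?thesis .
qed

lemma nn_integral_std_normal_minus:
  fixes f :: "real \<Rightarrow> ennreal"
  assumes [measurable]: "f \<in> borel_measurable borel"
  shows "(\<integral>\<^sup>+x. f (- x) \<partial>std_normal_distribution) = (\<integral>\<^sup>+x. f x \<partial>std_normal_distribution)"
  using nn_integral_real_affine[of "\<lambda>x. ennreal (std_normal_density x) * f x" "-1" 0]
  by (simp add: nn_integral_density std_normal_density_def)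

text \<open>
  Rotation invariance: the pair of a linear form and the squared norm has the law it would have
  if the form were a multiple of one coordinate.  Each induction step is a planar rotation.
\<close>

lemma nn_integral_gaussian_linear_form:
  fixes f :: "real \<times> real \<Rightarrow> ennreal"
  assumes "finite I" "k \<notin> I" and f: "f \<in> borel_measurable (borel \<Otimes>\<^sub>M borel)"
  shows "(\<integral>\<^sup>+g. f (\<Sum>i\<in>insert k I. v i * g i, \<Sum>i\<in>insert k I. (g i)\<^sup>2) \<partial>gaussian (insert k I))
       = (\<integral>\<^sup>+x. \<integral>\<^sup>+g. f (sqrt (\<Sum>i\<in>insert k I. (v i)\<^sup>2) * x, x\<^sup>2 + (\<Sum>i\<in>I. (g i)\<^sup>2))
            \<partial>gaussian I \<partial>std_normal_distribution)"
  using assms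
proof (induction I arbitrary: f rule: finite_induct)
  case empty
  note [measurable] = empty(2)
  have "(\<integral>\<^sup>+g. f (\<Sum>i\<in>{k}. v i * g i, \<Sum>i\<in>{k}. (g i)\<^sup>2) \<partial>gaussian {k})
      = (\<integral>\<^sup>+x. f (v k * x, x\<^sup>2) \<partial>std_normal_distribution)"
    using std_normal.product_nn_integral_singleton[of "\<lambda>x. f (v k * x, x\<^sup>2)" k] by simp
  \<comment> \<open>The coefficient may be negative while the square root yields its absolute value;
    symmetry of the normal law absorbs the sign.\<close>
  also have "\<dots> = (\<integral>\<^sup>+x. f (\<bar>v k\<bar> * x, x\<^sup>2) \<partial>std_normal_distribution)"
    using nn_integral_std_normal_minus[of "\<lambda>x. f (v k * x, x\<^sup>2)"] by (simp add: abs_if)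
  finally show ?case by (simp add: PiM_empty nn_integral_count_space_finite)
next
  case (insert j I)
  note [measurable] = insert.prems(2)
  have jk: "j \<notin> insert k I" "k \<notin> I" "finite (insert k I)" using insert by auto
  define c where "c = sqrt (\<Sum>i\<in>insert k I. (v i)\<^sup>2)"
  define r where "r = sqrt (\<Sum>i\<in>insert k (insert j I). (v i)\<^sup>2)"
  have c2: "c\<^sup>2 = (\<Sum>i\<in>insert k I. (v i)\<^sup>2)" unfolding c_def by (intro real_sqrt_pow2 sum_nonneg) simp
  have r2: "r\<^sup>2 = c\<^sup>2 + (v j)\<^sup>2"
  proof -
    have "r\<^sup>2 = (\<Sum>i\<in>insert k (insert j I). (v i)\<^sup>2)" unfolding r_def by (intro real_sqrt_pow2 sum_nonneg) simp
    also have "insert k (insert j I) = insert j (insert k I)" by auto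
    finally show ?thesis using jk by (simp add: c2)
  qed
  have r0: "r \<ge> 0" unfolding r_def by (intro real_sqrt_ge_zero sum_nonneg) simp
  \<comment> \<open>Integrates out the coordinates in \<open>I\<close>. What remains of the
    induction step is a statement about two variables, the combined coordinate x and the new
    coordinate e.\<close>
  define H where "H = (\<lambda>(a, b). \<integral>\<^sup>+g. f (a, b + (\<Sum>i\<in>I. (g i)\<^sup>2)) \<partial>gaussian I)"
  interpret gI: prob_space "gaussian I" by (intro prob_space_PiM prob_space_std_normal)
  have H [measurable]: "H \<in> borel_measurable (borel \<Otimes>\<^sub>M borel)"
    unfolding H_def by measurable
  have "(\<integral>\<^sup>+g. f (\<Sum>i\<in>insert k (insert j I). v i * g i, \<Sum>i\<in>insert k (insert j I). (g i)\<^sup>2) \<partial>gaussian (insert k (insert j I)))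
      = (\<integral>\<^sup>+e. \<integral>\<^sup>+g. f ((\<Sum>i\<in>insert k I. v i * g i) + v j * e, (\<Sum>i\<in>insert k I. (g i)\<^sup>2) + e\<^sup>2)
           \<partial>gaussian (insert k I) \<partial>std_normal_distribution)"
  proof -
    have comm: "insert k (insert j I) = insert j (insert k I)" by auto
    have "(\<Sum>i\<in>insert j (insert k I). v i * (g(j := e)) i) = (\<Sum>i\<in>insert k I. v i * g i) + v j * e"
      "(\<Sum>i\<in>insert j (insert k I). ((g(j := e)) i)\<^sup>2) = (\<Sum>i\<in>insert k I. (g i)\<^sup>2) + e\<^sup>2" for g e
    proof -
      have "(\<Sum>i\<in>insert k I. v i * (g(j := e)) i) = (\<Sum>i\<in>insert k I. v i * g i)"
        "(\<Sum>i\<in>insert k I. ((g(j := e)) i)\<^sup>2) = (\<Sum>i\<in>insert k I. (g i)\<^sup>2)"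
        using jk by (auto intro!: sum.cong)
      then show "(\<Sum>i\<in>insert j (insert k I). v i * (g(j := e)) i) = (\<Sum>i\<in>insert k I. v i * g i) + v j * e"
        "(\<Sum>i\<in>insert j (insert k I). ((g(j := e)) i)\<^sup>2) = (\<Sum>i\<in>insert k I. (g i)\<^sup>2) + e\<^sup>2"
        using jk by (subst sum.insert; simp)+
    qed
    then show ?thesis unfolding comm
      by (subst std_normal.product_nn_integral_insert_rev[OF jk(3,1)]) simp_all
  qed
  also have "\<dots> = (\<integral>\<^sup>+e. \<integral>\<^sup>+x. H (c * x + v j * e, x\<^sup>2 + e\<^sup>2) \<partial>std_normal_distribution \<partial>std_normal_distribution)"
  proof (rule nn_integral_cong)
    fix e :: real
    have "(\<lambda>(a, b). f (a + v j * e, b + e\<^sup>2)) \<in> borel_measurable (borel \<Otimes>\<^sub>M borel)" by measurable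
    from insert.IH[OF jk(2) this]
    show "(\<integral>\<^sup>+g. f ((\<Sum>i\<in>insert k I. v i * g i) + v j * e, (\<Sum>i\<in>insert k I. (g i)\<^sup>2) + e\<^sup>2) \<partial>gaussian (insert k I))
        = (\<integral>\<^sup>+x. H (c * x + v j * e, x\<^sup>2 + e\<^sup>2) \<partial>std_normal_distribution)"
      by (simp add: H_def c_def add_ac)
  qed
  also have "\<dots> = (\<integral>\<^sup>+x. \<integral>\<^sup>+e. H (c * x + v j * e, x\<^sup>2 + e\<^sup>2) \<partial>std_normal_distribution \<partial>std_normal_distribution)"
    by (rule std_normal_pair.Fubini') measurable
  also have "\<dots> = (\<integral>\<^sup>+x. \<integral>\<^sup>+e. H (r * x, x\<^sup>2 + e\<^sup>2) \<partial>std_normal_distribution \<partial>std_normal_distribution)"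
  proof (cases "r = 0")
    case True
    then have "c = 0" "v j = 0" using r2 by (simp_all add: sum_power2_eq_zero_iff)
    then show ?thesis using True by simp
  next
    case False
    \<comment> \<open>The rotation by (c / r, v j / r) carries c x + v j e to r times a single
      coordinate and preserves x^2 + e^2.\<close>
    define c' d' where "c' = c / r" and "d' = v j / r"
    have cd: "c'\<^sup>2 + d'\<^sup>2 = 1"
      using False by (simp add: c'_def d'_def power_divide add_divide_distrib[symmetric] r2[symmetric])
    have "c * x + v j * e = r * (c' * x + d' * e)"
      "x\<^sup>2 + e\<^sup>2 = (c' * x + d' * e)\<^sup>2 + (c' * e - d' * x)\<^sup>2" for x e
    proof -
      show "c * x + v j * e = r * (c' * x + d' * e)" using False by (simp add: c'_def d'_def distrib_left)
      have "(c' * x + d' * e)\<^sup>2 + (c' * e - d' * x)\<^sup>2 = (c'\<^sup>2 + d'\<^sup>2) * (x\<^sup>2 + e\<^sup>2)"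
        by (simp add: power2_eq_square algebra_simps)
      then show "x\<^sup>2 + e\<^sup>2 = (c' * x + d' * e)\<^sup>2 + (c' * e - d' * x)\<^sup>2" by (simp add: cd)
    qed
    then have "(\<integral>\<^sup>+x. \<integral>\<^sup>+e. H (c * x + v j * e, x\<^sup>2 + e\<^sup>2) \<partial>std_normal_distribution \<partial>std_normal_distribution)
      = (\<integral>\<^sup>+x. \<integral>\<^sup>+e. (\<lambda>(a, b). H (r * a, a\<^sup>2 + b\<^sup>2)) (c' * x + d' * e, c' * e - d' * x)
           \<partial>std_normal_distribution \<partial>std_normal_distribution)" by simp
    also have "\<dots> = (\<integral>\<^sup>+x. \<integral>\<^sup>+e. (\<lambda>(a, b). H (r * a, a\<^sup>2 + b\<^sup>2)) (x, e)
           \<partial>std_normal_distribution \<partial>std_normal_distribution)"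
      by (rule nn_integral_gaussian_rotation[OF _ cd]) measurable
    finally show ?thesis by simp
  qed
  also have "\<dots> = (\<integral>\<^sup>+x. \<integral>\<^sup>+g. f (r * x, x\<^sup>2 + (\<Sum>i\<in>insert j I. (g i)\<^sup>2)) \<partial>gaussian (insert j I) \<partial>std_normal_distribution)"
  proof (rule nn_integral_cong)
    fix x :: real
    have "(\<Sum>i\<in>I. ((g(j := e)) i)\<^sup>2) = (\<Sum>i\<in>I. (g i)\<^sup>2)" for g and e :: real
      using insert.hyps by (auto intro!: sum.cong)
    then show "(\<integral>\<^sup>+e. H (r * x, x\<^sup>2 + e\<^sup>2) \<partial>std_normal_distribution)
       = (\<integral>\<^sup>+g. f (r * x, x\<^sup>2 + (\<Sum>i\<in>insert j I. (g i)\<^sup>2)) \<partial>gaussian (insert j I))"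
      using insert.hyps
      by (subst std_normal.product_nn_integral_insert_rev) (simp_all add: H_def add_ac)
  qed
  finally show ?case by (simp add: r_def)
qed

section \<open>Exponential tilting, the inverse chi-square mean and the tail of a normalised linear
  form\<close>

lemma nn_integral_std_normal_tilt:
  fixes f :: "real \<Rightarrow> ennreal"
  assumes [measurable]: "f \<in> borel_measurable borel" and b: "b > 0"
  shows "(\<integral>\<^sup>+x. ennreal (exp (- (b - 1) / 2 * x\<^sup>2)) * f x \<partial>std_normal_distribution)
       = ennreal (1 / sqrt b) * (\<integral>\<^sup>+x. f (x / sqrt b) \<partial>std_normal_distribution)"
proof -
  let ?F = "\<lambda>x. ennreal (std_normal_density x) * (ennreal (exp (- (b - 1) / 2 * x\<^sup>2)) * f x)"
  have "exp (- (x / sqrt b)\<^sup>2 / 2) * exp (- (b - 1) / 2 * (x / sqrt b)\<^sup>2) = exp (- x\<^sup>2 / 2)" for x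
  proof -
    have "- (x / sqrt b)\<^sup>2 / 2 + - (b - 1) / 2 * (x / sqrt b)\<^sup>2 = - x\<^sup>2 / 2"
      using b by (simp add: power_divide field_simps)
    then show ?thesis by (simp only: exp_add[symmetric])
  qed
  then have eq: "?F (x / sqrt b) = ennreal (std_normal_density x) * f (x / sqrt b)" for x
    by (simp add: std_normal_density_def mult.assoc[symmetric] ennreal_mult[symmetric] del: exp_divide_power_eq)
  have "(\<integral>\<^sup>+x. ?F x \<partial>lborel) = ennreal \<bar>1 / sqrt b\<bar> * (\<integral>\<^sup>+x. ?F (0 + 1 / sqrt b * x) \<partial>lborel)"
    by (rule nn_integral_real_affine) (use b in auto)
  also have "\<dots> = ennreal (1 / sqrt b) * (\<integral>\<^sup>+x. ennreal (std_normal_density x) * f (x / sqrt b) \<partial>lborel)"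
    using b eq by simp
  finally show ?thesis by (simp add: nn_integral_density)
qed

text \<open>The density of N(0, 1) times exp(- (b - 1) x^2 / 2) is 1 / sqrt b times the density of
  N(0, 1 / b), once per coordinate. For f = 1 this is the chi-square Laplace transform; for general
  f it trades an exponential weight for a rescaling.\<close>

lemma nn_integral_gaussian_tilt:
  fixes f :: "real \<Rightarrow> ennreal"
  assumes "finite I" and f: "f \<in> borel_measurable borel" and b: "b > 0"
  shows "(\<integral>\<^sup>+g. ennreal (exp (- (b - 1) / 2 * (\<Sum>i\<in>I. (g i)\<^sup>2))) * f (\<Sum>i\<in>I. (g i)\<^sup>2) \<partial>gaussian I)
       = ennreal ((1 / sqrt b) ^ card I) * (\<integral>\<^sup>+g. f ((\<Sum>i\<in>I. (g i)\<^sup>2) / b) \<partial>gaussian I)"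
  using assms(1,2)
proof (induction I arbitrary: f rule: finite_induct)
  case empty
  then show ?case by (simp add: PiM_empty nn_integral_count_space_finite)
next
  case (insert j I)
  note [measurable] = insert.prems
  have upd: "(\<Sum>i\<in>I. (if i = j then e else g i)\<^sup>2) = (\<Sum>i\<in>I. (g i)\<^sup>2)" for g and e :: real
    using insert.hyps by (auto intro!: sum.cong)
  interpret gI: prob_space "gaussian I" by (intro prob_space_PiM prob_space_std_normal)
  let ?E = "\<lambda>q. ennreal (exp (- (b - 1) / 2 * q))"
  have E: "?E (x + y) = ?E x * ?E y" for x y
    by (simp add: ennreal_mult[symmetric] exp_add[symmetric] distrib_left)
  have "(\<integral>\<^sup>+g. ?E (\<Sum>i\<in>insert j I. (g i)\<^sup>2) * f (\<Sum>i\<in>insert j I. (g i)\<^sup>2) \<partial>gaussian (insert j I))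
     = (\<integral>\<^sup>+e. \<integral>\<^sup>+g. ?E (e\<^sup>2 + (\<Sum>i\<in>I. (g i)\<^sup>2)) * f (e\<^sup>2 + (\<Sum>i\<in>I. (g i)\<^sup>2)) \<partial>gaussian I \<partial>std_normal_distribution)"
    using insert.hyps by (subst std_normal.product_nn_integral_insert_rev) (simp_all add: upd)
  also have "\<dots> = (\<integral>\<^sup>+e. ?E (e\<^sup>2) * (\<integral>\<^sup>+g. ?E (\<Sum>i\<in>I. (g i)\<^sup>2) * f (e\<^sup>2 + (\<Sum>i\<in>I. (g i)\<^sup>2)) \<partial>gaussian I) \<partial>std_normal_distribution)"
    unfolding E mult.assoc by (intro nn_integral_cong nn_integral_cmult) measurable
  also have "\<dots> = (\<integral>\<^sup>+e. ?E (e\<^sup>2) * (ennreal ((1 / sqrt b) ^ card I) *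
      (\<integral>\<^sup>+g. f (e\<^sup>2 + (\<Sum>i\<in>I. (g i)\<^sup>2) / b) \<partial>gaussian I)) \<partial>std_normal_distribution)"
    by (subst insert.IH) simp_all
  also have "\<dots> = ennreal (1 / sqrt b) * (\<integral>\<^sup>+e. ennreal ((1 / sqrt b) ^ card I) *
      (\<integral>\<^sup>+g. f ((e / sqrt b)\<^sup>2 + (\<Sum>i\<in>I. (g i)\<^sup>2) / b) \<partial>gaussian I) \<partial>std_normal_distribution)"
    by (rule nn_integral_std_normal_tilt[OF _ b]) measurable
  also have "\<dots> = ennreal (1 / sqrt b) * (ennreal ((1 / sqrt b) ^ card I) * (\<integral>\<^sup>+e.
      (\<integral>\<^sup>+g. f ((e / sqrt b)\<^sup>2 + (\<Sum>i\<in>I. (g i)\<^sup>2) / b) \<partial>gaussian I) \<partial>std_normal_distribution))"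
    by (subst nn_integral_cmult) simp_all
  also have "\<dots> = ennreal ((1 / sqrt b) ^ card (insert j I)) * (\<integral>\<^sup>+e.
      (\<integral>\<^sup>+g. f ((e\<^sup>2 + (\<Sum>i\<in>I. (g i)\<^sup>2)) / b) \<partial>gaussian I) \<partial>std_normal_distribution)"
    using insert.hyps b by (simp add: mult.assoc[symmetric] ennreal_mult[symmetric] power_divide add_divide_distrib)
  also have "(\<integral>\<^sup>+e. (\<integral>\<^sup>+g. f ((e\<^sup>2 + (\<Sum>i\<in>I. (g i)\<^sup>2)) / b) \<partial>gaussian I) \<partial>std_normal_distribution)
     = (\<integral>\<^sup>+g. f ((\<Sum>i\<in>insert j I. (g i)\<^sup>2) / b) \<partial>gaussian (insert j I))"
    using insert.hyps by (subst std_normal.product_nn_integral_insert_rev) (simp_all add: upd)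
  finally show ?case .
qed


text \<open>Mills' bound: on t >= x the factor t / x is at least 1, and t times the normal density
  has the explicit antiderivative minus the density. Symmetry doubles the one-sided bound.\<close>

lemma std_normal_tail:
  assumes x: "x > 0"
  shows "(\<integral>\<^sup>+t. indicator {t. x < \<bar>t\<bar>} t \<partial>std_normal_distribution) \<le> ennreal (2 * std_normal_density x / x)"
proof -
  have "(\<integral>\<^sup>+t. ennreal (t * std_normal_density t) * indicator {x..} t \<partial>lborel) = ennreal (0 - (- std_normal_density x))"
  proof (rule nn_integral_FTC_atLeast)
    have "((\<lambda>t. - (C * exp (- t\<^sup>2 / 2))) has_real_derivative t * (C * exp (- t\<^sup>2 / 2))) (at t)" for t C :: real
      by (auto intro!: derivative_eq_intros)
    then show "((\<lambda>t. - std_normal_density t) has_real_derivative t * std_normal_density t) (at t)" for t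
      unfolding std_normal_density_def .
    show "((\<lambda>t. - std_normal_density t) \<longlongrightarrow> 0) at_top"
      unfolding std_normal_density_def by real_asymp
  qed (use x in auto)
  then have half: "(\<integral>\<^sup>+t. ennreal (t * std_normal_density t) * indicator {x..} t \<partial>lborel) = ennreal (std_normal_density x)"
    by simp
  have upper: "(\<integral>\<^sup>+t. indicator {x..} t \<partial>std_normal_distribution) \<le> ennreal (std_normal_density x / x)"
  proof -
    have "(\<integral>\<^sup>+t. indicator {x..} t \<partial>std_normal_distribution)
        = (\<integral>\<^sup>+t. ennreal (std_normal_density t) * indicator {x..} t \<partial>lborel)"
      by (rule nn_integral_density) auto
    also have "\<dots> \<le> (\<integral>\<^sup>+t. ennreal (1 / x) * (ennreal (t * std_normal_density t) * indicator {x..} t) \<partial>lborel)"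
      using x by (intro nn_integral_mono)
        (auto simp: indicator_def ennreal_mult[symmetric] pos_le_divide_eq mult.commute intro!: ennreal_leI mult_right_mono)
    also have "\<dots> = ennreal (1 / x) * ennreal (std_normal_density x)"
      by (simp add: nn_integral_cmult half)
    finally show ?thesis using x by (simp add: ennreal_mult[symmetric])
  qed
  have "(\<integral>\<^sup>+t. indicator {t. x < \<bar>t\<bar>} t \<partial>std_normal_distribution)
      \<le> (\<integral>\<^sup>+t. indicator {x..} t + indicator {x..} (- t) \<partial>std_normal_distribution)"
    by (intro nn_integral_mono) (auto simp: indicator_def)
  also have "\<dots> = (\<integral>\<^sup>+t. indicator {x..} t \<partial>std_normal_distribution) + (\<integral>\<^sup>+t. indicator {x..} (- t) \<partial>std_normal_distribution)"
    by (rule nn_integral_add) measurable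
  also have "(\<integral>\<^sup>+t. indicator {x..} (- t) \<partial>std_normal_distribution) = (\<integral>\<^sup>+t. indicator {x..} t \<partial>std_normal_distribution)"
    by (rule nn_integral_std_normal_minus) measurable
  also have "(\<integral>\<^sup>+t. indicator {x..} t \<partial>std_normal_distribution) + (\<integral>\<^sup>+t. indicator {x..} t \<partial>std_normal_distribution)
      \<le> ennreal (std_normal_density x / x) + ennreal (std_normal_density x / x)"
    by (intro add_mono upper)
  also have "\<dots> = ennreal (2 * std_normal_density x / x)"
    using x by (simp add: ennreal_plus[symmetric] del: ennreal_plus)
  finally show ?thesis .
qed

lemma inverse_sqrt_power:
  fixes c :: real assumes "c > 0"
  shows "(1 / sqrt c) ^ n = c powr (- real n / 2)"
proof -
  have "sqrt c ^ n = c powr (real n / 2)"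
    unfolding powr_half_sqrt[OF less_imp_le[OF assms], symmetric] using powr_power[of c "1 / 2" n] assms by simp
  then show ?thesis by (simp add: power_one_over powr_minus_divide)
qed

text \<open>The reciprocal as a mixture of exponentials; at 0 it is \<open>\<infinity>\<close>, where real division would give 0.\<close>

definition inv_laplace :: "real \<Rightarrow> ennreal" where
  "inv_laplace q = (\<integral>\<^sup>+t. ennreal (exp (- t * q)) * indicator {0..} t \<partial>lborel)"

lemma inv_laplace_measurable [measurable]: "inv_laplace \<in> borel_measurable borel"
  unfolding inv_laplace_def by measurable

lemma inv_laplace_pos:
  assumes q: "q > 0"
  shows "inv_laplace q = ennreal (1 / q)"
proof -
  have "inv_laplace q = ennreal (0 - (- exp (- 0 * q) / q))"
    unfolding inv_laplace_def
  proof (rule nn_integral_FTC_atLeast)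
    show "((\<lambda>t. - exp (- t * q) / q) has_real_derivative exp (- t * q)) (at t)" for t
      using q by (auto intro!: derivative_eq_intros)
    show "((\<lambda>t. - exp (- t * q) / q) \<longlongrightarrow> 0) at_top"
      using q by real_asymp
  qed auto
  then show ?thesis by simp
qed

lemma inv_laplace_0: "inv_laplace 0 = \<infinity>"
proof -
  have "inv_laplace 0 = emeasure lborel {0::real..}"
    by (simp add: inv_laplace_def)
  also have "\<dots> = \<infinity>"
  proof (rule ccontr)
    assume "emeasure lborel {0::real..} \<noteq> \<infinity>"
    then obtain r where r: "r \<ge> 0" "emeasure lborel {0::real..} = ennreal r"
      by (cases "emeasure lborel {0::real..}") auto
    have "emeasure lborel {0..r + 1} \<le> emeasure lborel {0::real..}"
      by (intro emeasure_mono) auto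
    then show False using r by simp
  qed
  finally show ?thesis .
qed

text \<open>By Fubini the expectation is the integral over t of the chi-square Laplace transform (1
  + 2 t / b)^(- m / 2), which converges exactly because m > 2. For b = 1 this is the inverse
  chi-square mean 1 / (m - 2).\<close>

lemma nn_integral_inv_laplace:
  assumes I: "finite I" "card I > 2" and b: "b > 0"
  shows "(\<integral>\<^sup>+g. inv_laplace ((\<Sum>i\<in>I. (g i)\<^sup>2) / b) \<partial>gaussian I) = ennreal (b / (real (card I) - 2))"
proof -
  interpret gI: prob_space "gaussian I" by (intro prob_space_PiM prob_space_std_normal)
  interpret pair_sigma_finite lborel "gaussian I"
    by (intro pair_sigma_finite.intro gI.sigma_finite_measure_axioms sigma_finite_lborel)
  let ?m = "real (card I)"
  have "(\<integral>\<^sup>+g. inv_laplace ((\<Sum>i\<in>I. (g i)\<^sup>2) / b) \<partial>gaussian I)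
      = (\<integral>\<^sup>+t. \<integral>\<^sup>+g. ennreal (exp (- t * ((\<Sum>i\<in>I. (g i)\<^sup>2) / b))) * indicator {0..} t \<partial>gaussian I \<partial>lborel)"
    unfolding inv_laplace_def by (rule Fubini') measurable
  also have "\<dots> = (\<integral>\<^sup>+t. ennreal ((1 + 2 * t / b) powr (- ?m / 2)) * indicator {0..} t \<partial>lborel)"
  proof (rule nn_integral_cong)
    fix t :: real
    show "(\<integral>\<^sup>+g. ennreal (exp (- t * ((\<Sum>i\<in>I. (g i)\<^sup>2) / b))) * indicator {0..} t \<partial>gaussian I)
       = ennreal ((1 + 2 * t / b) powr (- ?m / 2)) * indicator {0..} t"
    proof (cases "t \<ge> 0")
      case True
      define c where "c = 1 + 2 * t / b"
      have c: "c > 0" using True b by (simp add: c_def add_pos_nonneg)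
      have "(\<integral>\<^sup>+g. ennreal (exp (- t * ((\<Sum>i\<in>I. (g i)\<^sup>2) / b))) * indicator {0..} t \<partial>gaussian I)
         = (\<integral>\<^sup>+g. ennreal (exp (- (c - 1) / 2 * (\<Sum>i\<in>I. (g i)\<^sup>2))) * 1 \<partial>gaussian I)"
        using True by (simp add: c_def)
      also have "\<dots> = ennreal ((1 / sqrt c) ^ card I)"
        using nn_integral_gaussian_tilt[OF I(1) _ c, of "\<lambda>_. 1"] by (simp add: gI.emeasure_space_1)
      also have "(1 / sqrt c) ^ card I = c powr (- ?m / 2)"
        by (rule inverse_sqrt_power[OF c])
      finally show ?thesis using True by (simp add: c_def)
    qed simp
  qed
  also have "\<dots> = ennreal (0 - (- (b / (?m - 2)) * (1 + 2 * 0 / b) powr (1 - ?m / 2)))"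
  proof (rule nn_integral_FTC_atLeast)
    fix t :: real assume t: "0 \<le> t"
    then have pos: "1 + 2 * t / b > 0" using b by (simp add: add_pos_nonneg)
    show "((\<lambda>t. - (b / (?m - 2)) * (1 + 2 * t / b) powr (1 - ?m / 2))
        has_real_derivative (1 + 2 * t / b) powr (- ?m / 2)) (at t)"
    proof -
      define P where "P = (1 + 2 * t / b) powr (- ?m / 2)"
      have e: "1 - ?m / 2 - 1 = - ?m / 2" by simp
      have d: "((\<lambda>t. 1 + 2 * t / b) has_real_derivative 2 / b) (at t)"
        using b by (auto intro!: derivative_eq_intros)
      have "((\<lambda>t. (1 + 2 * t / b) powr (1 - ?m / 2)) has_real_derivative
          (1 - ?m / 2) * (1 + 2 * t / b) powr (1 - ?m / 2 - 1) * (2 / b)) (at t)"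
        using DERIV_fun_powr[OF d pos, of "1 - ?m / 2"] by (simp only: of_nat_1)
      from DERIV_cmult[OF this, of "- (b / (?m - 2))"]
      have "((\<lambda>t. - (b / (?m - 2)) * (1 + 2 * t / b) powr (1 - ?m / 2)) has_real_derivative
          - (b / (?m - 2)) * ((1 - ?m / 2) * P * (2 / b))) (at t)" unfolding e P_def[symmetric] .
      moreover have "- (b / (?m - 2)) * ((1 - ?m / 2) * P * (2 / b)) = P"
      proof -
        have "- (b / (?m - 2)) * ((1 - ?m / 2) * (2 / b)) = 1"
          using b I(2) by (simp add: divide_simps)
        then have "- (b / (?m - 2)) * ((1 - ?m / 2) * (2 / b)) * P = 1 * P" by (simp only:)
        then show ?thesis by (simp only: mult_ac mult_1)
      qed
      ultimately show ?thesis by (simp only: P_def)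
    qed
  next
    have "1 - ?m / 2 < 0" using I(2) by simp
    then have "((\<lambda>t. (1 + 2 * t / b) powr (1 - ?m / 2)) \<longlongrightarrow> 0) at_top"
      using b by real_asymp
    then show "((\<lambda>t. - (b / (?m - 2)) * (1 + 2 * t / b) powr (1 - ?m / 2)) \<longlongrightarrow> 0) at_top"
      by (intro tendsto_mult_right_zero)
  qed auto
  finally show ?thesis by simp
qed

text \<open>
  Conditionally on the orthogonal part, the linear form is standard normal.  After Mills' bound
  the remaining factor \<open>1 / |g|\<close> is linearised by AM-GM into \<open>(k / |g|\<^sup>2 + 1 / k) / 2\<close>, whose
  expectation is explicit.
\<close>

lemma gaussian_direction_tail:
  fixes v :: "nat \<Rightarrow> real"
  assumes I: "finite I" "k \<notin> I" "card I > 2" and v: "(\<Sum>i\<in>insert k I. (v i)\<^sup>2) = 1"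
    and w: "0 < w" "w < 1"
  shows "emeasure (gaussian (insert k I)) {g \<in> space (gaussian (insert k I)).
           w * sqrt (\<Sum>i\<in>insert k I. (g i)\<^sup>2) < \<bar>\<Sum>i\<in>insert k I. v i * g i\<bar>}
         \<le> ennreal (sqrt (2 / pi) * sqrt (1 - w\<^sup>2) ^ card I / (w * sqrt (real (card I) - 2)))"
proof -
  interpret gI: prob_space "gaussian I" by (intro prob_space_PiM prob_space_std_normal)
  let ?m = "real (card I)"
  \<comment> \<open>\<open>b\<close> and \<open>a\<close> come from solving w sqrt(x^2 + q) < |x|
    for |x|, which gives |x| > a sqrt q. Since a^2 = b - 1, the exponential in Mills' bound is
    exactly the weight removed by \<open>nn_integral_gaussian_tilt\<close>.\<close>
  define b where "b = 1 / (1 - w\<^sup>2)"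
  define a where "a = w * sqrt b"
  \<comment> \<open>The optimal AM-GM weight: after the tilt the mean of 1 / q becomes b / (m - 2),
    and this \<open>c\<close> makes the two terms c b / (m - 2) and 1 / c equal.\<close>
  define c where "c = sqrt ((?m - 2) / b)"
  have w2: "w\<^sup>2 < 1" "w\<^sup>2 > 0" using w by (simp_all add: power_less_one_iff)
  have b: "b > 1" using w2 by (simp add: b_def)
  have a: "a > 0" using w b by (simp add: a_def)
  have c: "c > 0" using I(3) b by (simp add: c_def)
  have a2: "a\<^sup>2 = b - 1" using w2 b by (simp add: a_def power_mult_distrib b_def field_simps)
  define f where "f = (\<lambda>(s, q). indicator {(s, q). w * sqrt q < \<bar>s\<bar>} (s, q) :: ennreal)"
  have f [measurable]: "f \<in> borel_measurable (borel \<Otimes>\<^sub>M borel)"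
    unfolding f_def by measurable
  define U where "U = (\<lambda>q. ennreal (1 / 2) * (ennreal c * inv_laplace q + ennreal (1 / c)))"
  have U [measurable]: "U \<in> borel_measurable borel" unfolding U_def by measurable
  have tail: "(\<integral>\<^sup>+x. f (x, x\<^sup>2 + q) \<partial>std_normal_distribution)
      \<le> ennreal (sqrt (2 / pi) / a) * (ennreal (exp (- (b - 1) / 2 * q)) * U q)" if q: "q \<ge> 0" for q
  proof (cases "q = 0")
    case True
    \<comment> \<open>At q = 0 the right side is infinite, which is why the reciprocal takes the
      value \<open>\<infinity>\<close> there.\<close>
    then show ?thesis using a c by (simp add: U_def inv_laplace_0 ennreal_mult_top ennreal_mult_eq_top_iff)
  next
    case False
    then have q: "q > 0" using q by simp
    have "f (x, x\<^sup>2 + q) \<le> indicator {t. a * sqrt q < \<bar>t\<bar>} x" for x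
    proof -
      have "a * sqrt q < \<bar>x\<bar>" if "w * sqrt (x\<^sup>2 + q) < \<bar>x\<bar>"
      proof -
        have "(w * sqrt (x\<^sup>2 + q))\<^sup>2 < \<bar>x\<bar>\<^sup>2" using that w q by (intro power_strict_mono) auto
        then have "w\<^sup>2 * (x\<^sup>2 + q) < x\<^sup>2" using q by (simp add: power_mult_distrib add_nonneg_pos less_imp_le)
        then have "w\<^sup>2 * q < x\<^sup>2 * (1 - w\<^sup>2)" by (simp add: algebra_simps)
        then have "w\<^sup>2 * b * q < x\<^sup>2" using w2 by (simp add: b_def pos_divide_less_eq)
        then have "(a * sqrt q)\<^sup>2 < \<bar>x\<bar>\<^sup>2" using b q by (simp add: a_def power_mult_distrib)
        then show ?thesis by (rule power_less_imp_less_base) simp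
      qed
      then show ?thesis by (auto simp: f_def indicator_def)
    qed
    then have "(\<integral>\<^sup>+x. f (x, x\<^sup>2 + q) \<partial>std_normal_distribution)
        \<le> (\<integral>\<^sup>+x. indicator {t. a * sqrt q < \<bar>t\<bar>} x \<partial>std_normal_distribution)"
      by (rule nn_integral_mono)
    also have "\<dots> \<le> ennreal (2 * std_normal_density (a * sqrt q) / (a * sqrt q))"
      using a q by (intro std_normal_tail) simp
    also have "2 * std_normal_density (a * sqrt q) / (a * sqrt q)
        = sqrt (2 / pi) / a * (exp (- (b - 1) / 2 * q) * (1 / sqrt q))"
    proof -
      have "- (a * sqrt q)\<^sup>2 / 2 = - (b - 1) / 2 * q" using q by (simp add: power_mult_distrib a2) (simp add: algebra_simps)
      moreover have "sqrt (2 / pi) = 2 / sqrt (2 * pi)"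
        by (simp add: real_sqrt_mult real_sqrt_divide divide_simps)
      ultimately show ?thesis by (simp add: std_normal_density_def)
    qed
    also have "\<dots> \<le> sqrt (2 / pi) / a * (exp (- (b - 1) / 2 * q) * (1 / 2 * (c * (1 / q) + 1 / c)))"
    proof -
      have "0 \<le> (c / sqrt q - 1)\<^sup>2 / (2 * c)" using c by simp
      also have "\<dots> = 1 / 2 * (c * (1 / q) + 1 / c) - 1 / sqrt q"
        using c q by (simp add: power2_diff power_divide field_simps power2_eq_square)
      finally show ?thesis using a by (intro mult_left_mono) auto
    qed
    also have "ennreal \<dots> = ennreal (sqrt (2 / pi) / a) * (ennreal (exp (- (b - 1) / 2 * q)) * U q)"
    proof -
      have "ennreal (1 / 2 * (c * (1 / q) + 1 / c)) = U q"
        unfolding U_def inv_laplace_pos[OF q] using c q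
        by (subst ennreal_mult, simp, simp, subst ennreal_plus, simp, simp, subst ennreal_mult, simp_all)
      then show ?thesis using a c q
        by (subst ennreal_mult, simp, simp, subst ennreal_mult, simp_all)
    qed
    finally show ?thesis by (simp add: ennreal_leI)
  qed
  have Q [measurable]: "(\<lambda>g. \<Sum>i\<in>I. (g i)\<^sup>2) \<in> borel_measurable (gaussian I)" by measurable
  interpret P: pair_sigma_finite std_normal_distribution "gaussian I"
    by (intro pair_sigma_finite.intro gI.sigma_finite_measure_axioms std_normal.sigma_finite_measures)
  define E where "E = {g \<in> space (gaussian (insert k I)).
           w * sqrt (\<Sum>i\<in>insert k I. (g i)\<^sup>2) < \<bar>\<Sum>i\<in>insert k I. v i * g i\<bar>}"
  have "E \<in> sets (gaussian (insert k I))" unfolding E_def by measurable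
  then have "emeasure (gaussian (insert k I)) E = (\<integral>\<^sup>+g. indicator E g \<partial>gaussian (insert k I))"
    by (rule nn_integral_indicator[symmetric])
  also have "\<dots> = (\<integral>\<^sup>+g. f (\<Sum>i\<in>insert k I. v i * g i, \<Sum>i\<in>insert k I. (g i)\<^sup>2) \<partial>gaussian (insert k I))"
    by (intro nn_integral_cong) (simp add: f_def indicator_def E_def)
  also have "\<dots> = (\<integral>\<^sup>+x. \<integral>\<^sup>+g. f (x, x\<^sup>2 + (\<Sum>i\<in>I. (g i)\<^sup>2)) \<partial>gaussian I \<partial>std_normal_distribution)"
    by (subst nn_integral_gaussian_linear_form[OF I(1,2) f]) (simp only: v real_sqrt_one mult_1)
  also have "\<dots> = (\<integral>\<^sup>+g. \<integral>\<^sup>+x. f (x, x\<^sup>2 + (\<Sum>i\<in>I. (g i)\<^sup>2)) \<partial>std_normal_distribution \<partial>gaussian I)"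
    by (rule P.Fubini'[symmetric]) measurable
  also have "\<dots> \<le> (\<integral>\<^sup>+g. ennreal (sqrt (2 / pi) / a) *
      (ennreal (exp (- (b - 1) / 2 * (\<Sum>i\<in>I. (g i)\<^sup>2))) * U (\<Sum>i\<in>I. (g i)\<^sup>2)) \<partial>gaussian I)"
    by (intro nn_integral_mono tail sum_nonneg) simp
  also have "\<dots> = ennreal (sqrt (2 / pi) / a) * (ennreal ((1 / sqrt b) ^ card I) *
      (\<integral>\<^sup>+g. U ((\<Sum>i\<in>I. (g i)\<^sup>2) / b) \<partial>gaussian I))"
    using b by (subst nn_integral_cmult, measurable, subst nn_integral_gaussian_tilt[OF I(1) U]) simp_all
  also have "(\<integral>\<^sup>+g. U ((\<Sum>i\<in>I. (g i)\<^sup>2) / b) \<partial>gaussian I)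
      = ennreal (1 / 2) * (ennreal c * ennreal (b / (?m - 2)) + ennreal (1 / c))"
    unfolding U_def using nn_integral_inv_laplace[OF I(1,3), of b] b
    by (simp add: nn_integral_cmult nn_integral_add gI.emeasure_space_1)
  also have "\<dots> = ennreal (1 / c)"
  proof -
    have "c * (b / (?m - 2)) = 1 / c"
    proof -
      have "c * c = (?m - 2) / b" using b I(3) by (simp add: c_def)
      then have "b / (?m - 2) = 1 / (c * c)" by simp
      then show ?thesis by simp
    qed
    then have "1 / 2 * (c * (b / (?m - 2)) + 1 / c) = 1 / c" by simp
    moreover have "ennreal (1 / 2 * (c * (b / (?m - 2)) + 1 / c))
        = ennreal (1 / 2) * (ennreal c * ennreal (b / (?m - 2)) + ennreal (1 / c))"
      using b c I(3)
      by (subst ennreal_mult, simp, simp, subst ennreal_plus, simp, simp, subst ennreal_mult, simp_all)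
    ultimately show ?thesis by simp
  qed
  also have "ennreal (sqrt (2 / pi) / a) * (ennreal ((1 / sqrt b) ^ card I) * ennreal (1 / c))
      = ennreal (sqrt (2 / pi) / a * ((1 / sqrt b) ^ card I * (1 / c)))"
    using a b c by (simp add: ennreal_mult[symmetric])
  also have "sqrt (2 / pi) / a * ((1 / sqrt b) ^ card I * (1 / c))
      = sqrt (2 / pi) * sqrt (1 - w\<^sup>2) ^ card I / (w * sqrt (?m - 2))"
  proof -
    have "1 / sqrt b = sqrt (1 - w\<^sup>2)" by (simp add: b_def real_sqrt_divide)
    moreover have "a * c = w * sqrt (?m - 2)" using b by (simp add: a_def c_def real_sqrt_divide)
    ultimately show ?thesis by simp
  qed
  finally show ?thesis unfolding E_def .
qed

text \<open>The logarithmic difference vanishes at 0 and has derivative t^2 / (1 - t). The quadratic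
  term is kept because it must later compensate for an exponent n - 1 in place of n.\<close>

lemma one_minus_le_exp:
  fixes x :: real
  assumes "0 \<le> x" "x < 1"
  shows "1 - x \<le> exp (- x - x\<^sup>2 / 2)"
proof -
  let ?g = "\<lambda>x::real. - x - x\<^sup>2 / 2 - ln (1 - x)"
  have "?g 0 \<le> ?g x"
  proof (rule DERIV_nonneg_imp_nondecreasing[OF assms(1)])
    fix t assume t: "0 \<le> t" "t \<le> x"
    have "(?g has_real_derivative (- 1 - t + 1 / (1 - t))) (at t)"
      using t assms by (auto intro!: derivative_eq_intros)
    moreover have "- 1 - t + 1 / (1 - t) = t\<^sup>2 / (1 - t)"
      using t assms by (simp add: power2_eq_square field_simps)
    ultimately show "\<exists>y. (?g has_real_derivative y) (at t) \<and> 0 \<le> y"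
      using t assms by (intro exI[of _ "t\<^sup>2 / (1 - t)"]) auto
  qed
  then have "ln (1 - x) \<le> - x - x\<^sup>2 / 2" by simp
  then have "exp (ln (1 - x)) \<le> exp (- x - x\<^sup>2 / 2)" by simp
  then show ?thesis using assms by simp
qed

lemma tail_exponent_pos:
  assumes "real n \<le> real (n - 1) * L" "n > 0"
  shows "L > 0"
proof (rule ccontr)
  assume "\<not> L > 0"
  then have "real (n - 1) * L \<le> 0" by (intro mult_nonneg_nonpos) auto
  then show False using assms by simp
qed

lemma gaussian_direction_tail_exp:
  fixes v :: "nat \<Rightarrow> real"
  assumes n: "n \<ge> 4" and v: "(\<Sum>i<n. (v i)\<^sup>2) = 1" and L: "real n \<le> real (n - 1) * L"
  shows "measure (gaussian {..<n}) {g \<in> space (gaussian {..<n}).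
           sqrt (2 / real n * L) * sqrt (\<Sum>i<n. (g i)\<^sup>2) < \<bar>\<Sum>i<n. v i * g i\<bar>}
         \<le> sqrt (real n / (real n - 3)) * (exp (- L) / sqrt (pi * L))"
proof -
  have L0: "L > 0" by (rule tail_exponent_pos[OF L]) (use n in simp)
  define w where "w = sqrt (2 / real n * L)"
  have w: "w > 0" using L0 n by (simp add: w_def)
  have w2: "w\<^sup>2 = 2 / real n * L" using L0 by (simp add: w_def)
  show ?thesis unfolding w_def[symmetric]
  proof (cases "w < 1")
    case False
    \<comment> \<open>For w >= 1 the event is empty by Cauchy-Schwarz, so the bound also covers
      large \<open>L\<close>.\<close>
    have "\<bar>\<Sum>i<n. v i * g i\<bar> \<le> w * sqrt (\<Sum>i<n. (g i)\<^sup>2)" for g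
    proof -
      have "\<bar>\<Sum>i<n. v i * g i\<bar> \<le> (\<Sum>i<n. \<bar>v i\<bar> * \<bar>g i\<bar>)"
        by (simp add: abs_mult[symmetric] sum_abs)
      also have "\<dots> \<le> L2_set v {..<n} * L2_set g {..<n}" by (rule L2_set_mult_ineq)
      also have "\<dots> = 1 * sqrt (\<Sum>i<n. (g i)\<^sup>2)" using v by (simp add: L2_set_def)
      also have "\<dots> \<le> w * sqrt (\<Sum>i<n. (g i)\<^sup>2)"
        using False by (intro mult_right_mono) (auto intro: sum_nonneg)
      finally show ?thesis .
    qed
    then have empty: "{g \<in> space (gaussian {..<n}). w * sqrt (\<Sum>i<n. (g i)\<^sup>2) < \<bar>\<Sum>i<n. v i * g i\<bar>} = {}"
      by (auto simp: not_less)
    show "measure (gaussian {..<n}) {g \<in> space (gaussian {..<n}). w * sqrt (\<Sum>i<n. (g i)\<^sup>2) < \<bar>\<Sum>i<n. v i * g i\<bar>}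
         \<le> sqrt (real n / (real n - 3)) * (exp (- L) / sqrt (pi * L))"
      unfolding empty using n L0 by simp
  next
    case True
    interpret G: prob_space "gaussian {..<n}" by (intro prob_space_PiM prob_space_std_normal)
    have ins: "{..<n} = insert 0 {1..<n}" using n by auto
    have card: "card {1..<n} = n - 1" by simp
    have rn: "real (n - 1) - 2 = real n - 3" using n by (simp add: of_nat_diff)
    let ?B = "sqrt (2 / pi) * sqrt (1 - w\<^sup>2) ^ (n - 1) / (w * sqrt (real n - 3))"
    have "emeasure (gaussian {..<n}) {g \<in> space (gaussian {..<n}).
           w * sqrt (\<Sum>i<n. (g i)\<^sup>2) < \<bar>\<Sum>i<n. v i * g i\<bar>} \<le> ennreal ?B"
      using gaussian_direction_tail[of "{1..<n}" 0 v w] v w True n unfolding ins card rn by simp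
    moreover have B0: "?B \<ge> 0" using w True n by (simp add: power_le_one)
    ultimately have "measure (gaussian {..<n}) {g \<in> space (gaussian {..<n}).
           w * sqrt (\<Sum>i<n. (g i)\<^sup>2) < \<bar>\<Sum>i<n. v i * g i\<bar>} \<le> ?B"
      by (simp add: G.emeasure_eq_measure)
    also have "?B \<le> sqrt (2 / pi) * exp (- L) / (w * sqrt (real n - 3))"
    proof -
      have w21: "0 \<le> w\<^sup>2" "w\<^sup>2 < 1" using w True by (simp_all add: power_less_one_iff)
      define e where "e = w\<^sup>2 + (w\<^sup>2)\<^sup>2 / 2"
      have "sqrt (1 - w\<^sup>2) \<le> sqrt (exp (- e))"
        using one_minus_le_exp[OF w21] by (simp add: e_def)
      also have "\<dots> = exp (- e / 2)"
        by (rule real_sqrt_unique) (simp_all add: exp_double[symmetric])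
      finally have "sqrt (1 - w\<^sup>2) ^ (n - 1) \<le> exp (- e / 2) ^ (n - 1)"
        using w21 by (intro power_mono) auto
      also have "\<dots> = exp (- (real (n - 1) * e / 2))" by (simp add: exp_of_nat_mult[symmetric])
      also have "\<dots> \<le> exp (- L)"
      proof -
        \<comment> \<open>The hypothesis n <= (n - 1) L says exactly that (n - 1) (1 + L / n) >= n:
          the second-order term makes up for the lost degree of freedom.\<close>
        have "real n * L \<le> (real (n - 1) + real (n - 1) * L / real n) * L"
        proof (rule mult_right_mono)
          have "1 \<le> real (n - 1) * L / real n" using L n by (simp add: pos_le_divide_eq)
          then show "real n \<le> real (n - 1) + real (n - 1) * L / real n" using n by (simp add: of_nat_diff)
        qed (use L0 in simp)
        also have "\<dots> = real n * (real (n - 1) * e / 2)"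
          using n unfolding e_def w2 by (simp add: power2_eq_square field_simps)
        finally show ?thesis using n by simp
      qed
      finally show ?thesis using w n by (intro divide_right_mono mult_left_mono) auto
    qed
    also have "\<dots> = sqrt (real n / (real n - 3)) * (exp (- L) / sqrt (pi * L))"
    proof -
      have "sqrt (2 / pi) / w = sqrt (real n / (pi * L))"
        using L0 n by (simp add: w_def real_sqrt_divide[symmetric] field_simps)
      moreover have "sqrt (2 / pi) * exp (- L) / (w * sqrt (real n - 3))
          = sqrt (2 / pi) / w * exp (- L) / sqrt (real n - 3)" by simp
      ultimately show ?thesis by (simp add: real_sqrt_divide)
    qed
    finally show "measure (gaussian {..<n}) {g \<in> space (gaussian {..<n}).
           w * sqrt (\<Sum>i<n. (g i)\<^sup>2) < \<bar>\<Sum>i<n. v i * g i\<bar>}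
         \<le> sqrt (real n / (real n - 3)) * (exp (- L) / sqrt (pi * L))" .
  qed
qed

subsection \<open>The law of the response\<close>

lemma distr_std_normal_affine:
  assumes "\<sigma> > 0"
  shows "distr std_normal_distribution borel (\<lambda>t. m + \<sigma> * t) = density lborel (\<lambda>t. ennreal (normal_density m \<sigma> t))"
proof -
  have "distributed std_normal_distribution lborel (\<lambda>t. t) (\<lambda>t. ennreal (std_normal_density t))"
    by (auto simp: distributed_def distr_id2)
  from prob_space.normal_density_affine[OF prob_space_std_normal this, of \<sigma> m] assms
  have "distributed std_normal_distribution lborel (\<lambda>t. m + \<sigma> * t) (\<lambda>t. ennreal (normal_density m \<sigma> t))"
    by simp
  from distributed_distr_eq_density[OF this] show ?thesis
    by (simp cong: distr_cong)
qed

lemma sets_response_law: "sets (response_law n p X \<beta> \<sigma>) = sets (PiM {..<n} (\<lambda>_. borel))"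
  unfolding response_law_def by (intro sets_PiM_cong) auto

lemma space_response_law: "space (response_law n p X \<beta> \<sigma>) = {..<n} \<rightarrow>\<^sub>E UNIV"
  by (simp add: response_law_def space_PiM)

definition response ::
  "nat \<Rightarrow> nat \<Rightarrow> (nat \<Rightarrow> nat \<Rightarrow> real) \<Rightarrow> (nat \<Rightarrow> real) \<Rightarrow> real \<Rightarrow> (nat \<Rightarrow> real) \<Rightarrow> nat \<Rightarrow> real" where
  "response n p X \<beta> \<sigma> g = (\<lambda>i\<in>{..<n}. mat_vec p X \<beta> i + \<sigma> * g i)"

lemma measurable_response [measurable]:
  "response n p X \<beta> \<sigma> \<in> measurable (gaussian {..<n}) (PiM {..<n} (\<lambda>_. borel))"
  unfolding response_def[abs_def] by measurable

text \<open>A product measure is determined by its values on boxes, and coordinatewise this is the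
  affine image of N(0, 1). Probabilities about the response thus become probabilities about a
  standard Gaussian vector g with residual \<sigma> g.\<close>

lemma response_law_eq_distr:
  assumes \<sigma>: "\<sigma> > 0"
  shows "response_law n p X \<beta> \<sigma> = distr (gaussian {..<n}) (PiM {..<n} (\<lambda>_. borel)) (response n p X \<beta> \<sigma>)"
proof -
  define N where "N = (\<lambda>i. density lborel (\<lambda>t. ennreal (normal_density (mat_vec p X \<beta> i) \<sigma> t)))"
  interpret N: product_prob_space N UNIV
    unfolding N_def by (rule product_prob_spaceI) (rule prob_space_normal_density[OF \<sigma>])
  have "distr (gaussian {..<n}) (PiM {..<n} (\<lambda>_. borel)) (response n p X \<beta> \<sigma>) = PiM {..<n} N"
  proof (rule N.PiM_eqI)
    show "sets (distr (gaussian {..<n}) (PiM {..<n} (\<lambda>_. borel)) (response n p X \<beta> \<sigma>)) = sets (PiM {..<n} N)"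
      unfolding sets_distr N_def by (intro sets_PiM_cong) auto
    fix A assume "\<And>i. i \<in> {..<n} \<Longrightarrow> A i \<in> sets (N i)"
    then have A [measurable]: "\<And>i. i \<in> {..<n} \<Longrightarrow> A i \<in> sets borel" by (simp add: N_def)
    let ?A = "\<lambda>i. (\<lambda>t. mat_vec p X \<beta> i + \<sigma> * t) -` A i"
    have A': "?A i \<in> sets std_normal_distribution" if "i \<in> {..<n}" for i
      using measurable_sets[of "\<lambda>t. mat_vec p X \<beta> i + \<sigma> * t" borel borel, OF _ A[OF that]] by simp
    have "PiE {..<n} A \<in> sets (PiM {..<n} (\<lambda>_. borel :: real measure))"
      using A by (intro sets_PiM_I_finite) auto
    then have "emeasure (distr (gaussian {..<n}) (PiM {..<n} (\<lambda>_. borel)) (response n p X \<beta> \<sigma>)) (PiE {..<n} A)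
        = emeasure (gaussian {..<n}) (response n p X \<beta> \<sigma> -` PiE {..<n} A \<inter> space (gaussian {..<n}))"
      by (intro emeasure_distr measurable_response)
    also have "response n p X \<beta> \<sigma> -` PiE {..<n} A \<inter> space (gaussian {..<n}) = PiE {..<n} ?A"
      by (auto simp: response_def space_PiM PiE_iff)
    also have "emeasure (gaussian {..<n}) (PiE {..<n} ?A) = (\<Prod>i<n. emeasure std_normal_distribution (?A i))"
      using A' by (intro std_normal.emeasure_PiM) auto
    also have "\<dots> = (\<Prod>i<n. emeasure (N i) (A i))"
    proof (rule prod.cong[OF refl])
      fix i assume i: "i \<in> {..<n}"
      show "emeasure std_normal_distribution (?A i) = emeasure (N i) (A i)"
        unfolding N_def distr_std_normal_affine[OF \<sigma>, symmetric]
        using A[OF i] by (subst emeasure_distr) auto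
    qed
    finally show "emeasure (distr (gaussian {..<n}) (PiM {..<n} (\<lambda>_. borel)) (response n p X \<beta> \<sigma>)) (PiE {..<n} A)
        = (\<Prod>i<n. emeasure (N i) (A i))" .
  qed simp
  then show ?thesis by (simp add: response_law_def N_def)
qed

lemma resid_response: "i < n \<Longrightarrow> resid p X (response n p X \<beta> \<sigma> g) \<beta> i = \<sigma> * g i"
  by (simp add: resid_def response_def)

lemma sigma_star_response:
  assumes "\<sigma> > 0"
  shows "sigma_star n p X (response n p X \<beta> \<sigma> g) \<beta> = \<sigma> * sqrt ((\<Sum>i<n. (g i)\<^sup>2) / real n)"
proof -
  have "L2_set (resid p X (response n p X \<beta> \<sigma> g) \<beta>) {..<n} = L2_set (\<lambda>i. \<sigma> * g i) {..<n}"
    by (intro L2_set_cong) (simp_all add: resid_response)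
  also have "\<dots> = \<sigma> * L2_set g {..<n}" using assms by (intro L2_set_right_distrib[symmetric]) simp
  finally show ?thesis by (simp add: sigma_star_def L2_set_def real_sqrt_divide)
qed

section \<open>Measurability of the oracle quantities and the union bound\<close>

lemma measurable_resid [measurable]:
  "i < n \<Longrightarrow> (\<lambda>y. resid p X y \<beta> i) \<in> borel_measurable (PiM {..<n} (\<lambda>_. borel))"
  unfolding resid_def by measurable

lemma measurable_sigma_star [measurable]:
  "(\<lambda>y. sigma_star n p X y \<beta>) \<in> borel_measurable (PiM {..<n} (\<lambda>_. borel))"
  unfolding sigma_star_def L2_set_def by measurable

lemma measurable_z_star [measurable]:
  "(\<lambda>y. z_star n p X y \<beta>) \<in> borel_measurable (PiM {..<n} (\<lambda>_. borel))"
  unfolding z_star_def linf_norm_def by measurable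

text \<open>\<open>mu\<close> involves an infimum over uncountably many \<nu>; measurability comes
  from monotonicity in \<open>lam\<close> instead.\<close>

lemma measurable_mu: "\<xi> > 1 \<Longrightarrow> (\<lambda>lam. mu n p X \<beta> lam \<xi>) \<in> borel_measurable borel"
  by (intro borel_measurable_mono monoI mu_mono)

lemma measurable_tau_star:
  assumes "\<xi> > 1"
  shows "(\<lambda>y. tau_star n p X y \<beta> lam0 \<xi>) \<in> borel_measurable (PiM {..<n} (\<lambda>_. borel))"
proof -
  note measurable_mu[OF assms, measurable]
  show ?thesis unfolding tau_star_def Let_def by measurable
qed

lemma measurable_noise_event:
  assumes "\<xi> > 1"
  shows "Measurable.pred (PiM {..<n} (\<lambda>_. borel)) (\<lambda>y. noise_event n p X y \<beta> lam0 \<xi>)"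
proof -
  have [measurable]: "(\<lambda>y. tau_star n p X y \<beta> lam0 \<xi>) \<in> borel_measurable (PiM {..<n} (\<lambda>_. borel))"
    by (rule measurable_tau_star[OF assms])
  have "(\<lambda>y. (1 - (tau_star n p X y \<beta> lam0 \<xi>)\<^sup>2) * lam0 * (\<xi> - 1) / (\<xi> + 1))
      \<in> borel_measurable (PiM {..<n} (\<lambda>_. borel))" by measurable
  then show ?thesis unfolding noise_event_def pred_def
    by (intro borel_measurable_le measurable_z_star)
qed

lemma measure_response_law:
  assumes \<sigma>: "\<sigma> > 0" and P: "Measurable.pred (PiM {..<n} (\<lambda>_. borel)) P"
  shows "measure (response_law n p X \<beta> \<sigma>) {y \<in> space (response_law n p X \<beta> \<sigma>). P y}
       = measure (gaussian {..<n}) {g \<in> space (gaussian {..<n}). P (response n p X \<beta> \<sigma> g)}"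
proof -
  let ?Y = "PiM {..<n} (\<lambda>_. borel :: real measure)"
  have "{y \<in> space ?Y. P y} \<in> sets ?Y" using P by (simp add: pred_def)
  then have "measure (distr (gaussian {..<n}) ?Y (response n p X \<beta> \<sigma>)) {y \<in> space ?Y. P y}
      = measure (gaussian {..<n}) (response n p X \<beta> \<sigma> -` {y \<in> space ?Y. P y} \<inter> space (gaussian {..<n}))"
    by (rule measure_distr[OF measurable_response])
  also have "response n p X \<beta> \<sigma> -` {y \<in> space ?Y. P y} \<inter> space (gaussian {..<n})
      = {g \<in> space (gaussian {..<n}). P (response n p X \<beta> \<sigma> g)}"
    using measurable_space[OF measurable_response] by blast
  finally show ?thesis by (simp only: response_law_eq_distr[OF \<sigma>] space_distr)
qed

text \<open>The ratio \<open>z_star\<close> is free of \<sigma>, and its event is a union over the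
  \<open>p\<close> columns. Each column divided by sqrt n is a unit vector, so
  \<open>gaussian_direction_tail_exp\<close> applies to every term.\<close>

lemma z_star_tail:
  assumes \<sigma>: "\<sigma> > 0" and n: "n \<ge> 4" and p: "p \<ge> 1" and L: "real n \<le> real (n - 1) * L"
    and X: "\<And>j. j < p \<Longrightarrow> (L2_set (\<lambda>i. X i j) {..<n})\<^sup>2 = real n"
  shows "measure (response_law n p X \<beta> \<sigma>) {y \<in> space (response_law n p X \<beta> \<sigma>). sqrt (2 / real n * L) < z_star n p X y \<beta>}
       \<le> real p * (sqrt (real n / (real n - 3)) * (exp (- L) / sqrt (pi * L)))"
proof -
  let ?G = "gaussian {..<n}" and ?w = "sqrt (2 / real n * L)"
  interpret G: prob_space ?G by (intro prob_space_PiM prob_space_std_normal)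
  let ?E = "\<lambda>j. {g \<in> space ?G. ?w * sqrt (\<Sum>i<n. (g i)\<^sup>2) < \<bar>\<Sum>i<n. X i j / sqrt (real n) * g i\<bar>}"
  have L0: "L > 0" by (rule tail_exponent_pos[OF L]) (use n in simp)
  have sub: "{g \<in> space ?G. ?w < z_star n p X (response n p X \<beta> \<sigma> g) \<beta>} \<subseteq> (\<Union>j<p. ?E j)"
  proof
    fix g assume "g \<in> {g \<in> space ?G. ?w < z_star n p X (response n p X \<beta> \<sigma> g) \<beta>}"
    then have g: "g \<in> space ?G" and less: "?w < z_star n p X (response n p X \<beta> \<sigma> g) \<beta>" by auto
    let ?y = "response n p X \<beta> \<sigma> g"
    define s where "s = sqrt ((\<Sum>i<n. (g i)\<^sup>2) / real n)"
    define h where "h j = (\<Sum>i<n. X i j * resid p X ?y \<beta> i) / real n" for j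
    have h: "h j = \<sigma> * (\<Sum>i<n. X i j * g i) / real n" for j
      by (simp add: h_def resid_response sum_distrib_left mult_ac)
    have ss: "sigma_star n p X ?y \<beta> = \<sigma> * s" by (simp add: s_def sigma_star_response[OF \<sigma>])
    have z: "z_star n p X ?y \<beta> = linf_norm p h / (\<sigma> * s)"
      by (simp add: z_star_def ss h_def[abs_def])
    have w0: "?w \<ge> 0" using L0 by simp
    \<comment> \<open>If the residual vanishes, division by zero makes \<open>z_star\<close> equal
      to 0, which cannot exceed the nonnegative threshold.\<close>
    have s0: "s > 0"
    proof (rule ccontr)
      assume "\<not> s > 0"
      moreover have "s \<ge> 0" unfolding s_def by (intro real_sqrt_ge_zero divide_nonneg_nonneg sum_nonneg) auto
      ultimately have "s = 0" by simp
      then show False using less w0 by (simp add: z)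
    qed
    have "linf_norm p h \<in> (\<lambda>j. \<bar>h j\<bar>) ` {..<p}"
      unfolding linf_norm_def using p by (intro Max_in) (auto simp: lessThan_empty_iff)
    then obtain j where j: "j < p" "linf_norm p h = \<bar>h j\<bar>" by auto
    have "?w * (\<sigma> * s) < \<bar>h j\<bar>" using less s0 \<sigma> by (simp add: z j pos_less_divide_eq)
    also have "\<bar>h j\<bar> = \<sigma> * (\<bar>\<Sum>i<n. X i j * g i\<bar> / real n)"
      using \<sigma> by (simp add: h abs_mult)
    finally have "\<sigma> * (?w * s) < \<sigma> * (\<bar>\<Sum>i<n. X i j * g i\<bar> / real n)" by (simp add: mult_ac)
    then have "?w * s < \<bar>\<Sum>i<n. X i j * g i\<bar> / real n" by (simp only: mult_less_cancel_left_pos[OF \<sigma>])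
    then have "?w * s * sqrt (real n) < \<bar>\<Sum>i<n. X i j * g i\<bar> / real n * sqrt (real n)"
      by (rule mult_strict_right_mono) (use n in simp)
    moreover have "?w * s * sqrt (real n) = ?w * sqrt (\<Sum>i<n. (g i)\<^sup>2)"
    proof -
      have "s * sqrt (real n) = sqrt (\<Sum>i<n. (g i)\<^sup>2)" using n by (simp add: s_def real_sqrt_divide)
      then show ?thesis by (simp only: mult.assoc)
    qed
    moreover have "\<bar>\<Sum>i<n. X i j * g i\<bar> / real n * sqrt (real n) = \<bar>\<Sum>i<n. X i j / sqrt (real n) * g i\<bar>"
    proof -
      have "a / real n * sqrt (real n) = a / sqrt (real n)" for a
        using real_div_sqrt[of "real n"] n by (simp add: field_simps)
      then have "\<bar>\<Sum>i<n. X i j * g i\<bar> / real n * sqrt (real n) = \<bar>\<Sum>i<n. X i j * g i\<bar> / sqrt (real n)" .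
      also have "\<dots> = \<bar>(\<Sum>i<n. X i j * g i) / sqrt (real n)\<bar>" by simp
      finally show ?thesis by (simp add: sum_divide_distrib)
    qed
    ultimately have "?w * sqrt (\<Sum>i<n. (g i)\<^sup>2) < \<bar>\<Sum>i<n. X i j / sqrt (real n) * g i\<bar>"
      by (simp only:)
    then show "g \<in> (\<Union>j<p. ?E j)" using g j(1) by blast
  qed
  have E: "?E j \<in> sets ?G" for j by measurable
  have "measure (response_law n p X \<beta> \<sigma>) {y \<in> space (response_law n p X \<beta> \<sigma>). ?w < z_star n p X y \<beta>}
      = measure ?G {g \<in> space ?G. ?w < z_star n p X (response n p X \<beta> \<sigma> g) \<beta>}"
    by (rule measure_response_law[OF \<sigma>]) measurable
  also have "\<dots> \<le> measure ?G (\<Union>j<p. ?E j)"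
    by (rule G.finite_measure_mono[OF sub]) (use E in auto)
  also have "\<dots> \<le> (\<Sum>j<p. measure ?G (?E j))"
    using E by (intro G.finite_measure_subadditive_finite) auto
  also have "\<dots> \<le> (\<Sum>j<p. sqrt (real n / (real n - 3)) * (exp (- L) / sqrt (pi * L)))"
  proof (intro sum_mono gaussian_direction_tail_exp[OF n _ L])
    fix j assume "j \<in> {..<p}"
    then have "(\<Sum>i<n. (X i j)\<^sup>2) = real n" using X[of j] by (simp add: L2_set_power2)
    then show "(\<Sum>i<n. (X i j / sqrt (real n))\<^sup>2) = 1"
      using n by (simp add: power_divide flip: sum_divide_distrib)
  qed
  finally show ?thesis by simp
qed

subsection \<open>Limit laws\<close>

text \<open>Monotonicity squeezes F n (xs n) between the values at x - d / 2 and x + d / 2 once xs n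
  lies between these points; continuity of the limit closes the gap. Pointwise convergence then
  suffices for shifted arguments.\<close>

lemma mono_tendsto_moving:
  fixes F :: "nat \<Rightarrow> real \<Rightarrow> real"
  assumes mono: "eventually (\<lambda>n. mono (F n)) sequentially" and conv: "\<And>x. (\<lambda>n. F n x) \<longlonglongrightarrow> G x"
    and cont: "isCont G x" and xs: "xs \<longlonglongrightarrow> x"
  shows "(\<lambda>n. F n (xs n)) \<longlonglongrightarrow> G x"
proof (rule order_tendstoI)
  fix a assume a: "a < G x"
  have "eventually (\<lambda>t. a < G t) (at x)"
    using cont a unfolding isCont_def by (rule order_tendstoD)
  then obtain d where d: "d > 0" "\<And>t. t \<noteq> x \<Longrightarrow> dist t x < d \<Longrightarrow> a < G t"
    unfolding eventually_at by auto
  have "a < G (x - d / 2)" using d by (auto simp: dist_real_def)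
  with conv have "eventually (\<lambda>n. a < F n (x - d / 2)) sequentially" by (rule order_tendstoD)
  moreover have "eventually (\<lambda>n. x - d / 2 < xs n) sequentially"
    using xs by (rule order_tendstoD) (use d in simp)
  ultimately show "eventually (\<lambda>n. a < F n (xs n)) sequentially"
    using mono by eventually_elim (meson less_imp_le less_le_trans monoD)
next
  fix a assume a: "G x < a"
  have "eventually (\<lambda>t. G t < a) (at x)"
    using cont a unfolding isCont_def by (rule order_tendstoD)
  then obtain d where d: "d > 0" "\<And>t. t \<noteq> x \<Longrightarrow> dist t x < d \<Longrightarrow> G t < a"
    unfolding eventually_at by auto
  have "G (x + d / 2) < a" using d by (auto simp: dist_real_def)
  with conv have "eventually (\<lambda>n. F n (x + d / 2) < a) sequentially" by (rule order_tendstoD)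
  moreover have "eventually (\<lambda>n. xs n < x + d / 2) sequentially"
    using xs by (rule order_tendstoD) (use d in simp)
  ultimately show "eventually (\<lambda>n. F n (xs n) < a) sequentially"
    using mono by eventually_elim (meson less_imp_le le_less_trans monoD)
qed

lemma mono_tendsto_moving_bot:
  fixes F :: "nat \<Rightarrow> real \<Rightarrow> real"
  assumes mono: "eventually (\<lambda>n. mono (F n)) sequentially" and nonneg: "\<And>n x. 0 \<le> F n x"
    and conv: "\<And>x. (\<lambda>n. F n x) \<longlonglongrightarrow> G x"
    and G: "(G \<longlongrightarrow> 0) at_bot" and xs: "filterlim xs at_bot sequentially"
  shows "(\<lambda>n. F n (xs n)) \<longlonglongrightarrow> 0"
proof (rule order_tendstoI)
  fix a :: real assume a: "0 < a"
  then have "eventually (\<lambda>t. G t < a) at_bot" using G by (auto dest: order_tendstoD)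
  then obtain K where K: "G K < a" by (auto simp: eventually_at_bot_linorder)
  with conv have "eventually (\<lambda>n. F n K < a) sequentially" by (auto dest: order_tendstoD)
  moreover have "eventually (\<lambda>n. xs n \<le> K) sequentially" using xs by (auto simp: filterlim_at_bot)
  ultimately show "eventually (\<lambda>n. F n (xs n) < a) sequentially"
    using mono by eventually_elim (meson le_less_trans monoD)
next
  fix a :: real assume "a < 0"
  then show "eventually (\<lambda>n. a < F n (xs n)) sequentially"
    by (intro always_eventually allI less_le_trans[OF _ nonneg])
qed

lemma mono_tendsto_moving_top:
  fixes F :: "nat \<Rightarrow> real \<Rightarrow> real"
  assumes mono: "eventually (\<lambda>n. mono (F n)) sequentially" and le: "eventually (\<lambda>n. \<forall>x. F n x \<le> 1) sequentially"
    and conv: "\<And>x. (\<lambda>n. F n x) \<longlonglongrightarrow> G x"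
    and G: "(G \<longlongrightarrow> 1) at_top" and xs: "filterlim xs at_top sequentially"
  shows "(\<lambda>n. F n (xs n)) \<longlonglongrightarrow> 1"
proof (rule order_tendstoI)
  fix a :: real assume a: "a < 1"
  then have "eventually (\<lambda>t. a < G t) at_top" using G by (auto dest: order_tendstoD)
  then obtain K where K: "a < G K" by (auto simp: eventually_at_top_linorder)
  with conv have "eventually (\<lambda>n. a < F n K) sequentially" by (auto dest: order_tendstoD)
  moreover have "eventually (\<lambda>n. K \<le> xs n) sequentially" using xs by (auto simp: filterlim_at_top)
  ultimately show "eventually (\<lambda>n. a < F n (xs n)) sequentially"
    using mono by eventually_elim (meson less_le_trans monoD)
next
  fix a :: real assume "1 < a"
  with le show "eventually (\<lambda>n. F n (xs n) < a) sequentially"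
    by (auto elim!: eventually_mono intro: le_less_trans)
qed

section \<open>Central limit theorem for the oracle scale\<close>

lemma isCont_cdf_std_normal: "isCont (cdf std_normal_distribution) x"
proof -
  interpret real_distribution std_normal_distribution by (rule real_dist_normal_dist)
  have "emeasure std_normal_distribution {x} = 0"
    by (subst emeasure_density) (auto simp: nn_integral_0_iff_AE indicator_def intro: AE_I[of _ _ "{x}"])
  then show ?thesis by (simp add: isCont_cdf measure_def)
qed

lemma cdf_normal:
  assumes "\<sigma> > 0"
  shows "cdf (density lborel (\<lambda>t. ennreal (normal_density 0 \<sigma> t))) x = cdf std_normal_distribution (x / \<sigma>)"
proof -
  have "(\<lambda>t. 0 + \<sigma> * t) -` {..x} \<inter> space std_normal_distribution = {..x / \<sigma>}"
    using assms by (auto simp: pos_le_divide_eq mult.commute)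
  then show ?thesis unfolding distr_std_normal_affine[OF assms, symmetric] cdf_def
    by (subst measure_distr) auto
qed

lemma indep_vars_gaussian: "prob_space.indep_vars (gaussian UNIV) (\<lambda>_. borel) (\<lambda>i \<omega>. \<omega> i) UNIV"
proof -
  have P: "prob_space (gaussian UNIV)" by (intro prob_space_PiM prob_space_std_normal)
  have "distr (gaussian UNIV) borel (\<lambda>\<omega>. \<omega> i) = std_normal_distribution" for i
  proof -
    have "distr (gaussian UNIV) borel (\<lambda>\<omega>. \<omega> i) = distr (gaussian UNIV) std_normal_distribution (\<lambda>\<omega>. \<omega> i)"
      by (rule distr_cong) auto
    then show ?thesis using std_normal.PiM_component[of i] by simp
  qed
  moreover have "distr (gaussian UNIV) (PiM UNIV (\<lambda>_. borel)) (\<lambda>\<omega>. \<lambda>i\<in>UNIV. \<omega> i) = gaussian UNIV"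
  proof -
    have "(\<lambda>\<omega> :: nat \<Rightarrow> real. \<lambda>i\<in>UNIV. \<omega> i) = (\<lambda>\<omega>. \<omega>)" by (auto simp: fun_eq_iff)
    moreover have "sets (PiM UNIV (\<lambda>_. borel)) = sets (gaussian UNIV)" by (intro sets_PiM_cong) auto
    ultimately show ?thesis by (simp add: distr_id2)
  qed
  ultimately show ?thesis
    by (subst prob_space.indep_vars_iff_distr_eq_PiM[OF P]) auto
qed

text \<open>A squared standard normal has mean 1 and variance 3 - 1 = 2. The central limit theorem
  is stated for one sequence on one space, so it is applied on the infinite product and read off on
  the first n coordinates.\<close>

lemma chi_square_clt:
  "(\<lambda>n. measure (gaussian {..<n}) {g \<in> space (gaussian {..<n}). (\<Sum>i<n. (g i)\<^sup>2 - 1) / sqrt (2 * real n) \<le> x})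
     \<longlonglongrightarrow> cdf std_normal_distribution x"
proof -
  let ?M = "gaussian UNIV"
  define X where "X = (\<lambda>(i::nat) (\<omega> :: nat \<Rightarrow> real). (\<omega> i)\<^sup>2)"
  have P: "prob_space ?M" by (intro prob_space_PiM prob_space_std_normal)
  have comp: "distr ?M std_normal_distribution (\<lambda>\<omega>. \<omega> i) = std_normal_distribution" for i
    using std_normal.PiM_component[of i] by simp
  have int: "integrable ?M (\<lambda>\<omega>. (\<omega> i) ^ k)" for i k
  proof -
    have "integrable std_normal_distribution (\<lambda>x. x ^ k)"
      using integrable_std_normal_moment[of k] by (subst integrable_density) auto
    then have "integrable (distr ?M std_normal_distribution (\<lambda>\<omega>. \<omega> i)) (\<lambda>x. x ^ k)" by (simp add: comp)
    then show ?thesis by (subst (asm) integrable_distr_eq) auto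
  qed
  have mom: "integral\<^sup>L ?M (\<lambda>\<omega>. (\<omega> i) ^ (2 * k)) = fact (2 * k) / (2 ^ k * fact k)" for i k
  proof -
    have "integral\<^sup>L ?M (\<lambda>\<omega>. (\<omega> i) ^ (2 * k)) = integral\<^sup>L (distr ?M std_normal_distribution (\<lambda>\<omega>. \<omega> i)) (\<lambda>x. x ^ (2 * k))"
      by (rule integral_distr[symmetric]) auto
    also have "\<dots> = integral\<^sup>L std_normal_distribution (\<lambda>x. x ^ (2 * k))" by (simp add: comp)
    also have "\<dots> = fact (2 * k) / (2 ^ k * fact k)"
      using integral_std_normal_moment_even[of k] by (subst integral_density) auto
    finally show ?thesis .
  qed
  have m2: "integral\<^sup>L ?M (X i) = 1" for i using mom[of i 1] by (simp add: X_def)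
  have m4: "integral\<^sup>L ?M (\<lambda>\<omega>. (X i \<omega>)\<^sup>2) = 3" for i
    using mom[of i 2] by (simp add: X_def power_mult[symmetric] fact_numeral)
  have sq: "integrable ?M (\<lambda>\<omega>. (X i \<omega>)\<^sup>2)" for i
    using int[of i 4] by (simp add: X_def power_mult[symmetric])
  have var: "integral\<^sup>L ?M (\<lambda>\<omega>. (X i \<omega> - integral\<^sup>L ?M (X i))\<^sup>2) = (sqrt 2)\<^sup>2" for i
  proof -
    have "integrable ?M (X i)" using int[of i 2] by (simp add: X_def)
    from prob_space.variance_eq[OF P this sq] show ?thesis by (simp add: m2 m4)
  qed
  have indep: "prob_space.indep_vars ?M (\<lambda>_. borel) X UNIV"
    unfolding X_def by (rule prob_space.indep_vars_compose2[OF P indep_vars_gaussian]) auto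
  have distr: "distr ?M borel (X i) = distr std_normal_distribution borel (\<lambda>x. x\<^sup>2)" for i
  proof -
    have "distr (distr ?M std_normal_distribution (\<lambda>\<omega>. \<omega> i)) borel (\<lambda>x. x\<^sup>2) = distr ?M borel (X i)"
      by (subst distr_distr) (auto simp: X_def comp_def)
    then show ?thesis by (simp add: comp)
  qed
  have "weak_conv_m (\<lambda>n. distr ?M borel (\<lambda>\<omega>. (\<Sum>i<n. X i \<omega> - 1) / sqrt (real n * (sqrt 2)\<^sup>2))) std_normal_distribution"
    by (rule prob_space.central_limit_theorem[OF P indep m2 _ sq var distr]) simp
  then have lim: "(\<lambda>n. cdf (distr ?M borel (\<lambda>\<omega>. (\<Sum>i<n. X i \<omega> - 1) / sqrt (real n * (sqrt 2)\<^sup>2))) x)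
      \<longlonglongrightarrow> cdf std_normal_distribution x"
    using isCont_cdf_std_normal unfolding weak_conv_m_def weak_conv_def by blast
  have "cdf (distr ?M borel (\<lambda>\<omega>. (\<Sum>i<n. X i \<omega> - 1) / sqrt (real n * (sqrt 2)\<^sup>2))) x
     = measure (gaussian {..<n}) {g \<in> space (gaussian {..<n}). (\<Sum>i<n. (g i)\<^sup>2 - 1) / sqrt (2 * real n) \<le> x}" for n
  proof -
    let ?S = "{g \<in> space (gaussian {..<n}). (\<Sum>i<n. (g i)\<^sup>2 - 1) / sqrt (2 * real n) \<le> x}"
    let ?f = "\<lambda>\<omega>. (\<Sum>i<n. X i \<omega> - 1) / sqrt (real n * (sqrt 2)\<^sup>2)"
    have f [measurable]: "?f \<in> borel_measurable ?M" unfolding X_def by measurable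
    have S: "?S \<in> sets (gaussian {..<n})" by measurable
    have "cdf (distr ?M borel ?f) x = measure ?M (?f -` {..x} \<inter> space ?M)"
      unfolding cdf_def by (rule measure_distr[OF f]) simp
    also have "?f -` {..x} \<inter> space ?M = (\<lambda>\<omega>. restrict \<omega> {..<n}) -` ?S \<inter> space ?M"
      by (auto simp: X_def space_PiM mult.commute)
    also have "measure ?M \<dots> = measure (distr ?M (gaussian {..<n}) (\<lambda>\<omega>. restrict \<omega> {..<n})) ?S"
      by (rule measure_distr[symmetric, OF _ S]) (rule measurable_restrict_subset, simp)
    also have "\<dots> = measure (gaussian {..<n}) ?S"
      by (subst std_normal.distr_PiM_restrict_finite) auto
    finally show ?thesis .
  qed
  with lim show ?thesis by simp
qed

text \<open>The delta method as an exact equivalence: for x^2 < N the number 1 + x / sqrt N is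
  positive, so squaring loses nothing. The curvature survives only as the shift x^2 / sqrt(2 N) of
  the threshold, which vanishes as N grows.\<close>

lemma scale_le_iff_square_le:
  fixes N Q x \<sigma> :: real
  assumes \<sigma>: "\<sigma> > 0" and N: "x\<^sup>2 < N" and Q: "Q \<ge> 0"
  shows "sqrt N * (\<sigma> * sqrt (Q / N) / \<sigma> - 1) \<le> x
     \<longleftrightarrow> (Q - N) / sqrt (2 * N) \<le> sqrt 2 * x + x\<^sup>2 / sqrt (2 * N)"
proof -
  have N0: "N > 0" using N by (rule le_less_trans[OF zero_le_power2])
  define u where "u = 1 + x / sqrt N"
  have "\<bar>x\<bar> < sqrt N" using N by (simp add: real_less_rsqrt)
  then have "- 1 < x / sqrt N" using N0 by (simp add: pos_less_divide_eq abs_less_iff)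
  then have u: "u > 0" by (simp add: u_def)
  have "sqrt N * (\<sigma> * sqrt (Q / N) / \<sigma> - 1) \<le> x \<longleftrightarrow> sqrt (Q / N) - 1 \<le> x / sqrt N"
    using \<sigma> N0 by (simp add: pos_le_divide_eq mult.commute)
  also have "\<dots> \<longleftrightarrow> sqrt (Q / N) \<le> sqrt (u\<^sup>2)" using u by (auto simp: u_def)
  also have "\<dots> \<longleftrightarrow> Q / N \<le> u\<^sup>2" by (rule real_sqrt_le_iff)
  also have "\<dots> \<longleftrightarrow> Q \<le> N * u\<^sup>2" using N0 by (simp add: pos_divide_le_eq mult.commute)
  also have "N * u\<^sup>2 = N + 2 * x * sqrt N + x\<^sup>2"
  proof -
    have "(sqrt N * u)\<^sup>2 = (sqrt N + x)\<^sup>2" using N0 by (simp add: u_def distrib_left)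
    then show ?thesis using N0 by (simp add: power_mult_distrib power2_sum)
  qed
  also have "Q \<le> N + 2 * x * sqrt N + x\<^sup>2
      \<longleftrightarrow> (Q - N) / sqrt (2 * N) \<le> (2 * x * sqrt N + x\<^sup>2) / sqrt (2 * N)"
    using N0 by (simp add: divide_le_cancel algebra_simps)
  also have "(2 * x * sqrt N + x\<^sup>2) / sqrt (2 * N) = sqrt 2 * x + x\<^sup>2 / sqrt (2 * N)"
  proof -
    have eq: "2 * x * sqrt N = sqrt 2 * x * sqrt (2 * N)" by (simp add: real_sqrt_mult)
    have nz: "sqrt (2 * N) \<noteq> 0" using N0 by simp
    show ?thesis unfolding add_divide_distrib eq by (simp only: nonzero_mult_div_cancel_right[OF nz])
  qed
  finally show ?thesis .
qed

lemma sigma_star_clt: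
  assumes \<sigma>: "eventually (\<lambda>n. \<sigma> n > 0) sequentially"
  shows "(\<lambda>n. measure (response_law n (p n) (X n) (\<beta> n) (\<sigma> n))
           {y \<in> space (response_law n (p n) (X n) (\<beta> n) (\<sigma> n)).
             sqrt (real n) * (sigma_star n (p n) (X n) y (\<beta> n) / \<sigma> n - 1) \<le> x})
         \<longlonglongrightarrow> cdf std_normal_distribution (sqrt 2 * x)"
proof -
  define H where "H = (\<lambda>n z. measure (gaussian {..<n})
    {g \<in> space (gaussian {..<n}). (\<Sum>i<n. (g i)\<^sup>2 - 1) / sqrt (2 * real n) \<le> z})"
  have conv: "(\<lambda>n. H n z) \<longlonglongrightarrow> cdf std_normal_distribution z" for z
    unfolding H_def by (rule chi_square_clt)
  have mono: "mono (H n)" for n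
  proof -
    interpret G: prob_space "gaussian {..<n}" by (intro prob_space_PiM prob_space_std_normal)
    show ?thesis unfolding H_def by (intro monoI G.finite_measure_mono) auto
  qed
  have ev: "eventually (\<lambda>n. mono (H n)) sequentially" by (simp add: mono)
  have "(\<lambda>n. x\<^sup>2 / sqrt (2 * real n)) \<longlonglongrightarrow> 0" by real_asymp
  from tendsto_add[OF tendsto_const[of "sqrt 2 * x"] this]
  have "(\<lambda>n. sqrt 2 * x + x\<^sup>2 / sqrt (2 * real n)) \<longlonglongrightarrow> sqrt 2 * x" by simp
  then have "(\<lambda>n. H n (sqrt 2 * x + x\<^sup>2 / sqrt (2 * real n))) \<longlonglongrightarrow> cdf std_normal_distribution (sqrt 2 * x)"
    by (rule mono_tendsto_moving[OF ev conv isCont_cdf_std_normal])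
  moreover have "eventually (\<lambda>n. real n > x\<^sup>2) sequentially" by real_asymp
  then have "eventually (\<lambda>n. H n (sqrt 2 * x + x\<^sup>2 / sqrt (2 * real n))
      = measure (response_law n (p n) (X n) (\<beta> n) (\<sigma> n))
           {y \<in> space (response_law n (p n) (X n) (\<beta> n) (\<sigma> n)).
             sqrt (real n) * (sigma_star n (p n) (X n) y (\<beta> n) / \<sigma> n - 1) \<le> x}) sequentially"
    using \<sigma>
  proof eventually_elim
    case (elim n)
    have "measure (response_law n (p n) (X n) (\<beta> n) (\<sigma> n))
           {y \<in> space (response_law n (p n) (X n) (\<beta> n) (\<sigma> n)).
             sqrt (real n) * (sigma_star n (p n) (X n) y (\<beta> n) / \<sigma> n - 1) \<le> x}
      = measure (gaussian {..<n}) {g \<in> space (gaussian {..<n}). sqrt (real n) *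
          (sigma_star n (p n) (X n) (response n (p n) (X n) (\<beta> n) (\<sigma> n) g) (\<beta> n) / \<sigma> n - 1) \<le> x}"
      by (rule measure_response_law[OF elim(2)]) measurable
    also have "\<dots> = H n (sqrt 2 * x + x\<^sup>2 / sqrt (2 * real n))"
      unfolding H_def sigma_star_response[OF elim(2)]
      by (subst scale_le_iff_square_le[OF elim(2,1)]) (simp_all add: sum_nonneg sum_subtractf)
    finally show ?case ..
  qed
  ultimately show ?thesis by (rule Lim_transform_eventually)
qed

section \<open>From the oracle scale to the estimated scale\<close>

lemma scaled_lasso_near_sigma_star:
  assumes \<xi>: "\<xi> > 1" and n: "n \<ge> 1" and p: "p \<ge> 1" and lam0: "lam0 > 0" and \<sigma>: "\<sigma> > 0"
    and est: "scaled_lasso_estimator n p X lam0 bhat shat" and y: "y \<in> {..<n} \<rightarrow>\<^sub>E UNIV"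
    and s: "\<sigma> / 2 \<le> sigma_star n p X y \<beta>" "sigma_star n p X y \<beta> \<le> 2 * \<sigma>"
    and d: "8 * d \<le> 1" and z: "z_star n p X y \<beta> \<le> (1 - 4 * d) * lam0 * (\<xi> - 1) / (\<xi> + 1)"
    and d_def: "d = lam0 * mu n p X \<beta> (\<sigma> * lam0) \<xi> / \<sigma>"
  shows "\<bar>shat y - sigma_star n p X y \<beta>\<bar> \<le> 16 * d * \<sigma>"
proof -
  define s where "s = sigma_star n p X y \<beta>"
  have s0: "s > 0" "\<sigma> \<le> 2 * s" "s \<le> 2 * \<sigma>" using s \<sigma> by (simp_all add: s_def)
  define q where "q = (tau_star n p X y \<beta> lam0 \<xi>)\<^sup>2"
  have q0: "q \<ge> 0" by (simp add: q_def)
  have "q * s = lam0 * mu n p X \<beta> (s * lam0) \<xi>"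
    using tau_star_power2[OF \<xi>, of lam0 n p X y \<beta>] lam0 s0 by (simp add: q_def s_def)
  \<comment> \<open>The random \<open>mu\<close> is compared with the one at the true \<sigma>. The
    bound s <= 2 \<sigma> gives one factor 2 by \<open>mu_scale\<close>, and \<sigma> <= 2 s gives
    another, so q <= 4 d <= 1 / 2.\<close>
  also have "\<dots> \<le> lam0 * (2 * mu n p X \<beta> (\<sigma> * lam0) \<xi>)"
  proof (rule mult_left_mono)
    have "mu n p X \<beta> (s * lam0) \<xi> \<le> mu n p X \<beta> (2 * (\<sigma> * lam0)) \<xi>"
      using s0 lam0 by (intro mu_mono[OF \<xi>]) (simp flip: mult.assoc)
    then show "mu n p X \<beta> (s * lam0) \<xi> \<le> 2 * mu n p X \<beta> (\<sigma> * lam0) \<xi>"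
      using mu_scale[OF \<xi>, of 2 n p X \<beta> "\<sigma> * lam0"] by simp
  qed (use lam0 in simp)
  also have "\<dots> = 2 * d * \<sigma>" using \<sigma> by (simp add: d_def)
  also have "\<dots> \<le> 2 * d * (2 * s)"
    using s0 lam0 \<sigma> mu_nonneg[OF \<xi>, of n p X \<beta> "\<sigma> * lam0"] by (intro mult_left_mono) (auto simp: d_def)
  finally have q: "q \<le> 4 * d" using s0 by simp
  have noise: "noise_event n p X y \<beta> lam0 \<xi>"
  proof -
    have "(1 - 4 * d) * (lam0 * (\<xi> - 1) / (\<xi> + 1)) \<le> (1 - q) * (lam0 * (\<xi> - 1) / (\<xi> + 1))"
      using q \<xi> lam0 by (intro mult_right_mono) auto
    then show ?thesis using z by (simp add: noise_event_def q_def)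
  qed
  \<comment> \<open>The estimator is constrained only where a scaled lasso minimiser exists. A
    square-root lasso minimiser has scale at least (1 - q) s > 0 on the noise event, so one does
    exist at this \<open>y\<close>.\<close>
  obtain b where b: "\<And>v. sigma_star n p X y b + lam0 * l1_norm {..<p} b
      \<le> sigma_star n p X y v + lam0 * l1_norm {..<p} v"
    using sqrt_lasso_exists[OF lam0] by blast
  have "(1 - q) * s \<le> sigma_star n p X y b"
    using sqrt_lasso_scale_lower[OF \<xi> n p lam0 _ noise b] s0 by (simp add: q_def s_def)
  moreover have "(1 - q) * s > 0" using q d s0 by simp
  ultimately have "is_scaled_lasso n p X y lam0 b (sigma_star n p X y b)"
    by (intro sqrt_lasso_is_scaled_lasso b) simp
  then have sl: "is_scaled_lasso n p X y lam0 (bhat y) (shat y)"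
    using est y unfolding scaled_lasso_estimator_def by blast
  have lower: "(1 - q) * s \<le> shat y" and upper: "(1 - q) * shat y \<le> s"
    using scaled_lasso_bounds(1,2)[OF \<xi> n p lam0 sl _ noise] s0 by (simp_all add: q_def s_def)
  have "shat y \<le> (1 + 2 * q) * s"
  proof -
    have "shat y * (1 - q) * (1 + 2 * q) \<le> s * (1 + 2 * q)"
      using upper q0 by (intro mult_right_mono) (auto simp: mult.commute)
    \<comment> \<open>For q <= 1 / 2 the factor 1 / (1 - q) is at most 1 + 2 q. The relative error
      is then at most 2 q, and 2 * (4 d) * (2 \<sigma>) gives the constant 16.\<close>
    moreover have "shat y * 1 \<le> shat y * ((1 - q) * (1 + 2 * q))"
    proof (rule mult_left_mono)
      have "0 \<le> q * (1 - 2 * q)" using q d q0 by (intro mult_nonneg_nonneg) auto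
      then show "1 \<le> (1 - q) * (1 + 2 * q)" by (simp add: algebra_simps)
    qed (use sl in \<open>simp add: is_scaled_lasso_iff\<close>)
    ultimately show ?thesis by (simp add: mult_ac)
  qed
  then have "\<bar>shat y - s\<bar> \<le> 2 * q * s" using lower q0 s0 by (simp add: abs_le_iff algebra_simps)
  also have "\<dots> \<le> 2 * (4 * d) * (2 * \<sigma>)" using q q0 s0 by (intro mult_mono) auto
  finally show ?thesis by (simp add: s_def)
qed

text \<open>The threshold of the noise event is random through \<tau>, but the almost sure condition
  on \<open>lam0\<close> places it above the deterministic level sqrt(2 L / n). It remains to bound
  the probability that \<open>z_star\<close> exceeds this level.\<close>

lemma noise_event_probability:
  assumes \<xi>: "\<xi> > 1" and n: "n \<ge> 4" and p: "p \<ge> 1" and \<sigma>: "\<sigma> > 0"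
    and L: "real n \<le> real (n - 1) * L"
    and X: "\<And>j. j < p \<Longrightarrow> (L2_set (\<lambda>i. X i j) {..<n})\<^sup>2 = real n"
    and ae: "AE y in response_law n p X \<beta> \<sigma>.
          let \<tau> = tau_star n p X y \<beta> lam0 \<xi> in
          \<tau> < 1 \<and> lam0 \<ge> sqrt (2 / real n * L) * (\<xi> + 1) / ((\<xi> - 1) * (1 - \<tau>\<^sup>2))"
    and lam0: "lam0 > 0"
  shows "measure (response_law n p X \<beta> \<sigma>)
           {y \<in> space (response_law n p X \<beta> \<sigma>). noise_event n p X y \<beta> lam0 \<xi>}
         \<ge> 1 - real p * (sqrt (real n / (real n - 3)) * (exp (- L) / sqrt (pi * L)))"
proof -
  let ?R = "response_law n p X \<beta> \<sigma>" and ?w = "sqrt (2 / real n * L)"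
  interpret R: prob_space ?R by (rule prob_space_response_law[OF \<sigma>])
  let ?E = "{y \<in> space ?R. ?w < z_star n p X y \<beta>}"
  have E: "?E \<in> sets ?R"
  proof -
    have "{y \<in> space (PiM {..<n} (\<lambda>_. borel)). ?w < z_star n p X y \<beta>} \<in> sets (PiM {..<n} (\<lambda>_. borel))"
      by measurable
    then show ?thesis using sets_eq_imp_space_eq[OF sets_response_law] by (simp add: sets_response_law)
  qed
  have N: "{y \<in> space ?R. noise_event n p X y \<beta> lam0 \<xi>} \<in> sets ?R"
    using measurable_noise_event[OF \<xi>, of n p X \<beta> lam0] sets_eq_imp_space_eq[OF sets_response_law]
    by (simp add: pred_def sets_response_law)
  have "AE y in ?R. y \<in> space ?R - ?E \<longrightarrow> y \<in> {y \<in> space ?R. noise_event n p X y \<beta> lam0 \<xi>}"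
    using ae
  proof eventually_elim
    case (elim y)
    define \<tau> where "\<tau> = tau_star n p X y \<beta> lam0 \<xi>"
    have \<tau>: "0 \<le> \<tau>" "\<tau> < 1" and lam: "?w * (\<xi> + 1) / ((\<xi> - 1) * (1 - \<tau>\<^sup>2)) \<le> lam0"
      using elim tau_star_nonneg[OF \<xi>, of lam0 n p X y \<beta>] lam0 by (simp_all add: \<tau>_def Let_def)
    have "\<tau>\<^sup>2 < 1" using \<tau> by (simp add: power_less_one_iff)
    then have pos: "(\<xi> - 1) * (1 - \<tau>\<^sup>2) > 0" using \<xi> by simp
    have "?w * (\<xi> + 1) \<le> lam0 * ((\<xi> - 1) * (1 - \<tau>\<^sup>2))"
      using lam unfolding pos_divide_le_eq[OF pos] .
    then have "?w \<le> lam0 * ((\<xi> - 1) * (1 - \<tau>\<^sup>2)) / (\<xi> + 1)"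
      using \<xi> by (subst pos_le_divide_eq) auto
    then have "?w \<le> (1 - \<tau>\<^sup>2) * lam0 * (\<xi> - 1) / (\<xi> + 1)" by (simp only: mult_ac)
    then show ?case by (auto simp: noise_event_def \<tau>_def)
  qed
  then have "measure ?R (space ?R - ?E) \<le> measure ?R {y \<in> space ?R. noise_event n p X y \<beta> lam0 \<xi>}"
    by (rule R.finite_measure_mono_AE[OF _ N])
  moreover have "measure ?R (space ?R - ?E) = 1 - measure ?R ?E" by (rule R.prob_compl[OF E])
  ultimately show ?thesis using z_star_tail[OF \<sigma> n p L, where X = X and \<beta> = \<beta>, OF X] by simp
qed

lemma eventually_tail_exponent:
  assumes L: "filterlim L at_top sequentially"
  shows "eventually (\<lambda>n. real n \<le> real (n - 1) * L n) sequentially"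
proof -
  have "eventually (\<lambda>n. 2 \<le> L n) sequentially" using L by (simp add: filterlim_at_top)
  moreover have "eventually (\<lambda>n. n \<ge> 2) sequentially" by (rule eventually_ge_at_top)
  ultimately show ?thesis
  proof eventually_elim
    case (elim n)
    have "real n \<le> real (n - 1) * 2" using elim by (simp add: of_nat_diff)
    also have "\<dots> \<le> real (n - 1) * L n" using elim by (intro mult_left_mono) auto
    finally show ?case .
  qed
qed

lemma noise_event_asymptotic:
  fixes p :: "nat \<Rightarrow> nat" and \<epsilon> lam0 :: "nat \<Rightarrow> real"
  assumes \<xi>: "\<xi> > 1"
    and pos: "\<forall>\<^sub>F n in sequentially. p n \<ge> 1 \<and> \<sigma> n > 0 \<and> \<epsilon> n > 0 \<and> lam0 n > 0"
    and X: "\<forall>\<^sub>F n in sequentially. \<forall>j<p n. (L2_set (\<lambda>i. X n i j) {..<n})\<^sup>2 = real n"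
    and ae: "\<forall>\<^sub>F n in sequentially. AE y in response_law n (p n) (X n) (\<beta> n) (\<sigma> n).
          let \<tau> = tau_star n (p n) (X n) y (\<beta> n) (lam0 n) \<xi> in
          \<tau> < 1 \<and>
          lam0 n \<ge> sqrt (2 / real n * ln (real (p n) / \<epsilon> n)) * (\<xi> + 1)
                      / ((\<xi> - 1) * (1 - \<tau>\<^sup>2))"
    and L: "filterlim (\<lambda>n. ln (real (p n) / \<epsilon> n)) at_top sequentially"
  shows "\<exists>r :: nat \<Rightarrow> real. r \<longlonglongrightarrow> 0 \<and>
          (\<forall>\<^sub>F n in sequentially.
            measure (response_law n (p n) (X n) (\<beta> n) (\<sigma> n))
              {y \<in> space (response_law n (p n) (X n) (\<beta> n) (\<sigma> n)).
                 noise_event n (p n) (X n) y (\<beta> n) (lam0 n) \<xi>}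
            \<ge> 1 - (1 + r n) * (\<epsilon> n / sqrt (pi * ln (real (p n) / \<epsilon> n))))"
proof (intro exI conjI)
  \<comment> \<open>For L = ln (p / \<epsilon>) the factor exp(-L) = \<epsilon> / p cancels the
    \<open>p\<close> of the union bound, leaving only the ratio from the inverse chi-square mean as
    1 + o(1).\<close>
  let ?r = "\<lambda>n. sqrt (real n / (real n - 3)) - 1"
  show "?r \<longlonglongrightarrow> 0" by real_asymp
  show "\<forall>\<^sub>F n in sequentially.
            measure (response_law n (p n) (X n) (\<beta> n) (\<sigma> n))
              {y \<in> space (response_law n (p n) (X n) (\<beta> n) (\<sigma> n)).
                 noise_event n (p n) (X n) y (\<beta> n) (lam0 n) \<xi>}
            \<ge> 1 - (1 + ?r n) * (\<epsilon> n / sqrt (pi * ln (real (p n) / \<epsilon> n)))"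
    using pos X ae eventually_tail_exponent[OF L] eventually_ge_at_top[of 4]
  proof eventually_elim
    case (elim n)
    have "exp (- ln (real (p n) / \<epsilon> n)) = \<epsilon> n / real (p n)"
      using elim(1) by (simp add: exp_minus)
    then have "real (p n) * (sqrt (real n / (real n - 3)) *
        (exp (- ln (real (p n) / \<epsilon> n)) / sqrt (pi * ln (real (p n) / \<epsilon> n))))
      = (1 + ?r n) * (\<epsilon> n / sqrt (pi * ln (real (p n) / \<epsilon> n)))"
      using elim(1) by simp
    moreover have "measure (response_law n (p n) (X n) (\<beta> n) (\<sigma> n))
              {y \<in> space (response_law n (p n) (X n) (\<beta> n) (\<sigma> n)).
                 noise_event n (p n) (X n) y (\<beta> n) (lam0 n) \<xi>}
        \<ge> 1 - real (p n) * (sqrt (real n / (real n - 3)) *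
          (exp (- ln (real (p n) / \<epsilon> n)) / sqrt (pi * ln (real (p n) / \<epsilon> n))))"
      by (rule noise_event_probability[OF \<xi> elim(5) _ _ elim(4) _ elim(3)]) (use elim(1,2) in auto)
    ultimately show ?case by (simp only:)
  qed
qed

text \<open>
  A Slutsky argument at the level of distribution functions: on the good event the perturbation
  is bounded by a deterministic null sequence, and the limit is continuous.
\<close>

lemma scaled_lasso_sigma_clt:
  fixes p :: "nat \<Rightarrow> nat" and \<sigma> lam0 :: "nat \<Rightarrow> real"
  assumes \<xi>: "\<xi> > 1"
    and \<sigma>: "\<forall>\<^sub>F n in sequentially. \<sigma> n > 0"
    and X: "\<forall>\<^sub>F n in sequentially. \<forall>j<p n. (L2_set (\<lambda>i. X n i j) {..<n})\<^sup>2 = real n"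
    and p: "filterlim p at_top sequentially"
    and A: "A > (\<xi> + 1) / (\<xi> - 1)"
    and lam0: "\<forall>\<^sub>F n in sequentially. lam0 n = A * sqrt (2 / real n * ln (real (p n)))"
    and small: "(\<lambda>n. lam0 n * mu n (p n) (X n) (\<beta> n) (\<sigma> n * lam0 n) \<xi> / \<sigma> n) \<in> o(\<lambda>n. 1 / sqrt (real n))"
    and est: "\<forall>\<^sub>F n in sequentially.
          scaled_lasso_estimator n (p n) (X n) (lam0 n) (bhat n) (shat n) \<and>
          shat n \<in> borel_measurable (response_law n (p n) (X n) (\<beta> n) (\<sigma> n))"
  shows "weak_conv_m
          (\<lambda>n. distr (response_law n (p n) (X n) (\<beta> n) (\<sigma> n)) borel
                 (\<lambda>y. sqrt (real n) * (shat n y / \<sigma> n - 1)))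
          (density lborel (\<lambda>t. ennreal (normal_density 0 (sqrt (1 / 2)) t)))"
proof -
  let ?R = "\<lambda>n. response_law n (p n) (X n) (\<beta> n) (\<sigma> n)"
  define \<Phi> where "\<Phi> x = cdf std_normal_distribution (sqrt 2 * x)" for x
  define V where "V n y = sqrt (real n) * (sigma_star n (p n) (X n) y (\<beta> n) / \<sigma> n - 1)" for n y
  define U where "U n y = sqrt (real n) * (shat n y / \<sigma> n - 1)" for n y
  define F where "F n x = measure (?R n) {y \<in> space (?R n). V n y \<le> x}" for n x
  define L where "L n = ln (real (p n))" for n
  define w where "w n = sqrt (2 / real n * L n)" for n
  define zt where "zt n = measure (?R n) {y \<in> space (?R n). w n < z_star n (p n) (X n) y (\<beta> n)}" for n
  define d where "d n = lam0 n * mu n (p n) (X n) (\<beta> n) (\<sigma> n * lam0 n) \<xi> / \<sigma> n" for n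
  \<comment> \<open>The 16 is the constant of \<open>scaled_lasso_near_sigma_star\<close>, here
    after scaling by sqrt n.\<close>
  define \<delta> where "\<delta> n = 16 * (sqrt (real n) * d n)" for n
  \<comment> \<open>Bounds the probability that the noise exceeds \<open>w n\<close> or that the
    oracle scale leaves the range from \<sigma> / 2 to 2 \<sigma>. In terms of \<open>V\<close>, the
    two ends of that range are - sqrt n / 2 and sqrt n.\<close>
  define bad where "bad n = zt n + F n (- sqrt (real n) / 2) + (1 - F n (sqrt (real n)))" for n

  have Vm: "{y \<in> space (?R n). P (V n y)} \<in> sets (?R n)" if [measurable]: "Measurable.pred borel P" for n P
  proof -
    have "{y \<in> space (PiM {..<n} (\<lambda>_. borel)). P (V n y)} \<in> sets (PiM {..<n} (\<lambda>_. borel))"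
      unfolding V_def by measurable
    then show ?thesis using sets_eq_imp_space_eq[OF sets_response_law] by (simp add: sets_response_law)
  qed
  have Zm: "{y \<in> space (?R n). w n < z_star n (p n) (X n) y (\<beta> n)} \<in> sets (?R n)" for n
  proof -
    have "{y \<in> space (PiM {..<n} (\<lambda>_. borel)). w n < z_star n (p n) (X n) y (\<beta> n)} \<in> sets (PiM {..<n} (\<lambda>_. borel))"
      by measurable
    then show ?thesis using sets_eq_imp_space_eq[OF sets_response_law] by (simp add: sets_response_law)
  qed
  have F_mono: "\<forall>\<^sub>F n in sequentially. mono (F n)" and F_le: "\<forall>\<^sub>F n in sequentially. \<forall>x. F n x \<le> 1"
  proof -
    have "mono (F n) \<and> (\<forall>x. F n x \<le> 1)" if "\<sigma> n > 0" for n
    proof -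
      interpret R: prob_space "?R n" by (rule prob_space_response_law[OF that])
      show ?thesis unfolding F_def
        by (intro conjI monoI R.finite_measure_mono Vm allI R.prob_le_1) auto
    qed
    then show "\<forall>\<^sub>F n in sequentially. mono (F n)" "\<forall>\<^sub>F n in sequentially. \<forall>x. F n x \<le> 1"
      using \<sigma> by (auto elim!: eventually_mono)
  qed
  have F_lim: "(\<lambda>n. F n x) \<longlonglongrightarrow> \<Phi> x" for x
    unfolding F_def V_def \<Phi>_def by (rule sigma_star_clt[OF \<sigma>])
  interpret N: real_distribution std_normal_distribution by (rule real_dist_normal_dist)
  have \<Phi>_cont: "isCont \<Phi> x" for x
    unfolding \<Phi>_def by (rule isCont_o2[OF _ isCont_cdf_std_normal]) simp
  have \<Phi>_bot: "(\<Phi> \<longlongrightarrow> 0) at_bot" unfolding \<Phi>_def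
    by (rule filterlim_compose[OF N.cdf_lim_at_bot]) real_asymp
  have \<Phi>_top: "(\<Phi> \<longlongrightarrow> 1) at_top" unfolding \<Phi>_def
    by (rule filterlim_compose[OF N.cdf_lim_at_top_prob]) real_asymp

  have L_lim: "filterlim L at_top sequentially" unfolding L_def
    by (rule filterlim_compose[OF ln_at_top filterlim_compose[OF filterlim_real_sequentially p]])
  have p1: "\<forall>\<^sub>F n in sequentially. p n \<ge> 1" using p by (simp add: filterlim_at_top)
  \<comment> \<open>This is the tail bound at L = ln p: exp(-L) = 1 / p cancels the union bound, and
    1 / sqrt(pi ln p) tends to 0.\<close>
  have zt_lim: "zt \<longlonglongrightarrow> 0"
  proof (rule tendsto_sandwich[of "\<lambda>_. 0"])
    have "(\<lambda>n. sqrt (real n / (real n - 3))) \<longlonglongrightarrow> 1" by real_asymp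
    moreover have "((\<lambda>x. 1 / sqrt (pi * x)) \<longlongrightarrow> 0) at_top" by real_asymp
    then have "(\<lambda>n. 1 / sqrt (pi * L n)) \<longlonglongrightarrow> 0" using L_lim by (rule filterlim_compose)
    ultimately have "(\<lambda>n. sqrt (real n / (real n - 3)) * (1 / sqrt (pi * L n))) \<longlonglongrightarrow> 1 * 0"
      by (rule tendsto_mult)
    then show "(\<lambda>n. sqrt (real n / (real n - 3)) * (1 / sqrt (pi * L n))) \<longlonglongrightarrow> 0" by simp
    show "\<forall>\<^sub>F n in sequentially. zt n \<le> sqrt (real n / (real n - 3)) * (1 / sqrt (pi * L n))"
      using \<sigma> X p1 eventually_tail_exponent[OF L_lim] eventually_ge_at_top[of 4]
    proof eventually_elim
      case (elim n)
      have "exp (- L n) = 1 / real (p n)" using elim(3) by (simp add: L_def exp_minus inverse_eq_divide)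
      then show ?case
        using z_star_tail[OF elim(1,5,3,4), where X = "X n" and \<beta> = "\<beta> n"] elim(2,3)
        by (simp add: zt_def w_def)
    qed
  qed (auto simp: zt_def)
  have bad_lim: "bad \<longlonglongrightarrow> 0"
  proof -
    have "(\<lambda>n. F n (- sqrt (real n) / 2)) \<longlonglongrightarrow> 0"
    proof (rule mono_tendsto_moving_bot[OF F_mono _ F_lim \<Phi>_bot])
      show "filterlim (\<lambda>n. - sqrt (real n) / 2) at_bot sequentially" by real_asymp
    qed (simp add: F_def)
    moreover have "(\<lambda>n. F n (sqrt (real n))) \<longlonglongrightarrow> 1"
    proof (rule mono_tendsto_moving_top[OF F_mono F_le F_lim \<Phi>_top])
      show "filterlim (\<lambda>n. sqrt (real n)) at_top sequentially" by real_asymp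
    qed
    ultimately have "bad \<longlonglongrightarrow> 0 + 0 + (1 - 1)"
      unfolding bad_def by (intro tendsto_intros zt_lim)
    then show ?thesis by simp
  qed
  have \<delta>_lim: "\<delta> \<longlonglongrightarrow> 0" and d_lim: "d \<longlonglongrightarrow> 0"
  proof -
    have "(\<lambda>n. d n / (1 / sqrt (real n))) \<longlonglongrightarrow> 0"
      using smalloD_tendsto[OF small] by (simp add: d_def)
    then have *: "(\<lambda>n. sqrt (real n) * d n) \<longlonglongrightarrow> 0" by (simp add: mult.commute)
    then show "\<delta> \<longlonglongrightarrow> 0" unfolding \<delta>_def by (rule tendsto_mult_right_zero)
    have "(\<lambda>n. 1 / sqrt (real n)) \<longlonglongrightarrow> 0" by real_asymp
    from tendsto_mult[OF * this] have "(\<lambda>n. sqrt (real n) * d n * (1 / sqrt (real n))) \<longlonglongrightarrow> 0" by simp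
    moreover have "\<forall>\<^sub>F n in sequentially. sqrt (real n) * d n * (1 / sqrt (real n)) = d n"
      using eventually_ge_at_top[of 1] by eventually_elim simp
    ultimately show "d \<longlonglongrightarrow> 0" by (rule Lim_transform_eventually)
  qed
  have A0: "A > 0" using A \<xi> by (smt (verit) divide_pos_pos)
  have A1: "A * (\<xi> - 1) / (\<xi> + 1) > 1" using A \<xi> by (simp add: pos_divide_less_eq)
  \<comment> \<open>Since \<open>lam0 n = A * w n\<close>, the strict inequality for
    \<open>A\<close> leaves a margin that eventually absorbs the factor 1 - 4 d, so z_star <= w n
    implies the noise condition.\<close>
  have ev_A: "\<forall>\<^sub>F n in sequentially. 1 < (1 - 4 * d n) * (A * (\<xi> - 1) / (\<xi> + 1))"
  proof (rule order_tendstoD)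
    have "(\<lambda>n. (1 - 4 * d n) * (A * (\<xi> - 1) / (\<xi> + 1))) \<longlonglongrightarrow> (1 - 4 * 0) * (A * (\<xi> - 1) / (\<xi> + 1))"
      by (intro tendsto_intros d_lim)
    then show "(\<lambda>n. (1 - 4 * d n) * (A * (\<xi> - 1) / (\<xi> + 1))) \<longlonglongrightarrow> A * (\<xi> - 1) / (\<xi> + 1)" by simp
  qed (rule A1)
  have ev_d: "\<forall>\<^sub>F n in sequentially. d n < 1 / 8" using d_lim by (rule order_tendstoD) simp
  have ev_L: "\<forall>\<^sub>F n in sequentially. L n \<ge> 1" using L_lim by (simp add: filterlim_at_top)

  have sandwich: "\<forall>\<^sub>F n in sequentially. \<forall>x.
      F n (x - \<delta> n) - bad n \<le> measure (?R n) {y \<in> space (?R n). U n y \<le> x} \<and>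
      measure (?R n) {y \<in> space (?R n). U n y \<le> x} \<le> F n (x + \<delta> n) + bad n"
    using \<sigma> p1 lam0 est ev_A ev_d ev_L eventually_ge_at_top[of 1]
  proof eventually_elim
    case (elim n)
    interpret R: prob_space "?R n" by (rule prob_space_response_law[OF elim(1)])
    have n0: "real n > 0" using elim(8) by simp
    have w0: "w n > 0" using elim(7) n0 by (simp add: w_def)
    have lam: "lam0 n = A * w n" using elim(3) by (simp add: w_def L_def)
    have lam_pos: "lam0 n > 0" using A0 w0 by (simp add: lam)
    define B where "B = {y \<in> space (?R n). w n < z_star n (p n) (X n) y (\<beta> n)} \<union>
        {y \<in> space (?R n). V n y \<le> - sqrt (real n) / 2} \<union> {y \<in> space (?R n). sqrt (real n) < V n y}"
    have Bm: "B \<in> sets (?R n)" unfolding B_def by (intro sets.Un Zm Vm) measurable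
    have "measure (?R n) {y \<in> space (?R n). sqrt (real n) < V n y} = 1 - F n (sqrt (real n))"
    proof -
      have "{y \<in> space (?R n). sqrt (real n) < V n y} = space (?R n) - {y \<in> space (?R n). V n y \<le> sqrt (real n)}"
        by auto
      moreover have "{y \<in> space (?R n). V n y \<le> sqrt (real n)} \<in> sets (?R n)" by (rule Vm) measurable
      ultimately show ?thesis unfolding F_def by (simp only: R.prob_compl)
    qed
    moreover have "measure (?R n) B \<le> zt n + F n (- sqrt (real n) / 2)
        + measure (?R n) {y \<in> space (?R n). sqrt (real n) < V n y}"
    proof -
      have V1: "{y \<in> space (?R n). V n y \<le> - sqrt (real n) / 2} \<in> sets (?R n)" by (rule Vm) measurable
      have V2: "{y \<in> space (?R n). sqrt (real n) < V n y} \<in> sets (?R n)" by (rule Vm) measurable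
      show ?thesis unfolding B_def zt_def F_def
        using measure_Un_le[OF sets.Un[OF Zm V1] V2] measure_Un_le[OF Zm V1] by linarith
    qed
    ultimately have B: "measure (?R n) B \<le> bad n" by (simp add: bad_def)
    have close: "\<bar>U n y - V n y\<bar> \<le> \<delta> n" if y: "y \<in> space (?R n)" "y \<notin> B" for y
    proof -
      define s where "s = sigma_star n (p n) (X n) y (\<beta> n)"
      have z: "z_star n (p n) (X n) y (\<beta> n) \<le> w n"
        and V1: "- sqrt (real n) / 2 < V n y" and V2: "V n y \<le> sqrt (real n)"
        using y by (auto simp: B_def not_less not_le)
      have "sqrt (real n) * (- 1 / 2) < sqrt (real n) * (s / \<sigma> n - 1)"
        using V1 by (simp add: V_def s_def)
      then have "- 1 / 2 < s / \<sigma> n - 1" using n0 by (simp only: mult_less_cancel_left_pos real_sqrt_gt_zero)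
      then have s1: "\<sigma> n / 2 \<le> s" using elim(1) by (simp add: field_simps)
      have "sqrt (real n) * (s / \<sigma> n - 1) \<le> sqrt (real n) * 1"
        using V2 by (simp add: V_def s_def)
      then have "s / \<sigma> n - 1 \<le> 1" using n0 by (simp only: mult_le_cancel_left_pos real_sqrt_gt_zero)
      then have s2: "s \<le> 2 * \<sigma> n" using elim(1) by (simp add: field_simps)
      have "w n * 1 \<le> w n * ((1 - 4 * d n) * (A * (\<xi> - 1) / (\<xi> + 1)))"
        using elim(5) w0 by (intro mult_left_mono) auto
      then have z': "z_star n (p n) (X n) y (\<beta> n) \<le> (1 - 4 * d n) * lam0 n * (\<xi> - 1) / (\<xi> + 1)"
        using z by (simp add: lam mult_ac)
      have "y \<in> {..<n} \<rightarrow>\<^sub>E UNIV" using y by (simp add: space_response_law)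
      then have "\<bar>shat n y - s\<bar> \<le> 16 * d n * \<sigma> n"
        using scaled_lasso_near_sigma_star[OF \<xi> elim(8,2) lam_pos elim(1) conjunct1[OF elim(4)] _ _ _ _ z' d_def]
          s1 s2 elim(6) by (simp add: s_def)
      then have "\<bar>shat n y - s\<bar> / \<sigma> n \<le> 16 * d n" using elim(1) by (simp add: pos_divide_le_eq)
      then have "sqrt (real n) * (\<bar>shat n y - s\<bar> / \<sigma> n) \<le> sqrt (real n) * (16 * d n)"
        by (rule mult_left_mono) simp
      moreover have "U n y - V n y = sqrt (real n) * ((shat n y - s) / \<sigma> n)"
        by (simp add: U_def V_def s_def diff_divide_distrib algebra_simps)
      then have "\<bar>U n y - V n y\<bar> = sqrt (real n) * (\<bar>shat n y - s\<bar> / \<sigma> n)"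
        using elim(1) by (simp add: abs_mult)
      ultimately show ?thesis by (simp add: \<delta>_def mult_ac)
    qed
    have Um: "{y \<in> space (?R n). U n y \<le> x} \<in> sets (?R n)" for x
    proof -
      have [measurable]: "shat n \<in> borel_measurable (?R n)" using elim(4) by simp
      show ?thesis unfolding U_def by measurable
    qed
    have VM: "{y \<in> space (?R n). V n y \<le> x} \<in> sets (?R n)" for x by (rule Vm) measurable
    show ?case
    proof
      fix x
      have "measure (?R n) {y \<in> space (?R n). U n y \<le> x} \<le> measure (?R n) ({y \<in> space (?R n). V n y \<le> x + \<delta> n} \<union> B)"
      proof (rule R.finite_measure_mono)
        show "{y \<in> space (?R n). U n y \<le> x} \<subseteq> {y \<in> space (?R n). V n y \<le> x + \<delta> n} \<union> B"
          using close by (auto simp: abs_le_iff) (smt (verit))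
      qed (intro sets.Un VM Bm)
      also have "\<dots> \<le> F n (x + \<delta> n) + measure (?R n) B"
        unfolding F_def by (intro measure_Un_le VM Bm)
      finally have upper: "measure (?R n) {y \<in> space (?R n). U n y \<le> x} \<le> F n (x + \<delta> n) + bad n" using B by simp
      have "F n (x - \<delta> n) \<le> measure (?R n) ({y \<in> space (?R n). U n y \<le> x} \<union> B)"
        unfolding F_def
      proof (rule R.finite_measure_mono)
        show "{y \<in> space (?R n). V n y \<le> x - \<delta> n} \<subseteq> {y \<in> space (?R n). U n y \<le> x} \<union> B"
          using close by (auto simp: abs_le_iff) (smt (verit))
      qed (intro sets.Un Um Bm)
      also have "\<dots> \<le> measure (?R n) {y \<in> space (?R n). U n y \<le> x} + measure (?R n) B"
        by (intro measure_Un_le Um Bm)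
      finally show "F n (x - \<delta> n) - bad n \<le> measure (?R n) {y \<in> space (?R n). U n y \<le> x} \<and>
          measure (?R n) {y \<in> space (?R n). U n y \<le> x} \<le> F n (x + \<delta> n) + bad n"
        using upper B by simp
    qed
  qed

  have U_lim: "(\<lambda>n. measure (?R n) {y \<in> space (?R n). U n y \<le> x}) \<longlonglongrightarrow> \<Phi> x" for x
  proof (rule tendsto_sandwich)
    have "(\<lambda>n. F n (x - \<delta> n)) \<longlonglongrightarrow> \<Phi> x"
      using tendsto_diff[OF tendsto_const[of x] \<delta>_lim] by (intro mono_tendsto_moving[OF F_mono F_lim \<Phi>_cont]) simp
    from tendsto_diff[OF this bad_lim] show "(\<lambda>n. F n (x - \<delta> n) - bad n) \<longlonglongrightarrow> \<Phi> x" by simp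
    have "(\<lambda>n. F n (x + \<delta> n)) \<longlonglongrightarrow> \<Phi> x"
      using tendsto_add[OF tendsto_const[of x] \<delta>_lim] by (intro mono_tendsto_moving[OF F_mono F_lim \<Phi>_cont]) simp
    from tendsto_add[OF this bad_lim] show "(\<lambda>n. F n (x + \<delta> n) + bad n) \<longlonglongrightarrow> \<Phi> x" by simp
  \<comment> \<open>A single family of inequalities, uniform in x, supplies both sides of the
    squeeze; the shifts by \<delta> and the term \<open>bad\<close> vanish in the limit.\<close>
  qed (use sandwich in \<open>auto elim!: eventually_mono\<close>)
  have cdf_U: "\<forall>\<^sub>F n in sequentially. measure (?R n) {y \<in> space (?R n). U n y \<le> x}
      = cdf (distr (?R n) borel (\<lambda>y. sqrt (real n) * (shat n y / \<sigma> n - 1))) x" for x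
    using est
  proof eventually_elim
    case (elim n)
    then have [measurable]: "shat n \<in> borel_measurable (?R n)" by simp
    have "(\<lambda>y. sqrt (real n) * (shat n y / \<sigma> n - 1)) \<in> borel_measurable (?R n)" by measurable
    then have "cdf (distr (?R n) borel (\<lambda>y. sqrt (real n) * (shat n y / \<sigma> n - 1))) x
        = measure (?R n) ((\<lambda>y. sqrt (real n) * (shat n y / \<sigma> n - 1)) -` {..x} \<inter> space (?R n))"
      unfolding cdf_def by (rule measure_distr) simp
    also have "(\<lambda>y. sqrt (real n) * (shat n y / \<sigma> n - 1)) -` {..x} \<inter> space (?R n) = {y \<in> space (?R n). U n y \<le> x}"
      by (auto simp: U_def)
    finally show ?case ..
  qed
  have "cdf (density lborel (\<lambda>t. ennreal (normal_density 0 (sqrt (1 / 2)) t))) x = \<Phi> x" for x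
    unfolding \<Phi>_def by (subst cdf_normal) (simp_all add: real_sqrt_divide mult.commute)
  then show ?thesis unfolding weak_conv_m_def weak_conv_def
    using Lim_transform_eventually[OF U_lim cdf_U] by simp
qed

theorem theorem2:
  fixes \<xi> :: real
  assumes "\<xi> > 1"
  shows
   "(\<forall>(n::nat) (p::nat) (X :: nat \<Rightarrow> nat \<Rightarrow> real) (y :: nat \<Rightarrow> real) (\<beta> :: nat \<Rightarrow> real)
      (lam0::real) (bhat :: nat \<Rightarrow> real) (shat::real).
      n \<ge> 1 \<longrightarrow> p \<ge> 1 \<longrightarrow> lam0 > 0 \<longrightarrow>
      is_scaled_lasso n p X y lam0 bhat shat \<longrightarrow>
      sigma_star n p X y \<beta> > 0 \<longrightarrow>
      noise_event n p X y \<beta> lam0 \<xi> \<longrightarrow>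
        (let s = sigma_star n p X y \<beta>; \<tau> = tau_star n p X y \<beta> lam0 \<xi> in
          max (1 - shat / s) (1 - s / shat) \<le> \<tau>\<^sup>2 \<and>
          ereal (l1_norm {..<p} (\<lambda>j. bhat j - \<beta> j))
            \<le> (if \<tau> = 1 then \<infinity> else ereal (mu n p X \<beta> (s * lam0) \<xi> / (1 - \<tau>\<^sup>2)))))
    \<and>
    (\<forall>(p :: nat \<Rightarrow> nat) (X :: nat \<Rightarrow> nat \<Rightarrow> nat \<Rightarrow> real) (\<beta> :: nat \<Rightarrow> nat \<Rightarrow> real)
      (\<sigma> :: nat \<Rightarrow> real) (\<epsilon> :: nat \<Rightarrow> real) (lam0 :: nat \<Rightarrow> real).
      (\<forall>\<^sub>F n in sequentially. p n \<ge> 1 \<and> \<sigma> n > 0 \<and> \<epsilon> n > 0 \<and> lam0 n > 0) \<longrightarrow>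
      (\<forall>\<^sub>F n in sequentially. \<forall>j<p n. (L2_set (\<lambda>i. X n i j) {..<n})\<^sup>2 = real n) \<longrightarrow>
      (\<forall>\<^sub>F n in sequentially. AE y in response_law n (p n) (X n) (\<beta> n) (\<sigma> n).
          let \<tau> = tau_star n (p n) (X n) y (\<beta> n) (lam0 n) \<xi> in
          \<tau> < 1 \<and>
          lam0 n \<ge> sqrt (2 / real n * ln (real (p n) / \<epsilon> n)) * (\<xi> + 1)
                      / ((\<xi> - 1) * (1 - \<tau>\<^sup>2))) \<longrightarrow>
      (\<forall>\<^sub>F n in sequentially. real n - 2 > ln (real (p n) / \<epsilon> n)) \<longrightarrow>
      filterlim (\<lambda>n. ln (real (p n) / \<epsilon> n)) at_top sequentially \<longrightarrow>
        (\<exists>r :: nat \<Rightarrow> real. r \<longlonglongrightarrow> 0 \<and>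
          (\<forall>\<^sub>F n in sequentially.
            measure (response_law n (p n) (X n) (\<beta> n) (\<sigma> n))
              {y \<in> space (response_law n (p n) (X n) (\<beta> n) (\<sigma> n)).
                 noise_event n (p n) (X n) y (\<beta> n) (lam0 n) \<xi>}
            \<ge> 1 - (1 + r n) * (\<epsilon> n / sqrt (pi * ln (real (p n) / \<epsilon> n))))))
    \<and>
    (\<forall>(p :: nat \<Rightarrow> nat) (X :: nat \<Rightarrow> nat \<Rightarrow> nat \<Rightarrow> real) (\<beta> :: nat \<Rightarrow> nat \<Rightarrow> real)
      (\<sigma> :: nat \<Rightarrow> real) (lam0 :: nat \<Rightarrow> real) (A::real)
      (bhat :: nat \<Rightarrow> (nat \<Rightarrow> real) \<Rightarrow> nat \<Rightarrow> real) (shat :: nat \<Rightarrow> (nat \<Rightarrow> real) \<Rightarrow> real).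
      (\<forall>\<^sub>F n in sequentially. \<sigma> n > 0) \<longrightarrow>
      (\<forall>\<^sub>F n in sequentially. \<forall>j<p n. (L2_set (\<lambda>i. X n i j) {..<n})\<^sup>2 = real n) \<longrightarrow>
      filterlim p at_top sequentially \<longrightarrow>
      A > (\<xi> + 1) / (\<xi> - 1) \<longrightarrow>
      (\<forall>\<^sub>F n in sequentially. lam0 n = A * sqrt (2 / real n * ln (real (p n)))) \<longrightarrow>
      (\<lambda>n. lam0 n * mu n (p n) (X n) (\<beta> n) (\<sigma> n * lam0 n) \<xi> / \<sigma> n)
         \<in> o(\<lambda>n. 1 / sqrt (real n)) \<longrightarrow>
      (\<forall>\<^sub>F n in sequentially.
          scaled_lasso_estimator n (p n) (X n) (lam0 n) (bhat n) (shat n) \<and>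
          shat n \<in> borel_measurable (response_law n (p n) (X n) (\<beta> n) (\<sigma> n))) \<longrightarrow>
        weak_conv_m
          (\<lambda>n. distr (response_law n (p n) (X n) (\<beta> n) (\<sigma> n)) borel
                 (\<lambda>y. sqrt (real n) * (shat n y / \<sigma> n - 1)))
          (density lborel (\<lambda>t. ennreal (normal_density 0 (sqrt (1 / 2)) t))))"
proof (intro conjI allI impI, goal_cases)
  case (1 n p X y \<beta> lam0 bhat shat)
  define s where "s = sigma_star n p X y \<beta>"
  define \<tau> where "\<tau> = tau_star n p X y \<beta> lam0 \<xi>"
  note bounds = scaled_lasso_bounds[OF assms 1]
  have s0: "s > 0" and shat: "shat > 0" using 1 by (simp_all add: s_def is_scaled_lasso_iff)
  have \<tau>: "0 \<le> \<tau>" "\<tau>\<^sup>2 \<le> 1"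
    using tau_star_nonneg[OF assms, of lam0 n p X y \<beta>] noise_eventD(2)[OF assms 1(2,3,5,6)] 1(3)
    by (simp_all add: \<tau>_def)
  have "1 - shat / s \<le> \<tau>\<^sup>2" "1 - s / shat \<le> \<tau>\<^sup>2"
  proof -
    have "1 - \<tau>\<^sup>2 \<le> shat / s" using bounds(1) s0 by (simp add: s_def \<tau>_def pos_le_divide_eq)
    then show "1 - shat / s \<le> \<tau>\<^sup>2" by simp
    have "1 - \<tau>\<^sup>2 \<le> s / shat" using bounds(2) shat by (simp add: s_def \<tau>_def pos_le_divide_eq)
    then show "1 - s / shat \<le> \<tau>\<^sup>2" by simp
  qed
  moreover have "ereal (l1_norm {..<p} (\<lambda>j. bhat j - \<beta> j))
      \<le> (if \<tau> = 1 then \<infinity> else ereal (mu n p X \<beta> (s * lam0) \<xi> / (1 - \<tau>\<^sup>2)))"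
  proof (cases "\<tau> = 1")
    case False
    then have "\<tau>\<^sup>2 < 1" using \<tau> power2_eq_1_iff[of \<tau>] by linarith
    then show ?thesis using bounds(3) False by (simp add: s_def \<tau>_def)
  qed simp
  ultimately show ?case unfolding Let_def s_def[symmetric] \<tau>_def[symmetric] by simp
next
  case (2 p X \<beta> \<sigma> \<epsilon> lam0)
  show ?case by (rule noise_event_asymptotic[OF assms 2(1,2,3,5)])
next
  case (3 p X \<beta> \<sigma> lam0 A bhat shat)
  show ?case by (rule scaled_lasso_sigma_clt[OF assms 3])
qed

end
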